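(* Let $T$ be a linear operator which is bounded on $L^2$ and admits a locally integrable kernel $K$ off the diagonal. If $K$ satisfies $$\sup_{R\in\mathcal{R}}\ \sup_{y,z\in R}\int_{(R^* )^c}|K(x,y)-K(x,z)|\,d\rho(x)<\infty,$$ then $T$ extends to a bounded operator from $H^1$ to $L^1$. If $K$ satisfies $$\sup_{R\in\mathcal{R}}\ \sup_{y,z\in R}\int_{(R^* )^c}|K(y,x)-K(z,x)|\,d\rho(x)<\infty,$$ then $T$ extends to a bounded operator from $L^\infty$ to $BMO$.
   Context: Let $d\geq 1$ be an integer and $S=\mathbb{R}^d\ltimes\mathbb{R}^+$ the group with product $(x,a)\cdot(x',a')=(x+a\,x',a\,a')$, endowed with the metric (also denoted $d$) induced by the left-invariant Riemannian metric $ds^2=a^{-2}(dx^2+da^2)$ and with the right Haar measure $d\rho(x,a)=a^{-1}\,dx\,da$. Write $L^p=L^p(S,\rho)$ with norm $\|\cdot\|_p$. A Calderón--Zygmund set is a set $R=Q\times[ae^{-r},ae^r]$, where $Q$ is a dyadic cube in $\mathbb{R}^d$ of side $L$, $a\in\mathbb{R}^+$, $r>0$, and $e^2ar\leq L<e^8ar$ if $r<1$, while $ae^{2r}\leq L<ae^{8r}$ if $r\geq1$. $\mathcal{R}$ denotes the family of all Calderón--Zygmund sets. It is known that there are a constant $\kappa_0$ and, for every $R\in\mathcal{R}$, a point $x_R\in S$ and a number $r_R>0$ such that $R\subseteq B(x_R,\kappa_0r_R)$ and the dilated set $R^*=\{x\in S: d(x,R)<r_R\}$ satisfies $\rho(R^*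 )\leq\kappa_0\,\rho(R)$; such $\kappa_0$, $x_R$, $r_R$ are fixed once and for all. $H^1=H^{1,\infty}$ consists of all $h\in L^1$ such that $h=\sum_j\lambda_ja_j$ with $\sum_j|\lambda_j|<\infty$, $\lambda_j\in\mathbb{C}$, and $a_j$ $(1,\infty)$-atoms, i.e. functions supported in a Calderón--Zygmund set $R$ with $\|a_j\|_\infty\leq\rho(R)^{-1}$ and $\int a_j\,d\rho=0$; $\|h\|_{H^1}$ is the infimum of $\sum_j|\lambda_j|$ over all such decompositions. For $f\in L^1_{\mathrm{loc}}$, $f_R=\frac{1}{\rho(R)}\int_Rf\,d\rho$ and $\|f\|_*=\sup_{R\in\mathcal{R}}\frac{1}{\rho(R)}\int_R|f-f_R|\,d\rho$. $BMO$ is the space of all $f\in L^1_{\mathrm{loc}}$ with $\|f\|_*<\infty$, modulo constant functions, with norm $\|\cdot\|_*$. "$T$ admits a locally integrable kernel $K$ off the diagonal" has the usual meaning: $K$ is locally integrable on $\{(x,y)\in S\times S: x\neq y\}$ and, for bounded $f$ with compact support, $Tf(x)=\int K(x,y)f(y)\,d\rho(y)$ for almost every $x\notin\operatorname{supp}f$. *)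

theory Defs
  imports "HOL-Analysis.Analysis" "HOL-Probability.Essential_Supremum"
begin

section \<open>The space $S$ with its metric and its measure\<close>

text \<open>
  The dimension $d \ge 1$ is \<open>CARD('n)\<close>. The group $S$ is the upper half-space inside
  \<open>(real ^ 'n) \<times> real\<close>; functions on $S$ are functions on the ambient type whose values
  outside \<open>half_space\<close> play no role. The group law enters only through the metric and the
  measure.
\<close>

type_synonym 'n pt = "(real ^ 'n) \<times> real"

type_synonym 'n cfun = "'n pt \<Rightarrow> complex"

definition half_space :: "'n::finite pt set" where
  "half_space = {p. snd p > 0}"

definition rho :: "'n::finite pt measure" where
  "rho = density lborel (\<lambda>p. indicator half_space p * ennreal (1 / snd p))"

text \<open>
  The length is a Lebesgue integral in \<^typ>\<open>ennreal\<close>, not \<^const>\<open>integral\<close>: a path satisfying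
  \<^const>\<open>valid_path\<close> may have an unbounded, non-integrable derivative at a break point, and it
  then gets length $\infty$ rather than $0$.
\<close>

definition riem_length :: "(real \<Rightarrow> 'n::finite pt) \<Rightarrow> ennreal" where
  "riem_length g =
     (\<integral>\<^sup>+t\<in>{0..1}. ennreal (norm (vector_derivative g (at t)) / snd (g t)) \<partial>lborel)"

definition riem_dist :: "'n::finite pt \<Rightarrow> 'n pt \<Rightarrow> real" where
  "riem_dist p q = enn2real (Inf {riem_length g | g.
     valid_path g \<and> path_image g \<subseteq> half_space \<and> pathstart g = p \<and> pathfinish g = q})"

definition riem_ball :: "'n::finite pt \<Rightarrow> real \<Rightarrow> 'n pt set" where
  "riem_ball p s = {q \<in> half_space. riem_dist p q < s}"

definition riem_setdist :: "'n::finite pt \<Rightarrow> 'n pt set \<Rightarrow> real" where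
  "riem_setdist p R = (INF q\<in>R. riem_dist p q)"


section \<open>Calderon--Zygmund sets\<close>

definition dyadic_cube :: "int \<Rightarrow> ('n::finite \<Rightarrow> int) \<Rightarrow> (real ^ 'n) set" where
  "dyadic_cube k m =
     {x. \<forall>i. of_int (m i) * 2 powi k \<le> x $ i \<and> x $ i < (of_int (m i) + 1) * 2 powi k}"

definition CZ_sets :: "'n::finite pt set set" where
  "CZ_sets = {dyadic_cube k m \<times> {a * exp (- r)..a * exp r} | k m a r.
     a > 0 \<and> r > 0 \<and>
     (r < 1 \<longrightarrow> exp 2 * a * r \<le> 2 powi k \<and> 2 powi k < exp 8 * a * r) \<and>
     (r \<ge> 1 \<longrightarrow> a * exp (2 * r) \<le> 2 powi k \<and> 2 powi k < a * exp (8 * r))}"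

definition dilated :: "('n::finite pt set \<Rightarrow> real) \<Rightarrow> 'n pt set \<Rightarrow> 'n pt set" where
  "dilated rR R = {p \<in> half_space. riem_setdist p R < rR R}"

definition CZ_data ::
  "real \<Rightarrow> ('n::finite pt set \<Rightarrow> 'n pt) \<Rightarrow> ('n pt set \<Rightarrow> real) \<Rightarrow> bool" where
  "CZ_data \<kappa> xR rR \<longleftrightarrow> (\<forall>R\<in>CZ_sets.
     xR R \<in> half_space \<and> rR R > 0 \<and> R \<subseteq> riem_ball (xR R) (\<kappa> * rR R) \<and>
     emeasure rho (dilated rR R) \<le> ennreal \<kappa> * emeasure rho R)"


section \<open>Function spaces\<close>

definition Lp :: "real \<Rightarrow> 'n::finite cfun set" where
  "Lp p = {f \<in> borel_measurable rho. integrable rho (\<lambda>x. norm (f x) powr p)}"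

definition Lp_norm :: "real \<Rightarrow> 'n::finite cfun \<Rightarrow> real" where
  "Lp_norm p f = (\<integral>x. norm (f x) powr p \<partial>rho) powr (1 / p)"

definition Linf_norm :: "'n::finite cfun \<Rightarrow> ennreal" where
  "Linf_norm f = esssup rho (\<lambda>x. ennreal (norm (f x)))"

definition Linf :: "'n::finite cfun set" where
  "Linf = {f \<in> borel_measurable rho. Linf_norm f < \<infinity>}"

definition L1_loc :: "'n::finite cfun set" where
  "L1_loc = {f \<in> borel_measurable rho.
     \<forall>C. compact C \<and> C \<subseteq> half_space \<longrightarrow> set_integrable rho C f}"

definition atom :: "'n::finite cfun \<Rightarrow> bool" where
  "atom a \<longleftrightarrow> a \<in> Lp 1 \<and> (\<exists>R\<in>CZ_sets.
     (AE x in rho. x \<notin> R \<longrightarrow> a x = 0) \<and>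
     Linf_norm a \<le> 1 / emeasure rho R \<and>
     (\<integral>x. a x \<partial>rho) = 0)"

text \<open>
  Atoms have $L^1$ norm at most $1$, so the series in an atomic decomposition converges
  absolutely in $L^1$. Finite decompositions are covered by vanishing coefficients.
\<close>

definition atomic_decomp ::
  "'n::finite cfun \<Rightarrow> (nat \<Rightarrow> complex) \<Rightarrow> (nat \<Rightarrow> 'n cfun) \<Rightarrow> bool" where
  "atomic_decomp h c a \<longleftrightarrow> (\<forall>j. atom (a j)) \<and> summable (\<lambda>j. norm (c j)) \<and>
     (\<lambda>N. Lp_norm 1 (\<lambda>x. h x - (\<Sum>j<N. c j * a j x))) \<longlonglongrightarrow> 0"

definition H1 :: "'n::finite cfun set" where
  "H1 = {h \<in> Lp 1. \<exists>c a. atomic_decomp h c a}"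

definition H1_norm :: "'n::finite cfun \<Rightarrow> real" where
  "H1_norm h = Inf {(\<Sum>j. norm (c j)) | c a. atomic_decomp h c a}"

definition average :: "'n::finite pt set \<Rightarrow> 'n cfun \<Rightarrow> complex" where
  "average R f = (1 / measure rho R) *\<^sub>R (LINT x:R|rho. f x)"

definition BMO_norm :: "'n::finite cfun \<Rightarrow> ennreal" where
  "BMO_norm f = (SUP R\<in>CZ_sets.
     (1 / emeasure rho R) * (\<integral>\<^sup>+x\<in>R. ennreal (norm (f x - average R f)) \<partial>rho))"

definition BMO :: "'n::finite cfun set" where
  "BMO = {f \<in> L1_loc. BMO_norm f < \<infinity>}"


section \<open>Operators\<close>

text \<open>
  Elements of the function spaces are represented by functions. Equality in the $L^p$ spaces
  and in $H^1$ is \<open>ae_eq\<close>; equality in \<open>BMO\<close> is \<open>eq_mod_const\<close>. Linearity in the sense of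
  \<open>linear_on_upto\<close> together with a norm bound makes an operator well defined on equivalence
  classes.
\<close>

definition ae_eq :: "'n::finite cfun \<Rightarrow> 'n cfun \<Rightarrow> bool" where
  "ae_eq f g \<longleftrightarrow> (AE x in rho. f x = g x)"

definition eq_mod_const :: "'n::finite cfun \<Rightarrow> 'n cfun \<Rightarrow> bool" where
  "eq_mod_const f g \<longleftrightarrow> (\<exists>c. AE x in rho. f x = g x + c)"

definition linear_on_upto ::
  "('n::finite cfun \<Rightarrow> 'n cfun \<Rightarrow> bool) \<Rightarrow> 'n cfun set \<Rightarrow> ('n cfun \<Rightarrow> 'n cfun) \<Rightarrow> bool" where
  "linear_on_upto eq V T \<longleftrightarrow>
     (\<forall>f\<in>V. \<forall>g\<in>V. eq (T (\<lambda>x. f x + g x)) (\<lambda>x. T f x + T g x)) \<and>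
     (\<forall>c. \<forall>f\<in>V. eq (T (\<lambda>x. c * f x)) (\<lambda>x. c * T f x))"

definition bounded_on_L2 :: "('n::finite cfun \<Rightarrow> 'n cfun) \<Rightarrow> bool" where
  "bounded_on_L2 T \<longleftrightarrow> linear_on_upto ae_eq (Lp 2) T \<and> (\<forall>f\<in>Lp 2. T f \<in> Lp 2) \<and>
     (\<exists>C. \<forall>f\<in>Lp 2. Lp_norm 2 (T f) \<le> C * Lp_norm 2 f)"

definition extends_H1_L1 :: "('n::finite cfun \<Rightarrow> 'n cfun) \<Rightarrow> bool" where
  "extends_H1_L1 T \<longleftrightarrow> (\<exists>U. linear_on_upto ae_eq H1 U \<and> (\<forall>h\<in>H1. U h \<in> Lp 1) \<and>
     (\<exists>C. \<forall>h\<in>H1. Lp_norm 1 (U h) \<le> C * H1_norm h) \<and>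
     (\<forall>h\<in>H1 \<inter> Lp 2. ae_eq (U h) (T h)))"

definition extends_Linf_BMO :: "('n::finite cfun \<Rightarrow> 'n cfun) \<Rightarrow> bool" where
  "extends_Linf_BMO T \<longleftrightarrow> (\<exists>U. linear_on_upto eq_mod_const Linf U \<and> (\<forall>f\<in>Linf. U f \<in> BMO) \<and>
     (\<exists>C. \<forall>f\<in>Linf. BMO_norm (U f) \<le> ennreal C * Linf_norm f) \<and>
     (\<forall>f\<in>Linf \<inter> Lp 2. eq_mod_const (U f) (T f)))"

definition supp :: "'n::finite cfun \<Rightarrow> 'n pt set" where
  "supp f = half_space \<inter> closure {x \<in> half_space. f x \<noteq> 0}"

definition has_kernel ::
  "('n::finite cfun \<Rightarrow> 'n cfun) \<Rightarrow> ('n pt \<Rightarrow> 'n pt \<Rightarrow> complex) \<Rightarrow> bool" where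
  "has_kernel T K \<longleftrightarrow>
     (\<forall>C. compact C \<and> C \<subseteq> {(x, y). x \<in> half_space \<and> y \<in> half_space \<and> x \<noteq> y} \<longrightarrow>
        set_integrable (rho \<Otimes>\<^sub>M rho) C (\<lambda>(x, y). K x y)) \<and>
     (\<forall>f\<in>borel_measurable rho. bounded (f ` half_space) \<and> compact (supp f) \<longrightarrow>
        (AE x in rho. x \<notin> supp f \<longrightarrow> T f x = (\<integral>y. K x y * f y \<partial>rho)))"

end

theory Submission
  imports Defs "HOL-Library.Function_Algebras"
begin

text \<open>
  The common basis of both parts is the classical estimate $\|Ta\|_1 \le C$ for atoms
  (\<open>cancelling_image_L1\<close>): on the dilated set $R^*$, Cauchy--Schwarz and the $L^2$ bound
  suffice because $\rho(R^*)$ is comparable to $\rho(R)$; off $R^*$ the cancellation of $a$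
  replaces the kernel by its increments, which the hypothesis controls.

  For the first part it remains to pass from atoms to infinite sums of atoms, although $T$ is not
  defined on $L^1$ and an atomic decomposition is not unique. This is done by duality, in place of
  a weak type estimate. Let $S$ be the transpose of $T$, which exists by the Riesz representation
  theorem for $L^2$. For a relatively compact set $A$ the function $g = S 1_A$ satisfies
  $|\int a g\,d\rho| = |\int_A Ta\,d\rho| \le C$ for all atoms, that is, $g$ has bounded mean
  oscillation (\<open>oscillation_le_of_atoms\<close>). Clipping $g$ at height $n$ at most doubles this bound,
  and the clipped functions $g_n$ may be paired with every function in $L^1$. So if
  $h = \sum_j c_j a_j$, then
  $\int h g_n\,d\rho = \sum_j c_j \int a_j g_n\,d\rho \to \sum_j c_j \int_A T a_j\,d\rho$
  (\<open>pairing_with_H1\<close>). The left-hand side depends on $h$ alone and is linear in $h$, and if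
  $h \in L^2$ its limit is $\int_A Th\,d\rho$. Hence $\sum_j c_j T a_j$ is a well-defined linear
  extension of $T$.

  For the second part, the transpose $S$ has the kernel $K(y,x)$
  (\<open>regular_kernel_transpose\<close>), so the atom estimate holds for $S$, and $Uf$ is required to satisfy
  $\int (Uf) a\,d\rho = \int f\,Sa\,d\rho$ for all atoms $a$. The bound on the mean oscillation is
  then \<open>oscillation_le_of_atoms\<close> again. On a single set $R$ a solution is
  $T(f 1_{R^*})(x) + \int_{(R^*)^c} (K(x,y) - K(z,y)) f(y)\,d\rho(y)$ with $z \in R$
  (\<open>represents_on_exists\<close>), solutions on the same set differ by constants, and normalised solutions
  on an exhausting sequence are glued. Dyadic cubes do not cross the
  coordinate hyperplanes, so the solution is unique only up to one constant for each orthant, while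
  $U$ has to be linear and to extend $T$ modulo one global constant. The constants are therefore chosen
  by a linear selection along a Hamel basis of $L^\infty$ that extends one of
  $L^\infty \cap L^2$, on which $Tf$ itself is the selected solution (\<open>linear_selection\<close>).
\<close>

section \<open>Square-integrable functions and absolutely convergent series\<close>

lemma AE_summable_norm:
  fixes f :: "nat \<Rightarrow> 'a \<Rightarrow> 'b::{banach, second_countable_topology}"
  assumes int: "\<And>j. integrable M (f j)" and sm: "summable (\<lambda>j. \<integral>x. norm (f j x) \<partial>M)"
  shows "AE x in M. summable (\<lambda>j. norm (f j x))"
proof -
  note [measurable] = borel_measurable_integrable[OF int]
  have "(\<integral>\<^sup>+x. (\<Sum>j. ennreal (norm (f j x))) \<partial>M) = (\<Sum>j. \<integral>\<^sup>+x. ennreal (norm (f j x)) \<partial>M)"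
    by (intro nn_integral_suminf) measurable
  also have "\<dots> = (\<Sum>j. ennreal (\<integral>x. norm (f j x) \<partial>M))"
    using int by (intro suminf_cong nn_integral_eq_integral) auto
  also have "\<dots> = ennreal (\<Sum>j. \<integral>x. norm (f j x) \<partial>M)"
    using sm by (intro suminf_ennreal2) auto
  finally have "(\<integral>\<^sup>+x. (\<Sum>j. ennreal (norm (f j x))) \<partial>M) \<noteq> \<infinity>" by simp
  then have "AE x in M. (\<Sum>j. ennreal (norm (f j x))) \<noteq> \<infinity>"
    by (intro nn_integral_PInf_AE) auto
  then show ?thesis
    by eventually_elim (auto intro: summable_suminf_not_top)
qed

lemma L1_series:
  fixes f :: "nat \<Rightarrow> 'a \<Rightarrow> complex"
  assumes int: "\<And>j. integrable M (f j)" and sm: "summable (\<lambda>j. \<integral>x. norm (f j x) \<partial>M)"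
  defines "u \<equiv> \<lambda>x. \<Sum>j. f j x"
  shows "integrable M u" "(\<integral>x. norm (u x) \<partial>M) \<le> (\<Sum>j. \<integral>x. norm (f j x) \<partial>M)"
    and "\<And>\<phi> B. \<phi> \<in> borel_measurable M \<Longrightarrow> (\<And>x. norm (\<phi> x) \<le> B) \<Longrightarrow>
      (\<lambda>j. \<integral>x. \<phi> x * f j x \<partial>M) sums (\<integral>x. \<phi> x * u x \<partial>M)"
proof -
  note AE = AE_summable_norm[OF int sm]
  note [measurable] = borel_measurable_integrable[OF int]
  show ui: "integrable M u"
    unfolding u_def by (rule integrable_suminf[OF int AE sm])
  have nint: "integrable M (\<lambda>x. norm (f j x))" for j using int by simp
  have AE': "AE x in M. summable (\<lambda>j. norm (norm (f j x)))" using AE by simp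
  have sm': "summable (\<lambda>j. \<integral>x. norm (norm (f j x)) \<partial>M)" using sm by simp
  have "(\<integral>x. norm (u x) \<partial>M) \<le> (\<integral>x. (\<Sum>j. norm (f j x)) \<partial>M)"
  proof (rule integral_mono_AE)
    show "integrable M (\<lambda>x. norm (u x))" using ui by simp
    show "integrable M (\<lambda>x. \<Sum>j. norm (f j x))" by (rule integrable_suminf[OF nint AE' sm'])
    show "AE x in M. norm (u x) \<le> (\<Sum>j. norm (f j x))"
      using AE by eventually_elim (auto simp: u_def intro: summable_norm)
  qed
  also have "\<dots> = (\<Sum>j. \<integral>x. norm (f j x) \<partial>M)" by (rule integral_suminf[OF nint AE' sm'])
  finally show "(\<integral>x. norm (u x) \<partial>M) \<le> (\<Sum>j. \<integral>x. norm (f j x) \<partial>M)" .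
  fix \<phi> :: "'a \<Rightarrow> complex" and B
  assume \<phi>[measurable]: "\<phi> \<in> borel_measurable M" and B: "\<And>x. norm (\<phi> x) \<le> B"
  have B0: "B \<ge> 0" using B norm_ge_zero order_trans by blast
  have pt: "norm (\<phi> x * f j x) \<le> B * norm (f j x)" for x j
    unfolding norm_mult by (intro mult_right_mono B) auto
  have pi: "integrable M (\<lambda>x. \<phi> x * f j x)" for j
  proof (rule Bochner_Integration.integrable_bound[OF integrable_mult_right[OF nint[of j], of B]])
    show "AE x in M. norm (\<phi> x * f j x) \<le> norm (B * norm (f j x))"
      using pt B0 by (intro AE_I2) (simp add: abs_mult)
  qed measurable
  have "(\<lambda>j. \<integral>x. \<phi> x * f j x \<partial>M) sums (\<integral>x. (\<Sum>j. \<phi> x * f j x) \<partial>M)"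
  proof (rule sums_integral[OF pi])
    show "AE x in M. summable (\<lambda>j. norm (\<phi> x * f j x))"
      using AE by eventually_elim (auto simp: norm_mult intro: summable_mult)
    show "summable (\<lambda>j. \<integral>x. norm (\<phi> x * f j x) \<partial>M)"
    proof (rule summable_comparison_test'[OF summable_mult[OF sm, of B]])
      fix j :: nat
      have "(\<integral>x. norm (\<phi> x * f j x) \<partial>M) \<le> (\<integral>x. B * norm (f j x) \<partial>M)"
        using pi[of j] nint[of j] pt by (intro integral_mono) auto
      then show "norm (\<integral>x. norm (\<phi> x * f j x) \<partial>M) \<le> B * (\<integral>x. norm (f j x) \<partial>M)" by simp
    qed
  qed
  also have "(\<integral>x. (\<Sum>j. \<phi> x * f j x) \<partial>M) = (\<integral>x. \<phi> x * u x \<partial>M)"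
  proof (rule integral_cong_AE)
    show "(\<lambda>x. \<Sum>j. \<phi> x * f j x) \<in> borel_measurable M" by measurable
    show "(\<lambda>x. \<phi> x * u x) \<in> borel_measurable M" using borel_measurable_integrable[OF ui] by measurable
    show "AE x in M. (\<Sum>j. \<phi> x * f j x) = \<phi> x * u x"
      using AE by eventually_elim (auto simp: u_def intro!: suminf_mult summable_norm_cancel)
  qed
  finally show "(\<lambda>j. \<integral>x. \<phi> x * f j x \<partial>M) sums (\<integral>x. \<phi> x * u x \<partial>M)" .
qed

lemma integrable_times_bounded:
  fixes h \<phi> :: "'a \<Rightarrow> complex"
  assumes h: "integrable M h" and \<phi>: "\<phi> \<in> borel_measurable M" "\<And>x. norm (\<phi> x) \<le> B"
  shows "integrable M (\<lambda>x. h x * \<phi> x)" "norm (\<integral>x. h x * \<phi> x \<partial>M) \<le> B * (\<integral>x. norm (h x) \<partial>M)"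
proof -
  note [measurable] = borel_measurable_integrable[OF h] \<phi>(1)
  have B0: "B \<ge> 0" using \<phi>(2) norm_ge_zero order_trans by blast
  have bi: "integrable M (\<lambda>x. B * norm (h x))" using h by simp
  have pt: "norm (h x * \<phi> x) \<le> B * norm (h x)" for x
    using mult_left_mono[OF \<phi>(2)[of x] norm_ge_zero[of "h x"]] by (simp add: norm_mult mult.commute)
  show i: "integrable M (\<lambda>x. h x * \<phi> x)"
    by (rule Bochner_Integration.integrable_bound[OF bi]) (use pt B0 in \<open>auto intro!: AE_I2 simp: abs_mult\<close>)
  have "norm (\<integral>x. h x * \<phi> x \<partial>M) \<le> (\<integral>x. norm (h x * \<phi> x) \<partial>M)" by (rule integral_norm_bound)
  also have "\<dots> \<le> (\<integral>x. B * norm (h x) \<partial>M)" using i bi pt by (intro integral_mono) auto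
  finally show "norm (\<integral>x. h x * \<phi> x \<partial>M) \<le> B * (\<integral>x. norm (h x) \<partial>M)" by simp
qed

lemma indicator_integral_complex:
  assumes "A \<in> sets M" "emeasure M A < \<infinity>"
  shows "integrable M (indicator A :: 'a \<Rightarrow> complex)"
    and "(\<integral>x. indicator A x \<partial>M) = complex_of_real (measure M A)"
proof -
  have *: "(indicator A :: 'a \<Rightarrow> complex) = (\<lambda>x. complex_of_real (indicator A x))"
    by (auto simp: indicator_def)
  have i: "integrable M (indicator A :: 'a \<Rightarrow> real)"
    using assms by (rule integrable_real_indicator)
  show "integrable M (indicator A :: 'a \<Rightarrow> complex)" unfolding * using i by (rule integrable_of_real)
  have "(\<integral>x. indicator A x \<partial>M) = complex_of_real (\<integral>x. indicator A x \<partial>M)"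
    unfolding * by (rule integral_complex_of_real)
  then show "(\<integral>x. indicator A x \<partial>M) = complex_of_real (measure M A)"
    using sets.sets_into_space[OF assms(1)] by (simp add: Int_absorb2)
qed

definition square_integrable :: "'a measure \<Rightarrow> ('a \<Rightarrow> complex) \<Rightarrow> bool" where
  "square_integrable M f \<longleftrightarrow>
     f \<in> borel_measurable M \<and> integrable M (\<lambda>x. (norm (f x))\<^sup>2)"

definition sq_norm :: "'a measure \<Rightarrow> ('a \<Rightarrow> complex) \<Rightarrow> real" where
  "sq_norm M f = (\<integral>x. (norm (f x))\<^sup>2 \<partial>M)"

lemma square_integrable_measurable [measurable_dest]:
  "square_integrable M f \<Longrightarrow> f \<in> borel_measurable M"
  by (simp add: square_integrable_def)

lemma sq_norm_nonneg [simp]: "sq_norm M f \<ge> 0"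
  by (simp add: sq_norm_def)

lemma mult_le_sum_squares: "(a::real) * b \<le> a\<^sup>2 + b\<^sup>2"
proof -
  have "0 \<le> (a - b)\<^sup>2" "0 \<le> a\<^sup>2 + b\<^sup>2" by simp_all
  then show ?thesis by (simp only: power2_diff)
qed

lemma norm_add_square_le: "(norm (a + b :: complex))\<^sup>2 \<le> 2 * (norm a)\<^sup>2 + 2 * (norm b)\<^sup>2"
proof -
  have "(norm (a + b))\<^sup>2 \<le> (norm a + norm b)\<^sup>2"
    by (intro power_mono norm_triangle_ineq) auto
  also have "\<dots> \<le> 2 * (norm a)\<^sup>2 + 2 * (norm b)\<^sup>2"
    using sum_squares_bound[of "norm a" "norm b"] by (simp add: power2_sum)
  finally show ?thesis .
qed

lemma square_integrable_add:
  assumes "square_integrable M f" "square_integrable M g"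
  shows "square_integrable M (\<lambda>x. f x + g x)"
  unfolding square_integrable_def
proof
  note [measurable] = assms[THEN square_integrable_measurable]
  show "(\<lambda>x. f x + g x) \<in> borel_measurable M" by measurable
  show "integrable M (\<lambda>x. (norm (f x + g x))\<^sup>2)"
  proof (rule Bochner_Integration.integrable_bound)
    show "integrable M (\<lambda>x. 2 * (norm (f x))\<^sup>2 + 2 * (norm (g x))\<^sup>2)"
      using assms by (auto simp: square_integrable_def)
    show "AE x in M. norm ((norm (f x + g x))\<^sup>2) \<le> norm (2 * (norm (f x))\<^sup>2 + 2 * (norm (g x))\<^sup>2)"
      using norm_add_square_le by (intro AE_I2) auto
  qed measurable
qed

lemma square_integrable_cmult:
  assumes "square_integrable M f"
  shows "square_integrable M (\<lambda>x. c * f x)"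
  using assms by (auto simp: square_integrable_def norm_mult power_mult_distrib)

lemma sq_norm_cmult: "sq_norm M (\<lambda>x. c * f x) = (norm c)\<^sup>2 * sq_norm M f"
  by (simp add: sq_norm_def norm_mult power_mult_distrib)

lemma square_integrable_diff:
  assumes "square_integrable M f" "square_integrable M g"
  shows "square_integrable M (\<lambda>x. f x - g x)"
  using square_integrable_add[OF assms(1) square_integrable_cmult[OF assms(2), of "-1"]] by simp

lemma square_integrable_cnj:
  "square_integrable M f \<Longrightarrow> square_integrable M (\<lambda>x. cnj (f x))"
  using measurable_compose[of f M borel cnj, OF _ borel_measurable_continuous_onI]
  by (auto simp: square_integrable_def intro: continuous_intros)

lemma sq_norm_cnj: "sq_norm M (\<lambda>x. cnj (f x)) = sq_norm M f"
  by (simp add: sq_norm_def)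

lemma integrable_mult_square_integrable:
  assumes "square_integrable M f" "square_integrable M g"
  shows "integrable M (\<lambda>x. f x * g x)"
proof (rule Bochner_Integration.integrable_bound)
  note [measurable] = assms[THEN square_integrable_measurable]
  show "integrable M (\<lambda>x. (norm (f x))\<^sup>2 + (norm (g x))\<^sup>2)"
    using assms by (auto simp: square_integrable_def)
  show "AE x in M. norm (f x * g x) \<le> norm ((norm (f x))\<^sup>2 + (norm (g x))\<^sup>2)"
    using mult_le_sum_squares by (intro AE_I2) (auto simp: norm_mult)
  show "(\<lambda>x. f x * g x) \<in> borel_measurable M" by measurable
qed

lemma nn_integral_sq_norm:
  "square_integrable M f \<Longrightarrow> (\<integral>\<^sup>+x. (ennreal (norm (f x)))\<^sup>2 \<partial>M) = ennreal (sq_norm M f)"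
  unfolding square_integrable_def sq_norm_def
  by (subst nn_integral_eq_integral[symmetric]) (auto simp: ennreal_power)

lemma Cauchy_Schwarz_integral:
  assumes "square_integrable M f" "square_integrable M g"
  shows "(\<integral>x. norm (f x) * norm (g x) \<partial>M)\<^sup>2 \<le> sq_norm M f * sq_norm M g"
proof -
  note [measurable] = assms[THEN square_integrable_measurable]
  have "integrable M (\<lambda>x. norm (f x) * norm (g x))"
    using integrable_mult_square_integrable[OF assms, THEN integrable_norm] by (simp add: norm_mult)
  then have "ennreal (\<integral>x. norm (f x) * norm (g x) \<partial>M)
      = (\<integral>\<^sup>+x. ennreal (norm (f x)) * ennreal (norm (g x)) \<partial>M)"
    by (subst nn_integral_eq_integral[symmetric]) (auto simp: ennreal_mult)
  then have "ennreal ((\<integral>x. norm (f x) * norm (g x) \<partial>M)\<^sup>2)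
      = (\<integral>\<^sup>+x. ennreal (norm (f x)) * ennreal (norm (g x)) \<partial>M)\<^sup>2"
    by (simp flip: ennreal_power)
  also have "\<dots> \<le> ennreal (sq_norm M f) * ennreal (sq_norm M g)"
    using Cauchy_Schwarz_nn_integral[of "\<lambda>x. ennreal (norm (f x))" M "\<lambda>x. ennreal (norm (g x))"]
    by (simp add: nn_integral_sq_norm assms)
  finally show ?thesis
    by (simp add: ennreal_mult[symmetric] ennreal_le_iff)
qed

lemma Cauchy_Schwarz_norm:
  assumes "square_integrable M f" "square_integrable M g"
  shows "(norm (\<integral>x. f x * g x \<partial>M))\<^sup>2 \<le> sq_norm M f * sq_norm M g"
proof -
  have "norm (\<integral>x. f x * g x \<partial>M) \<le> (\<integral>x. norm (f x) * norm (g x) \<partial>M)"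
    using integral_norm_bound[of M "\<lambda>x. f x * g x"] by (simp add: norm_mult)
  then show ?thesis
    using Cauchy_Schwarz_integral[OF assms] by (meson order_trans power_mono norm_ge_zero)
qed

lemma sq_norm_parallelogram:
  assumes "square_integrable M f" "square_integrable M g"
  shows "sq_norm M (\<lambda>x. f x - g x) + sq_norm M (\<lambda>x. f x + g x) = 2 * sq_norm M f + 2 * sq_norm M g"
proof -
  have *: "(norm (a - b))\<^sup>2 + (norm (a + b))\<^sup>2 = 2 * (norm a)\<^sup>2 + 2 * (norm b)\<^sup>2" for a b :: complex
    unfolding cmod_power2 by (simp add: power2_eq_square algebra_simps)
  have "sq_norm M (\<lambda>x. f x - g x) + sq_norm M (\<lambda>x. f x + g x)
     = (\<integral>x. (norm (f x - g x))\<^sup>2 + (norm (f x + g x))\<^sup>2 \<partial>M)"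
    using square_integrable_diff[OF assms] square_integrable_add[OF assms]
    by (simp add: sq_norm_def square_integrable_def)
  also have "\<dots> = 2 * sq_norm M f + 2 * sq_norm M g"
    unfolding * using assms by (simp add: sq_norm_def square_integrable_def)
  finally show ?thesis .
qed

text \<open>
  The increments are so small that the weighted square function $\sum_n 4^n |f_{n+1}-f_n|^2$ is
  integrable. It controls every increment pointwise by $2^{-n}$ times one fixed function, so the
  sequence converges almost everywhere, and the tails are dominated in $L^2$.
\<close>

lemma square_integrable_complete:
  fixes f :: "nat \<Rightarrow> 'a \<Rightarrow> complex"
  assumes sq: "\<And>n. square_integrable M (f n)"
    and incr: "\<And>n. sq_norm M (\<lambda>x. f (Suc n) x - f n x) \<le> C * (1/16) ^ n"
  obtains g where "square_integrable M g" "(\<lambda>n. sq_norm M (\<lambda>x. f n x - g x)) \<longlonglongrightarrow> 0"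
proof -
  note [measurable] = sq[THEN square_integrable_measurable]
  define d where "d n x = f (Suc n) x - f n x" for n x
  define e where "e n x = 4 ^ n * (norm (d n x))\<^sup>2" for n x
  have d_sq: "square_integrable M (d n)" for n
    unfolding d_def by (intro square_integrable_diff sq)
  have [measurable]: "d n \<in> borel_measurable M" for n
    unfolding d_def by measurable
  have e_nonneg: "e n x \<ge> 0" for n x by (simp add: e_def)
  have e_int: "integrable M (e n)" for n
    using d_sq unfolding e_def square_integrable_def by simp
  have e_le: "(\<integral>x. e n x \<partial>M) \<le> C * (1/4) ^ n" for n
  proof -
    have "(\<integral>x. e n x \<partial>M) = 4 ^ n * sq_norm M (d n)"
      by (simp add: e_def sq_norm_def)
    also have "\<dots> \<le> 4 ^ n * (C * (1/16) ^ n)"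
      using incr[of n] by (simp add: d_def[abs_def])
    also have "\<dots> = C * (1/4) ^ n"
      by (simp add: power_divide power_mult_distrib[symmetric] field_simps)
    finally show ?thesis .
  qed
  have e_sum: "summable (\<lambda>n. \<integral>x. e n x \<partial>M)"
    by (rule summable_comparison_test'[of "\<lambda>n. C * (1/4) ^ n"])
       (use e_le e_nonneg in \<open>auto intro!: summable_mult summable_geometric integral_nonneg\<close>)
  have AE_sum: "AE x in M. summable (\<lambda>n. e n x)"
    using AE_summable_norm[OF e_int] e_sum e_nonneg by simp
  define E where "E x = (\<Sum>n. e n x)" for x
  have E_int: "integrable M E"
    unfolding E_def
    by (rule integrable_suminf) (use e_int AE_sum e_sum e_nonneg in auto)
  define g where "g x = f 0 x + (\<Sum>n. d n x)" for x
  have [measurable]: "g \<in> borel_measurable M" unfolding g_def by measurable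
  have pt: "(norm (f n x - g x))\<^sup>2 \<le> 4 * E x * (1/4) ^ n" if sm: "summable (\<lambda>n. e n x)" for n x
  proof -
    have E0: "E x \<ge> 0" unfolding E_def using sm e_nonneg by (intro suminf_nonneg) auto
    \<comment> \<open>one term of the series $E$ already dominates the increment\<close>
    have dle: "norm (d k x) \<le> sqrt (E x) * (1/2) ^ k" for k
    proof -
      have "e k x \<le> E x" unfolding E_def
        using sum_le_suminf[OF sm, of "{k}"] e_nonneg by simp
      moreover have "(2 ^ k)\<^sup>2 = (4::real) ^ k"
        by (subst power_mult[symmetric], subst mult.commute, subst power_mult) simp
      ultimately have "(2 ^ k * norm (d k x))\<^sup>2 \<le> E x"
        by (simp add: e_def power_mult_distrib)
      then have "2 ^ k * norm (d k x) \<le> sqrt (E x)"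
        by (rule real_le_rsqrt)
      then show ?thesis by (simp add: field_simps power_divide)
    qed
    have sg: "summable (\<lambda>k. sqrt (E x) * (1/2) ^ k)"
      by (intro summable_mult summable_geometric) auto
    have sd: "summable (\<lambda>k. norm (d k x))"
      by (rule summable_comparison_test'[OF sg]) (use dle in auto)
    have "f n x = f 0 x + (\<Sum>k<n. d k x)"
      unfolding d_def by (simp add: sum_lessThan_telescope[of "\<lambda>k. f k x"])
    then have "g x - f n x = (\<Sum>k. d (k + n) x)"
      unfolding g_def using suminf_split_initial_segment[OF summable_norm_cancel[OF sd], of n] by simp
    also have "norm \<dots> \<le> (\<Sum>k. norm (d (k + n) x))"
      by (rule summable_norm) (use sd summable_iff_shift[of "\<lambda>k. norm (d k x)" n] in simp)
    also have "\<dots> \<le> (\<Sum>k. sqrt (E x) * (1/2) ^ n * (1/2) ^ k)"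
    proof (rule suminf_le)
      show "norm (d (k + n) x) \<le> sqrt (E x) * (1/2) ^ n * (1/2) ^ k" for k
        using dle[of "k + n"] by (simp add: power_add mult_ac)
      show "summable (\<lambda>k. norm (d (k + n) x))"
        using sd summable_iff_shift[of "\<lambda>k. norm (d k x)" n] by simp
      show "summable (\<lambda>k. sqrt (E x) * (1/2) ^ n * (1/2) ^ k)"
        by (intro summable_mult summable_geometric) auto
    qed
    also have "\<dots> = 2 * sqrt (E x) * (1/2) ^ n"
      by (subst suminf_mult) (auto simp: suminf_geometric summable_geometric)
    finally have "norm (f n x - g x) \<le> 2 * sqrt (E x) * (1/2) ^ n"
      by (simp add: norm_minus_commute)
    then have "(norm (f n x - g x))\<^sup>2 \<le> (2 * sqrt (E x) * (1/2) ^ n)\<^sup>2"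
      by (intro power_mono) auto
    also have "\<dots> = 4 * E x * ((1/2)\<^sup>2) ^ n"
      using E0 by (simp only: power_mult_distrib power_mult[symmetric] mult.commute[of 2 n]) simp
    also have "\<dots> = 4 * E x * (1/4) ^ n"
      by (simp add: power2_eq_square)
    finally show ?thesis .
  qed
  have bint: "integrable M (\<lambda>x. 4 * E x * (1/4) ^ n)" for n
    using E_int by simp
  have E_nonneg: "AE x in M. E x \<ge> 0"
    using AE_sum by eventually_elim (auto simp: E_def intro!: suminf_nonneg e_nonneg)
  have dint: "integrable M (\<lambda>x. (norm (f n x - g x))\<^sup>2)" for n
  proof (rule Bochner_Integration.integrable_bound[OF bint[of n]])
    show "AE x in M. norm ((norm (f n x - g x))\<^sup>2) \<le> norm (4 * E x * (1/4) ^ n)"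
      using AE_sum
    proof eventually_elim
      case (elim x)
      then show ?case using order_trans[OF pt[OF elim] abs_ge_self] by simp
    qed
  qed measurable
  have dsq: "square_integrable M (\<lambda>x. f n x - g x)" for n
    using dint by (simp add: square_integrable_def)
  have le: "sq_norm M (\<lambda>x. f n x - g x) \<le> (4 * (\<integral>x. E x \<partial>M)) * (1/4) ^ n" for n
  proof -
    have "sq_norm M (\<lambda>x. f n x - g x) \<le> (\<integral>x. 4 * E x * (1/4) ^ n \<partial>M)"
      unfolding sq_norm_def using AE_sum
      by (intro integral_mono_AE dint bint) (auto intro: pt elim: eventually_mono)
    then show ?thesis by simp
  qed
  have "(\<lambda>n. sq_norm M (\<lambda>x. f n x - g x)) \<longlonglongrightarrow> 0"
  proof (rule tendsto_sandwich[of "\<lambda>_. 0"])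
    show "(\<lambda>n. (4 * (\<integral>x. E x \<partial>M)) * (1/4::real) ^ n) \<longlonglongrightarrow> 0"
      by (intro tendsto_mult_right_zero LIMSEQ_realpow_zero) auto
  qed (use le in auto)
  moreover have "square_integrable M g"
    using square_integrable_diff[OF sq[of 0] dsq[of 0]] by simp
  ultimately show ?thesis using that by blast
qed

text \<open>
  The representing function is the conjugate of the minimiser of $\|f\|_2^2 - 2\,\mathrm{Re}\,l(f)$.
  A minimising sequence is Cauchy by the parallelogram law, and the first variation at the limit
  gives the real part of the identity; the imaginary part follows by testing with $\mathrm{i}h$.
\<close>

theorem L2_Riesz_representation:
  fixes l :: "('a \<Rightarrow> complex) \<Rightarrow> complex"
  assumes add: "\<And>f g. square_integrable M f \<Longrightarrow> square_integrable M g \<Longrightarrow>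
                  l (\<lambda>x. f x + g x) = l f + l g"
    and cmult: "\<And>c f. square_integrable M f \<Longrightarrow> l (\<lambda>x. c * f x) = c * l f"
    and bound: "\<And>f. square_integrable M f \<Longrightarrow> (norm (l f))\<^sup>2 \<le> C * sq_norm M f"
  obtains g where "square_integrable M g"
    "\<And>f. square_integrable M f \<Longrightarrow> l f = (\<integral>x. f x * g x \<partial>M)"
proof -
  define J where "J f = sq_norm M f - 2 * Re (l f)" for f
  have z_sq: "square_integrable M (\<lambda>x. 0)" by (simp add: square_integrable_def)
  define C' where "C' = max C 0"
  have bound': "(norm (l f))\<^sup>2 \<le> C' * sq_norm M f" if "square_integrable M f" for f
    using bound[OF that] mult_right_mono[of C C' "sq_norm M f"] by (auto simp: C'_def)
  define m where "m = Inf (J ` {f. square_integrable M f})"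
  have bdd: "bdd_below (J ` {f. square_integrable M f})"
  proof (rule bdd_belowI[of _ "- (C' + 1)"])
    fix y assume "y \<in> J ` {f. square_integrable M f}"
    then obtain f where f: "y = J f" "square_integrable M f" by auto
    have "(Re (l f))\<^sup>2 \<le> C' * sq_norm M f"
      using bound'[OF f(2)] cmod_power2[of "l f"] zero_le_power2[of "Im (l f)"] by linarith
    then have "Re (l f) \<le> sqrt (C' * sq_norm M f)" by (rule real_le_rsqrt)
    moreover have "2 * (sqrt C' * sqrt (sq_norm M f)) \<le> C' + sq_norm M f"
      using sum_squares_bound[of "sqrt C'" "sqrt (sq_norm M f)"] by (simp add: C'_def)
    ultimately show "- (C' + 1) \<le> y"
      unfolding f J_def by (simp add: real_sqrt_mult)
  qed
  have m_le: "m \<le> J f" if "square_integrable M f" for f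
    unfolding m_def using bdd that by (intro cInf_lower) auto
  have "\<exists>f. square_integrable M f \<and> J f < m + (1/16) ^ n" for n :: nat
  proof -
    have "\<exists>y\<in>J ` {f. square_integrable M f}. y < m + (1/16) ^ n"
      using z_sq unfolding m_def by (intro cInf_lessD) auto
    then show ?thesis by auto
  qed
  then obtain F where F_sq: "\<And>n. square_integrable M (F n)" and F_J: "\<And>n. J (F n) < m + (1/16) ^ n"
    by metis
  have l_mid: "l (\<lambda>x. (1/2) * (f x + g x)) = (l f + l g) / 2"
    if "square_integrable M f" "square_integrable M g" for f g
    using add[OF that] cmult[OF square_integrable_add[OF that], of "1/2"] by simp
  have incr: "sq_norm M (\<lambda>x. F (Suc n) x - F n x) \<le> 4 * (1/16) ^ n" for n
  proof -
    \<comment> \<open>the midpoint cannot do better than the infimum $m$\<close>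
    let ?h = "\<lambda>x. (1/2) * (F (Suc n) x + F n x)"
    have sqh: "square_integrable M ?h"
      by (intro square_integrable_cmult square_integrable_add F_sq)
    have "4 * sq_norm M ?h = sq_norm M (\<lambda>x. F (Suc n) x + F n x)"
      by (subst sq_norm_cmult) (simp add: power2_eq_square)
    then have "sq_norm M (\<lambda>x. F (Suc n) x - F n x)
        = 2 * J (F (Suc n)) + 2 * J (F n) - 4 * J ?h"
      using sq_norm_parallelogram[OF F_sq[of "Suc n"] F_sq[of n]]
      unfolding J_def l_mid[OF F_sq[of "Suc n"] F_sq[of n]] by (simp add: field_simps)
    also have "\<dots> \<le> 2 * (m + (1/16) ^ Suc n) + 2 * (m + (1/16) ^ n) - 4 * m"
    proof -
      have "2 * a + 2 * b - 4 * c \<le> 2 * (m + p) + 2 * (m + q) - 4 * m"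
        if "a < m + p" "b < m + q" "m \<le> c" for a b c p q :: real
        using that by argo
      then show ?thesis using F_J[of n] F_J[of "Suc n"] m_le[OF sqh] by blast
    qed
    also have "\<dots> \<le> 4 * (1/16) ^ n" by simp
    finally show ?thesis .
  qed
  obtain g where g: "square_integrable M g" "(\<lambda>n. sq_norm M (\<lambda>x. F n x - g x)) \<longlonglongrightarrow> 0"
    using square_integrable_complete[OF F_sq incr] by blast
  have expand: "sq_norm M (\<lambda>x. f x + of_real t * h x)
      = sq_norm M f + 2 * t * Re (\<integral>x. h x * cnj (f x) \<partial>M) + t\<^sup>2 * sq_norm M h"
    if f: "square_integrable M f" and h: "square_integrable M h" for f h t
  proof -
    have *: "(norm (a + of_real t * b))\<^sup>2 = (norm a)\<^sup>2 + 2 * t * Re (b * cnj a) + t\<^sup>2 * (norm b)\<^sup>2"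
      for a b :: complex
      unfolding cmod_power2 by (simp add: power2_eq_square algebra_simps)
    have int: "integrable M (\<lambda>x. h x * cnj (f x))"
      by (intro integrable_mult_square_integrable square_integrable_cnj f h)
    define w where "w x = Re (h x * cnj (f x))" for x
    have "integrable M w" "(\<integral>x. w x \<partial>M) = Re (\<integral>x. h x * cnj (f x) \<partial>M)"
      unfolding w_def using integrable_Re[OF int] integral_Re[OF int] by auto
    then show ?thesis
      using f h unfolding sq_norm_def * square_integrable_def w_def[symmetric] by simp
  qed
  have variation: "0 \<le> 2 * t * (Re (\<integral>x. h x * cnj (g x) \<partial>M) - Re (l h)) + t\<^sup>2 * sq_norm M h"
    if h: "square_integrable M h" for h t
  proof -
    let ?L = "\<lambda>f. 2 * t * (Re (\<integral>x. h x * cnj (f x) \<partial>M) - Re (l h)) + t\<^sup>2 * sq_norm M h"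
    have "- ((1/16) ^ n) \<le> ?L (F n)" for n :: nat
    proof -
      have sq: "square_integrable M (\<lambda>x. of_real t * h x)"
        by (intro square_integrable_cmult h)
      have "m \<le> J (\<lambda>x. F n x + of_real t * h x)"
        by (intro m_le square_integrable_add F_sq sq)
      also have "\<dots> = J (F n) + ?L (F n)"
        unfolding J_def expand[OF F_sq h] add[OF F_sq sq] cmult[OF h] by (simp add: algebra_simps)
      finally show ?thesis using F_J[of n] by linarith
    qed
    moreover have "(\<lambda>n. ?L (F n)) \<longlonglongrightarrow> ?L g"
    proof -
      have "(\<lambda>n. (\<integral>x. h x * cnj (F n x) \<partial>M) - (\<integral>x. h x * cnj (g x) \<partial>M)) \<longlonglongrightarrow> 0"
      proof (rule Lim_null_comparison)
        show "\<forall>\<^sub>F n in sequentially. norm ((\<integral>x. h x * cnj (F n x) \<partial>M) - (\<integral>x. h x * cnj (g x) \<partial>M))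
            \<le> sqrt (sq_norm M h * sq_norm M (\<lambda>x. F n x - g x))"
        proof (intro always_eventually allI)
          fix n
          have d: "square_integrable M (\<lambda>x. cnj (F n x - g x))"
            by (intro square_integrable_cnj square_integrable_diff F_sq g)
          have "(\<integral>x. h x * cnj (F n x) \<partial>M) - (\<integral>x. h x * cnj (g x) \<partial>M)
              = (\<integral>x. h x * cnj (F n x - g x) \<partial>M)"
            by (simp add: algebra_simps integrable_mult_square_integrable square_integrable_cnj F_sq g h)
          moreover have "norm (\<integral>x. h x * cnj (F n x - g x) \<partial>M)
              \<le> sqrt (sq_norm M h * sq_norm M (\<lambda>x. F n x - g x))"
            using Cauchy_Schwarz_norm[OF h d] by (simp only: sq_norm_cnj real_le_rsqrt)
          ultimately show "norm ((\<integral>x. h x * cnj (F n x) \<partial>M) - (\<integral>x. h x * cnj (g x) \<partial>M))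
            \<le> sqrt (sq_norm M h * sq_norm M (\<lambda>x. F n x - g x))" by simp
        qed
        have "(\<lambda>n. sqrt (sq_norm M h * sq_norm M (\<lambda>x. F n x - g x))) \<longlonglongrightarrow> sqrt (sq_norm M h * 0)"
          by (intro tendsto_intros g)
        then show "(\<lambda>n. sqrt (sq_norm M h * sq_norm M (\<lambda>x. F n x - g x))) \<longlonglongrightarrow> 0" by simp
      qed
      then have "(\<lambda>n. \<integral>x. h x * cnj (F n x) \<partial>M) \<longlonglongrightarrow> (\<integral>x. h x * cnj (g x) \<partial>M)"
        using Lim_null by blast
      then show ?thesis by (intro tendsto_intros)
    qed
    moreover have "(\<lambda>n. - ((1/16::real) ^ n)) \<longlonglongrightarrow> - 0"
      by (intro tendsto_minus LIMSEQ_realpow_zero) auto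
    ultimately show ?thesis
      using LIMSEQ_le[of "\<lambda>n. - ((1/16::real) ^ n)" "- 0" "\<lambda>n. ?L (F n)" "?L g"] by auto
  qed
  have Re_eq: "Re (\<integral>x. h x * cnj (g x) \<partial>M) = Re (l h)" if h: "square_integrable M h" for h
  proof (rule ccontr)
    define a where "a = Re (\<integral>x. h x * cnj (g x) \<partial>M) - Re (l h)"
    define b where "b = sq_norm M h + 1"
    assume "Re (\<integral>x. h x * cnj (g x) \<partial>M) \<noteq> Re (l h)"
    then have "a \<noteq> 0" by (simp add: a_def)
    have b: "b > 0" "sq_norm M h < b" by (auto simp: b_def intro: add_nonneg_pos)
    \<comment> \<open>this $t$ minimises the quadratic polynomial $2 t a + t^2 b$\<close>
    have "0 \<le> 2 * (- a / b) * a + (- a / b)\<^sup>2 * sq_norm M h"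
      using variation[OF h, of "- a / b"] by (simp add: a_def)
    also have "\<dots> \<le> 2 * (- a / b) * a + (- a / b)\<^sup>2 * b"
      using b by (intro add_left_mono mult_left_mono) auto
    also have "\<dots> = - (a\<^sup>2 / b)"
      using b by (simp add: field_simps power2_eq_square)
    finally show False
      using b \<open>a \<noteq> 0\<close> by (simp add: divide_le_0_iff)
  qed
  have "l h = (\<integral>x. h x * cnj (g x) \<partial>M)" if h: "square_integrable M h" for h
  proof (rule complex_eqI)
    show "Re (l h) = Re (\<integral>x. h x * cnj (g x) \<partial>M)" using Re_eq[OF h] by simp
    have "Re (\<integral>x. (\<i> * h x) * cnj (g x) \<partial>M) = Re (\<i> * l h)"
      using Re_eq[OF square_integrable_cmult[OF h, of \<i>]] cmult[OF h, of \<i>] by simp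
    then show "Im (l h) = Im (\<integral>x. h x * cnj (g x) \<partial>M)"
      by (simp add: mult.assoc)
  qed
  then show ?thesis
    using that[OF square_integrable_cnj[OF g(1)]] by blast
qed

section \<open>The right Haar measure\<close>

lemma sets_rho [measurable_cong, simp]: "sets rho = sets borel"
  by (simp add: rho_def)

lemma space_rho [simp]: "space rho = UNIV"
  by (simp add: rho_def)

lemma open_half_space: "open (half_space :: 'n::finite pt set)"
  unfolding half_space_def by (intro open_Collect_less continuous_intros)

lemma half_space_measurable [measurable]: "half_space \<in> sets borel"
  by (intro borel_open open_half_space)

lemma snd_measurable_borel [measurable]: "snd \<in> borel_measurable (borel :: 'n::finite pt measure)"
  by (intro borel_measurable_continuous_onI continuous_on_snd continuous_on_id)

lemma rho_density_measurable [measurable]: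
  "(\<lambda>p :: 'n::finite pt. indicator half_space p * ennreal (1 / snd p)) \<in> borel_measurable borel"
  by measurable

lemma AE_rho_half_space: "AE x in rho. x \<in> half_space"
  unfolding rho_def by (subst AE_density) (auto simp: indicator_def intro!: AE_I2 split: if_splits)

lemma null_sets_rhoI: "N \<in> null_sets lborel \<Longrightarrow> N \<in> null_sets rho"
  unfolding rho_def by (subst null_sets_density_iff) (auto intro: AE_not_in AE_mp)

lemma sigma_finite_rho: "sigma_finite_measure (rho :: 'n::finite pt measure)"
  unfolding rho_def
  by (subst sigma_finite_measure.sigma_finite_iff_density_finite[OF lborel.sigma_finite_measure_axioms]) (auto simp: indicator_def intro!: AE_I2)

interpretation rho: sigma_finite_measure "rho :: 'n::finite pt measure"
  by (rule sigma_finite_rho)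

interpretation rho_pair: pair_sigma_finite
  "rho :: 'n::finite pt measure" "rho :: 'n::finite pt measure" ..

lemma emeasure_rho_compact:
  assumes "compact C" "C \<subseteq> half_space"
  shows "emeasure rho C < \<infinity>"
proof (cases "C = {}")
  case False
  have "continuous_on C snd" by (intro continuous_intros)
  from continuous_attains_inf[OF assms(1) False this]
  obtain p where p: "p \<in> C" "\<And>x. x \<in> C \<Longrightarrow> snd p \<le> snd x" by metis
  have pos: "snd p > 0" using p(1) assms(2) by (auto simp: half_space_def)
  have Cb: "C \<in> sets borel" using assms(1) by (simp add: borel_compact)
  have "emeasure rho C = (\<integral>\<^sup>+x. indicator half_space x * ennreal (1 / snd x) * indicator C x \<partial>lborel)"
    unfolding rho_def using Cb by (subst emeasure_density) auto
  also have "\<dots> \<le> (\<integral>\<^sup>+x. ennreal (1 / snd p) * indicator C x \<partial>lborel)"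
    using p(2) pos by (intro nn_integral_mono) (auto simp: indicator_def intro!: ennreal_leI frac_le)
  also have "\<dots> = ennreal (1 / snd p) * emeasure lborel C"
    using Cb by (simp add: nn_integral_cmult_indicator)
  also have "\<dots> < \<infinity>"
    using emeasure_compact_finite[OF assms(1)] by (simp add: ennreal_mult_less_top)
  finally show ?thesis .
qed simp

lemma emeasure_rho_open_pos:
  assumes "open U" "U \<subseteq> half_space" "U \<noteq> {}"
  shows "emeasure rho U > 0"
proof (rule ccontr)
  assume "\<not> emeasure rho U > 0"
  then have "U \<in> null_sets rho" using assms(1) by (auto simp: null_sets_def)
  then have "AE x in lborel. x \<in> U \<longrightarrow> indicator half_space x * ennreal (1 / snd x) = 0"
    unfolding rho_def by (subst (asm) null_sets_density_iff) auto
  then have "AE x in lborel. x \<notin> U"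
    by eventually_elim (use assms(2) in \<open>auto simp: half_space_def indicator_def\<close>)
  then have "U \<in> null_sets lborel"
    using assms(1) by (subst AE_iff_null_sets) auto
  then have "negligible U"
    by (simp add: negligible_iff_null_sets null_sets_completionI)
  then show False using open_not_negligible assms by blast
qed

section \<open>Calderon--Zygmund sets\<close>

lemma dyadic_cube_measurable [measurable]: "dyadic_cube k m \<in> sets borel"
  unfolding dyadic_cube_def by measurable

text \<open>
  All measure-theoretic properties of a Calderon--Zygmund set come from squeezing it between an
  open and a closed box of the half-space with null difference.
\<close>

lemma CZ_set_between_boxes:
  assumes "R \<in> CZ_sets"
  obtains a b where "box a b \<subseteq> R" "R \<subseteq> cbox a b" "cbox a b \<subseteq> half_space" "box a b \<noteq> {}"
proof -
  obtain k m c r where R: "R = dyadic_cube k m \<times> {c * exp (- r)..c * exp r}" and cr: "c > 0" "r > 0"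
    using assms unfolding CZ_sets_def by blast
  define A B :: "real ^ 'a" where "A = (\<chi> i. of_int (m i) * 2 powi k)"
    and "B = (\<chi> i. (of_int (m i) + 1) * 2 powi k)"
  define lo hi where "lo = c * exp (- r)" and "hi = c * exp r"
  have lohi: "0 < lo" "lo < hi" using cr by (auto simp: lo_def hi_def)
  have pk: "(2::real) powi k > 0" by simp
  have lt: "of_int (m i) * 2 powi k < (of_int (m i) + 1) * (2::real) powi k" for i
    using pk by (simp add: algebra_simps)
  have boxP: "box (A, lo) (B, hi) = box A B \<times> box lo hi"
    by (auto simp: box_def Basis_prod_def)
  show ?thesis
  proof (rule that[of "(A, lo)" "(B, hi)"])
    show "box (A, lo) (B, hi) \<subseteq> R"
      unfolding boxP R by (auto simp: mem_box_cart dyadic_cube_def A_def B_def lo_def hi_def less_imp_le)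
    show "R \<subseteq> cbox (A, lo) (B, hi)"
      unfolding cbox_Pair_eq R
      by (auto simp: mem_box_cart dyadic_cube_def A_def B_def lo_def hi_def less_imp_le)
    show "cbox (A, lo) (B, hi) \<subseteq> half_space"
      using lohi unfolding cbox_Pair_eq half_space_def by auto
    have "box A B \<noteq> {}" using lt by (simp add: interval_ne_empty_cart A_def B_def)
    then show "box (A, lo) (B, hi) \<noteq> {}" unfolding boxP using lohi by auto
  qed
qed

lemma CZ_set_measurable: assumes "R \<in> CZ_sets" shows "R \<in> sets borel"
proof -
  obtain k m c r where R: "R = dyadic_cube k m \<times> {c * exp (- r)..c * exp r}"
    using assms unfolding CZ_sets_def by blast
  show ?thesis unfolding R by (intro borel_Times) auto
qed

lemma CZ_set_subset_half_space: "R \<in> CZ_sets \<Longrightarrow> R \<subseteq> half_space"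
  by (meson CZ_set_between_boxes order_trans)

lemma CZ_set_nonempty: "R \<in> CZ_sets \<Longrightarrow> R \<noteq> {}"
  by (metis CZ_set_between_boxes subset_empty)

text \<open>
  Kernels represent operators only off the closed support of a function. Closing a
  Calderon--Zygmund set adds a null set, so nothing is lost.
\<close>

lemma CZ_set_compact_hull:
  assumes "R \<in> CZ_sets"
  obtains C where "compact C" "C \<subseteq> half_space" "R \<subseteq> C" "C - R \<in> null_sets rho"
proof -
  obtain a b where ab: "box a b \<subseteq> R" "R \<subseteq> cbox a b" "cbox a b \<subseteq> half_space"
    using CZ_set_between_boxes[OF assms] by metis
  have "cbox a b - box a b \<in> null_sets lborel"
    using negligible_frontier_interval[of a b]
    by (auto simp: negligible_iff_null_sets null_sets_completion_iff)
  then have "cbox a b - R \<in> null_sets lborel"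
    using ab CZ_set_measurable[OF assms] by (auto intro: null_sets_subset)
  then show ?thesis
    using that[of "cbox a b"] ab null_sets_rhoI by auto
qed

lemma emeasure_CZ_set_finite: "R \<in> CZ_sets \<Longrightarrow> emeasure rho R < \<infinity>"
  by (metis CZ_set_compact_hull emeasure_mono emeasure_rho_compact le_less_trans borel_compact sets_rho)

lemma emeasure_CZ_set_pos: "R \<in> CZ_sets \<Longrightarrow> emeasure rho R > 0"
proof -
  assume R: "R \<in> CZ_sets"
  then obtain a b where ab: "box a b \<subseteq> R" "R \<subseteq> cbox a b" "cbox a b \<subseteq> half_space" "box a b \<noteq> {}"
    by (rule CZ_set_between_boxes)
  have "0 < emeasure rho (box a b)"
    using ab by (intro emeasure_rho_open_pos) auto
  also have "\<dots> \<le> emeasure rho R"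
    using ab CZ_set_measurable[OF R] by (intro emeasure_mono) auto
  finally show ?thesis .
qed

lemma measure_CZ_set_pos: "R \<in> CZ_sets \<Longrightarrow> measure rho R > 0"
  by (metis emeasure_CZ_set_finite emeasure_CZ_set_pos enn2real_positive_iff measure_def infinity_ennreal_def)

lemma emeasure_CZ_set: "R \<in> CZ_sets \<Longrightarrow> emeasure rho R = ennreal (measure rho R)"
  by (metis emeasure_CZ_set_finite emeasure_eq_ennreal_measure infinity_ennreal_def less_irrefl)


section \<open>Dilated sets are open\<close>

lemma riem_length_linepath_finite:
  assumes "p \<in> half_space" "q \<in> half_space"
  shows "riem_length (linepath p q) < \<infinity>"
proof -
  define \<mu> where "\<mu> = min (snd p) (snd q)"
  have \<mu>: "\<mu> > 0" using assms by (auto simp: \<mu>_def half_space_def)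
  have ge: "\<mu> \<le> snd (linepath p q t)" if "t \<in> {0..1}" for t
  proof -
    have "\<mu> = (1 - t) * \<mu> + t * \<mu>" by (simp add: algebra_simps)
    also have "\<dots> \<le> (1 - t) * snd p + t * snd q"
      using that by (intro add_mono mult_left_mono) (auto simp: \<mu>_def)
    finally show ?thesis by (simp add: linepath_def)
  qed
  have vd: "vector_derivative (linepath p q) (at t) = q - p" for t
    by (rule vector_derivative_at) (rule has_vector_derivative_linepath_within)
  have "riem_length (linepath p q) \<le> (\<integral>\<^sup>+(t::real)\<in>{0..1}. ennreal (norm (q - p) / \<mu>) \<partial>lborel)"
    unfolding riem_length_def vd
  proof (intro nn_integral_mono)
    fix t :: real
    show "ennreal (norm (q - p) / snd (linepath p q t)) * indicator {0..1} t
        \<le> ennreal (norm (q - p) / \<mu>) * indicator {0..1} t"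
      using frac_le[of "norm (q - p)" "norm (q - p)" \<mu> "snd (linepath p q t)"] ge[of t] \<mu>
      by (cases "t \<in> {0..1}") (auto intro!: ennreal_leI)
  qed
  also have "\<dots> < \<infinity>"
    by (simp add: nn_integral_cmult_indicator ennreal_mult_less_top)
  finally show ?thesis .
qed

lemma convex_half_space: "convex (half_space :: 'n::finite pt set)"
  using convex_linear_vimage[of "snd :: 'n::finite pt \<Rightarrow> real" "{0<..}"]
  by (simp add: half_space_def vimage_def linear_snd)

lemma riem_dist_less_path:
  assumes "p \<in> half_space" "q \<in> half_space" "riem_dist p q < s"
  obtains g where "valid_path g" "path_image g \<subseteq> half_space" "pathstart g = p" "pathfinish g = q"
    "riem_length g < ennreal s"
proof -
  let ?S = "{riem_length g | g.
     valid_path g \<and> path_image g \<subseteq> half_space \<and> pathstart g = p \<and> pathfinish g = q}"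
  have "riem_length (linepath p q) \<in> ?S"
    using assms(1,2) closed_segment_subset[OF _ _ convex_half_space, of p q]
    by (auto intro!: exI[of _ "linepath p q"])
  then have "Inf ?S < \<infinity>"
    using riem_length_linepath_finite[OF assms(1,2)] by (meson Inf_lower le_less_trans)
  then have "Inf ?S < ennreal s"
    using assms(3) unfolding riem_dist_def
    by (cases "Inf ?S") (auto simp: ennreal_less_iff)
  then show ?thesis using that by (auto simp: Inf_less_iff)
qed

lemma riem_dist_le_length:
  assumes "valid_path g" "path_image g \<subseteq> half_space" "pathstart g = p" "pathfinish g = q"
    "riem_length g \<le> ennreal s" "s \<ge> 0"
  shows "riem_dist p q \<le> s"
  unfolding riem_dist_def
  by (rule enn2real_leI[OF assms(6)], rule order_trans[OF Inf_lower assms(5)]) (use assms in blast)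

lemma riem_dist_refl:
  assumes "p \<in> half_space" shows "riem_dist p p \<le> 0"
proof (rule riem_dist_le_length[of "linepath p p"])
  have vd: "vector_derivative (linepath p p) (at t) = p - p" for t
    by (rule vector_derivative_at) (rule has_vector_derivative_linepath_within)
  show "riem_length (linepath p p) \<le> ennreal 0"
    unfolding riem_length_def vd by simp
qed (use assms in auto)

text \<open>
  Moving the starting point of a curve $g$ by $v$ is achieved by the curve $g(t) + (1-t)v$, whose
  length exceeds that of $g$ by an amount that vanishes with $v$.
\<close>

lemma riem_length_perturb:
  assumes g: "valid_path g" and img: "\<And>t. t \<in> {0..1} \<Longrightarrow> \<mu> \<le> snd (g t)"
    and v: "norm v \<le> \<delta>" "\<delta> < \<mu>" and l: "riem_length g = ennreal l" "l \<ge> 0"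
  shows "riem_length (\<lambda>t. g t + (1 - t) *\<^sub>R v) \<le> ennreal (\<mu> / (\<mu> - \<delta>) * l + \<delta> / (\<mu> - \<delta>))"
proof -
  have \<mu>: "0 \<le> \<delta>" "0 < \<mu>" "0 < \<mu> - \<delta>" using v norm_ge_zero[of v] by linarith+
  obtain S where S: "finite S" "g C1_differentiable_on {0..1} - S"
    using g unfolding valid_path_def piecewise_C1_differentiable_on_def by auto
  let ?h = "\<lambda>t. g t + (1 - t) *\<^sub>R v"
  have pt: "norm (vector_derivative ?h (at t)) / snd (?h t)
      \<le> \<mu> / (\<mu> - \<delta>) * (norm (vector_derivative g (at t)) / snd (g t)) + \<delta> / (\<mu> - \<delta>)"
    if t: "t \<in> {0..1} - S" for t
  proof -
    define D where "D = vector_derivative g (at t)"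
    have "(g has_vector_derivative D) (at t)"
      using S(2) t unfolding C1_differentiable_on_eq D_def by (simp add: vector_derivative_works)
    then have "(?h has_vector_derivative (D - v)) (at t)"
      by (auto intro!: derivative_eq_intros)
    then have vd: "vector_derivative ?h (at t) = D - v" by (rule vector_derivative_at)
    have sg: "\<mu> \<le> snd (g t)" using img t by auto
    have "\<bar>snd ((1 - t) *\<^sub>R v)\<bar> \<le> norm ((1 - t) *\<^sub>R v)"
      by (metis norm_snd_le real_norm_def prod.collapse)
    also have "\<dots> \<le> 1 * norm v"
      unfolding norm_scaleR using t by (intro mult_right_mono) auto
    also have "\<dots> \<le> \<delta>" using v by simp
    finally have sh: "snd (g t) - \<delta> \<le> snd (?h t)" by simp
    have pos: "snd (g t) - \<delta> > 0" using sg v by simp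
    have "norm (D - v) / snd (?h t) \<le> (norm D + \<delta>) / (snd (g t) - \<delta>)"
      using sh pos v(1) \<mu>(1) norm_triangle_ineq4[of D v] by (intro frac_le) auto
    also have "\<dots> = norm D / (snd (g t) - \<delta>) + \<delta> / (snd (g t) - \<delta>)"
      by (simp add: add_divide_distrib)
    also have "norm D / (snd (g t) - \<delta>) \<le> \<mu> / (\<mu> - \<delta>) * (norm D / snd (g t))"
    proof -
      have "\<delta> * \<mu> \<le> \<delta> * snd (g t)" using sg \<mu> by (intro mult_left_mono) auto
      then have "snd (g t) * (\<mu> - \<delta>) \<le> \<mu> * (snd (g t) - \<delta>)" by (simp add: algebra_simps)
      then have "1 / (snd (g t) - \<delta>) \<le> \<mu> / (\<mu> - \<delta>) * (1 / snd (g t))"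
        using pos \<mu> sg by (simp add: field_simps)
      from mult_left_mono[OF this norm_ge_zero[of D]] show ?thesis by (simp add: mult_ac)
    qed
    also have "\<delta> / (snd (g t) - \<delta>) \<le> \<delta> / (\<mu> - \<delta>)"
      using sg \<mu> pos by (intro divide_left_mono) auto
    finally show ?thesis by (simp add: vd D_def)
  qed
  \<comment> \<open>the break points are negligible for the length\<close>
  have "AE t in lborel. t \<notin> S"
    using S(1) by (intro AE_not_in finite_imp_null_set_lborel)
  then have "riem_length ?h \<le>
      (\<integral>\<^sup>+t\<in>{0..1}. ennreal (\<mu> / (\<mu> - \<delta>) * (norm (vector_derivative g (at t)) / snd (g t)) + \<delta> / (\<mu> - \<delta>)) \<partial>lborel)"
    unfolding riem_length_def
  proof (intro nn_integral_mono_AE, eventually_elim)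
    case (elim t)
    show ?case
    proof (cases "t \<in> {0..1}")
      case True
      with elim have "t \<in> {0..1} - S" by blast
      from ennreal_leI[OF pt[OF this]] True show ?thesis by (simp only: indicator_simps mult_1_right)
    qed simp
  qed
  also have "\<dots> = (\<integral>\<^sup>+t. ennreal (\<mu> / (\<mu> - \<delta>)) *
        (ennreal (norm (vector_derivative g (at t)) / snd (g t)) * indicator {0..1} t)
        + ennreal (\<delta> / (\<mu> - \<delta>)) * indicator {0..1} t \<partial>lborel)"
  proof (intro nn_integral_cong)
    fix t :: real
    show "ennreal (\<mu> / (\<mu> - \<delta>) * (norm (vector_derivative g (at t)) / snd (g t)) + \<delta> / (\<mu> - \<delta>)) * indicator {0..1} t
      = ennreal (\<mu> / (\<mu> - \<delta>)) * (ennreal (norm (vector_derivative g (at t)) / snd (g t)) * indicator {0..1} t)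
        + ennreal (\<delta> / (\<mu> - \<delta>)) * indicator {0..1} t"
    proof (cases "t \<in> {0..1}")
      case True
      have "norm (vector_derivative g (at t)) / snd (g t) \<ge> 0" using img[OF True] \<mu> by auto
      moreover have "0 \<le> \<mu> / (\<mu> - \<delta>)" "0 \<le> \<delta> / (\<mu> - \<delta>)" using \<mu> by simp_all
      moreover have "ennreal (a * b + c) = ennreal a * ennreal b + ennreal c"
        if "0 \<le> a" "0 \<le> b" "0 \<le> c" for a b c
        using that by (simp add: ennreal_plus ennreal_mult)
      ultimately show ?thesis using True by (simp only: indicator_simps mult_1_right)
    qed simp
  qed
  also have "\<dots> = ennreal (\<mu> / (\<mu> - \<delta>)) * riem_length g + ennreal (\<delta> / (\<mu> - \<delta>))"
  proof -
    let ?F = "\<lambda>t. ennreal (norm (vector_derivative g (at t)) / snd (g t)) * indicator {0..1} t"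
    have contg: "continuous_on {0..1} g"
      using g valid_path_imp_path path_def by blast
    have "continuous_on ({0..1} - S) (\<lambda>t. norm (vector_derivative g (at t)) / snd (g t))"
      using S(2) img \<mu> unfolding C1_differentiable_on_eq
      by (intro continuous_intros continuous_on_subset[OF contg]) force+
    then have "(\<lambda>t. norm (vector_derivative g (at t)) / snd (g t)) \<in> borel_measurable (restrict_space borel ({0..1} - S))"
      by (rule borel_measurable_continuous_on_restrict)
    moreover have "{0..1} - S \<in> sets borel" using S(1) by (intro sets.Diff borel_closed[OF closed_atLeastAtMost] borel_closed[OF finite_imp_closed])
    ultimately have "(\<lambda>t. indicator ({0..1} - S) t *\<^sub>R (norm (vector_derivative g (at t)) / snd (g t))) \<in> borel_measurable borel"
      by (subst (asm) borel_measurable_restrict_space_iff) auto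
    then have m: "(\<lambda>t. ennreal (indicator ({0..1} - S) t *\<^sub>R (norm (vector_derivative g (at t)) / snd (g t)))) \<in> borel_measurable lborel"
      by simp
    have eqF: "AE t in lborel. ?F t = ennreal (indicator ({0..1} - S) t *\<^sub>R (norm (vector_derivative g (at t)) / snd (g t)))"
      using \<open>AE t in lborel. t \<notin> S\<close> by eventually_elim (auto simp: indicator_def)
    have "(\<integral>\<^sup>+t. ennreal (\<mu> / (\<mu> - \<delta>)) * ?F t + ennreal (\<delta> / (\<mu> - \<delta>)) * indicator {0..1} t \<partial>lborel)
       = (\<integral>\<^sup>+t. ennreal (\<mu> / (\<mu> - \<delta>)) * ennreal (indicator ({0..1} - S) t *\<^sub>R (norm (vector_derivative g (at t)) / snd (g t)))
           + ennreal (\<delta> / (\<mu> - \<delta>)) * indicator {0..1} t \<partial>lborel)"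
      using eqF by (intro nn_integral_cong_AE, eventually_elim) simp
    also have "\<dots> = ennreal (\<mu> / (\<mu> - \<delta>)) * (\<integral>\<^sup>+t. ennreal (indicator ({0..1} - S) t *\<^sub>R (norm (vector_derivative g (at t)) / snd (g t))) \<partial>lborel)
        + ennreal (\<delta> / (\<mu> - \<delta>))"
      using m by (subst nn_integral_add) (auto simp: nn_integral_cmult nn_integral_cmult_indicator)
    also have "(\<integral>\<^sup>+t. ennreal (indicator ({0..1} - S) t *\<^sub>R (norm (vector_derivative g (at t)) / snd (g t))) \<partial>lborel)
        = riem_length g"
      unfolding riem_length_def using eqF by (intro nn_integral_cong_AE, eventually_elim) simp
    finally show ?thesis .
  qed
  also have "\<dots> = ennreal (\<mu> / (\<mu> - \<delta>) * l + \<delta> / (\<mu> - \<delta>))"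
    using \<mu> l ennreal_mult[of "\<mu> / (\<mu> - \<delta>)" l] by (simp add: ennreal_plus)
  finally show ?thesis .
qed

lemma riem_dist_less_open:
  assumes p: "p \<in> half_space" and q: "q \<in> half_space" and less: "riem_dist p q < s"
  shows "\<exists>\<delta>>0. \<forall>p'. dist p' p < \<delta> \<longrightarrow> riem_dist p' q < s"
proof -
  obtain g where g: "valid_path g" "path_image g \<subseteq> half_space" "pathstart g = p" "pathfinish g = q"
    and len: "riem_length g < ennreal s"
    by (rule riem_dist_less_path[OF assms])
  obtain l where l: "riem_length g = ennreal l" "l \<ge> 0"
    using len by (cases "riem_length g") auto
  have ls: "l < s" using len l by (simp add: ennreal_less_iff)
  have "compact (path_image g)" "path_image g \<noteq> {}"
    using g by (auto intro: compact_path_image valid_path_imp_path)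
  then obtain w where w: "w \<in> path_image g" "\<And>y. y \<in> path_image g \<Longrightarrow> snd w \<le> snd y"
    using continuous_attains_inf[of "path_image g" snd, OF _ _ continuous_on_snd[OF continuous_on_id]]
    by metis
  define \<mu> where "\<mu> = snd w"
  have \<mu>: "\<mu> > 0" using w g(2) by (auto simp: \<mu>_def half_space_def)
  have img: "\<mu> \<le> snd (g t)" if "t \<in> {0..1}" for t
    using w(2) that by (auto simp: \<mu>_def path_image_def)
  have "((\<lambda>\<delta>. \<mu> / (\<mu> - \<delta>) * l + \<delta> / (\<mu> - \<delta>)) \<longlongrightarrow> \<mu> / (\<mu> - 0) * l + 0 / (\<mu> - 0)) (at_right 0)"
    using \<mu> by (intro tendsto_intros) auto
  then have "((\<lambda>\<delta>. \<mu> / (\<mu> - \<delta>) * l + \<delta> / (\<mu> - \<delta>)) \<longlongrightarrow> l) (at_right 0)"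
    using \<mu> by simp
  then have "\<forall>\<^sub>F \<delta> in at_right 0. \<mu> / (\<mu> - \<delta>) * l + \<delta> / (\<mu> - \<delta>) < s"
    using ls by (rule order_tendstoD)
  moreover have "\<forall>\<^sub>F \<delta> in at_right 0. \<delta> < \<mu>" "\<forall>\<^sub>F \<delta>::real in at_right 0. 0 < \<delta>"
    using \<mu> by (auto simp: eventually_at_right_less eventually_at_right)
  ultimately have "\<forall>\<^sub>F \<delta> in at_right 0. \<mu> / (\<mu> - \<delta>) * l + \<delta> / (\<mu> - \<delta>) < s \<and> \<delta> < \<mu> \<and> 0 < \<delta>"
    by eventually_elim auto
  then obtain \<delta> where \<delta>: "\<mu> / (\<mu> - \<delta>) * l + \<delta> / (\<mu> - \<delta>) < s" "\<delta> < \<mu>" "0 < \<delta>"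
    using eventually_happens'[OF trivial_limit_at_right_real] by blast
  have "riem_dist p' q < s" if p': "dist p' p < \<delta>" for p'
  proof -
    let ?h = "\<lambda>t. g t + (1 - t) *\<^sub>R (p' - p)"
    have nv: "norm (p' - p) \<le> \<delta>" using p' by (simp add: dist_norm)
    have "riem_dist p' q \<le> \<mu> / (\<mu> - \<delta>) * l + \<delta> / (\<mu> - \<delta>)"
    proof (rule riem_dist_le_length[of ?h])
      show "valid_path ?h"
        unfolding valid_path_def
      proof (rule piecewise_C1_differentiable_add)
        show "g piecewise_C1_differentiable_on {0..1}" using g(1) by (simp add: valid_path_def)
        show "(\<lambda>t. (1 - t) *\<^sub>R (p' - p)) piecewise_C1_differentiable_on {0..1}"
          by (rule C1_differentiable_imp_piecewise) (intro derivative_intros)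
      qed
      show "path_image ?h \<subseteq> half_space"
      proof
        fix y assume "y \<in> path_image ?h"
        then obtain t where t: "t \<in> {0..1}" "y = ?h t" by (auto simp: path_image_def)
        have "\<bar>snd ((1 - t) *\<^sub>R (p' - p))\<bar> \<le> norm ((1 - t) *\<^sub>R (p' - p))"
          by (metis norm_snd_le real_norm_def prod.collapse)
        also have "\<dots> \<le> 1 * norm (p' - p)"
          unfolding norm_scaleR using t by (intro mult_right_mono) auto
        finally have "snd y \<ge> snd (g t) - \<delta>" using nv t by (simp add: abs_le_iff)
        then show "y \<in> half_space" using img[OF t(1)] \<delta> by (simp add: half_space_def)
      qed
      show "pathstart ?h = p'" "pathfinish ?h = q"
        using g(3,4) by (auto simp: pathstart_def pathfinish_def)
      show "riem_length ?h \<le> ennreal (\<mu> / (\<mu> - \<delta>) * l + \<delta> / (\<mu> - \<delta>))"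
        by (rule riem_length_perturb[OF g(1) img nv \<delta>(2) l])
      show "0 \<le> \<mu> / (\<mu> - \<delta>) * l + \<delta> / (\<mu> - \<delta>)"
        using \<mu> \<delta> l by auto
    qed
    then show ?thesis using \<delta> by simp
  qed
  then show ?thesis using \<delta> by blast
qed

lemma dilated_iff:
  assumes "R \<noteq> {}"
  shows "p \<in> dilated rR R \<longleftrightarrow> p \<in> half_space \<and> (\<exists>q\<in>R. riem_dist p q < rR R)"
proof -
  have "bdd_below (riem_dist p ` R)"
    by (rule bdd_belowI[of _ 0]) (auto simp: riem_dist_def)
  then show ?thesis
    using assms by (auto simp: dilated_def riem_setdist_def cINF_less_iff)
qed

text \<open>
  Openness makes the dilated set measurable, so that the bound on its measure can be used under
  integrals.
\<close>

lemma open_dilated: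
  assumes "R \<subseteq> half_space" "R \<noteq> {}"
  shows "open (dilated rR R)"
  unfolding open_dist
proof
  fix p assume "p \<in> dilated rR R"
  then obtain q where q: "p \<in> half_space" "q \<in> R" "riem_dist p q < rR R"
    using assms by (auto simp: dilated_iff)
  obtain \<delta> where \<delta>: "\<delta> > 0" "\<And>p'. dist p' p < \<delta> \<Longrightarrow> riem_dist p' q < rR R"
    using riem_dist_less_open[of p q "rR R"] q assms by blast
  obtain \<epsilon> where \<epsilon>: "\<epsilon> > 0" "\<And>p'. dist p' p < \<epsilon> \<Longrightarrow> p' \<in> half_space"
    using open_half_space q(1) unfolding open_dist by blast
  show "\<exists>e>0. \<forall>y. dist y p < e \<longrightarrow> y \<in> dilated rR R"
    using \<delta> \<epsilon> q(2) unfolding dilated_iff[OF assms(2)] by (intro exI[of _ "min \<delta> \<epsilon>"]) auto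
qed

lemma subset_dilated:
  assumes "R \<subseteq> half_space" "rR R > 0"
  shows "R \<subseteq> dilated rR R"
proof
  fix p assume p: "p \<in> R"
  then have "riem_dist p p < rR R" using riem_dist_refl[of p] assms by force
  then show "p \<in> dilated rR R" using p assms by (subst dilated_iff) auto
qed

section \<open>Exhaustion of the half-space by Calderon--Zygmund sets\<close>

text \<open>
  A dyadic cube never meets two orthants, so no increasing sequence of Calderon--Zygmund sets
  exhausts the half-space. There is one exhausting sequence for each of the finitely many sign
  patterns of the horizontal coordinates: an orthant is encoded by the index, with entries
  \<open>0\<close> and \<open>-1\<close>, of the dyadic cubes with a corner at the origin that it contains.
\<close>

definition orthants :: "('n::finite \<Rightarrow> int) set" where
  "orthants = {q. \<forall>i. q i \<in> {0, -1}}"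

definition orthant_of :: "'n::finite pt \<Rightarrow> 'n \<Rightarrow> int" where
  "orthant_of p = (\<lambda>i. if 0 \<le> fst p $ i then 0 else -1)"

text \<open>
  With $a = 1$ and $L = 2^N$, the radius $r = N \ln 2 / 4$ satisfies $e^{2r} = 2^{N/2} \le L$ and
  $L < 4^N = e^{8r}$, and it is at least $1$ as soon as $N \ge 6$.
\<close>

definition CZ_exhaustion :: "('n::finite \<Rightarrow> int) \<Rightarrow> nat \<Rightarrow> 'n pt set" where
  "CZ_exhaustion q n = dyadic_cube (int (n + 6)) q \<times>
     {exp (- (real (n + 6) * ln 2 / 4))..exp (real (n + 6) * ln 2 / 4)}"

lemma finite_orthants: "finite (orthants :: ('n::finite \<Rightarrow> int) set)"
proof -
  have "orthants = PiE (UNIV :: 'n set) (\<lambda>_. {0, -1})"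
    by (auto simp: orthants_def PiE_def Pi_def extensional_def)
  moreover have "finite (PiE (UNIV :: 'n set) (\<lambda>_. {0, -1 :: int}))"
    by (rule finite_PiE) auto
  ultimately show ?thesis by simp
qed

lemma orthant_of_in_orthants: "orthant_of p \<in> orthants"
  by (simp add: orthants_def orthant_of_def)

lemma exp_mult_ln2: "exp (real n * ln 2) = (2::real) ^ n"
  by (metis exp_ln exp_of_nat_mult zero_less_numeral)

lemma CZ_exhaustion_in_CZ_sets: "CZ_exhaustion q n \<in> CZ_sets"
proof -
  define N where "N = n + 6"
  define r where "r = real N * ln 2 / 4"
  have "6 * (2/3) \<le> real N * ln (2::real)"
    using ln2_ge_two_thirds by (intro mult_mono) (auto simp: N_def)
  then have r1: "1 \<le> r" by (simp add: r_def)
  have pw: "(2::real) powi int N = exp (real N * ln 2)"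
    by (simp only: exp_mult_ln2 power_int_of_nat)
  have lnpos: "0 < real N * ln (2::real)" by (simp add: N_def)
  have le: "1 * exp (2 * r) \<le> (2::real) powi int N"
    unfolding pw r_def using lnpos by simp
  have lt: "(2::real) powi int N < 1 * exp (8 * r)"
    unfolding pw r_def using lnpos by simp
  have "CZ_exhaustion q n = dyadic_cube (int N) q \<times> {1 * exp (- r)..1 * exp r}"
    by (simp add: CZ_exhaustion_def N_def r_def)
  moreover have "(1::real) > 0 \<and> r > 0 \<and>
     (r < 1 \<longrightarrow> exp 2 * 1 * r \<le> 2 powi int N \<and> 2 powi int N < exp 8 * 1 * r) \<and>
     (r \<ge> 1 \<longrightarrow> 1 * exp (2 * r) \<le> 2 powi int N \<and> 2 powi int N < 1 * exp (8 * r))"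
    using r1 le lt by simp
  ultimately show ?thesis unfolding CZ_sets_def by blast
qed

lemma mem_dyadic_cube_orthant:
  assumes "q \<in> orthants"
  shows "x \<in> dyadic_cube (int N) q \<longleftrightarrow>
    (\<forall>i. (q i = 0 \<longrightarrow> 0 \<le> x $ i \<and> x $ i < 2 ^ N) \<and> (q i = -1 \<longrightarrow> - (2 ^ N) \<le> x $ i \<and> x $ i < 0))"
proof -
  have "(of_int (q i) * 2 ^ N \<le> x $ i \<and> x $ i < (of_int (q i) + 1) * 2 ^ N) \<longleftrightarrow>
    (q i = 0 \<longrightarrow> 0 \<le> x $ i \<and> x $ i < 2 ^ N) \<and> (q i = -1 \<longrightarrow> - (2 ^ N) \<le> x $ i \<and> x $ i < 0)" for i
  proof -
    have "q i = 0 \<or> q i = -1" using assms by (auto simp: orthants_def)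
    then show ?thesis by auto
  qed
  then show ?thesis unfolding dyadic_cube_def power_int_of_nat by simp
qed

lemma CZ_exhaustion_mono:
  assumes "q \<in> orthants" "m \<le> n"
  shows "CZ_exhaustion q m \<subseteq> CZ_exhaustion q n"
proof -
  have p: "(2::real) ^ (m + 6) \<le> 2 ^ (n + 6)" using assms(2) by (intro power_increasing) auto
  have e: "real (m + 6) * ln 2 / 4 \<le> real (n + 6) * ln 2 / 4"
    using assms(2) by (intro divide_right_mono mult_right_mono) auto
  have "dyadic_cube (int (m + 6)) q \<subseteq> dyadic_cube (int (n + 6)) q"
    unfolding subset_iff mem_dyadic_cube_orthant[OF assms(1)]
    using p by (meson neg_le_iff_le order_less_le_trans order_trans)
  moreover have "{exp (- (real (m + 6) * ln 2 / 4))..exp (real (m + 6) * ln 2 / 4)}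
      \<subseteq> {exp (- (real (n + 6) * ln 2 / 4))..exp (real (n + 6) * ln 2 / 4)}"
    using e by (intro atLeastatMost_subset_iff[THEN iffD2]) simp
  ultimately show ?thesis unfolding CZ_exhaustion_def by (rule Sigma_mono)
qed

lemma orthant_of_eq:
  assumes "q \<in> orthants" "p \<in> CZ_exhaustion q n"
  shows "orthant_of p = q"
proof
  fix i
  have "fst p \<in> dyadic_cube (int (n + 6)) q" using assms(2) by (auto simp: CZ_exhaustion_def)
  then have "(q i = 0 \<longrightarrow> 0 \<le> fst p $ i) \<and> (q i = -1 \<longrightarrow> fst p $ i < 0)"
    unfolding mem_dyadic_cube_orthant[OF assms(1)] by blast
  moreover have "q i = 0 \<or> q i = -1" using assms(1) by (auto simp: orthants_def)
  ultimately show "orthant_of p i = q i" by (auto simp: orthant_of_def)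
qed

lemma compact_in_CZ_exhaustion:
  fixes C :: "'n::finite pt set"
  assumes "compact C" "C \<subseteq> half_space"
  obtains n where "\<And>p. p \<in> C \<Longrightarrow> p \<in> CZ_exhaustion (orthant_of p) n"
proof (cases "C = {}")
  case False
  obtain p0 where p0: "p0 \<in> C" "\<And>x. x \<in> C \<Longrightarrow> snd p0 \<le> snd x"
    using continuous_attains_inf[OF assms(1) False continuous_on_snd[OF continuous_on_id]] by metis
  have pos: "snd p0 > 0" using p0(1) assms(2) by (auto simp: half_space_def)
  obtain B where B: "\<And>x. x \<in> C \<Longrightarrow> norm x \<le> B"
    using compact_imp_bounded[OF assms(1)] by (auto simp: bounded_iff)
  define t where "t = max B (1 / snd p0)"
  obtain n where n: "t < (2::real) ^ n" using real_arch_pow[of 2 t] by auto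
  \<comment> \<open>the radius grows only like $N \ln 2 / 4$, hence the factor $4$\<close>
  define M where "M = 4 * n"
  have big: "exp (real (M + 6) * ln 2 / 4) > t" "2 ^ (M + 6) > t"
  proof -
    have "exp (real n * ln 2) \<le> exp (real (M + 6) * ln 2 / 4)"
      by (simp add: M_def algebra_simps)
    then show "exp (real (M + 6) * ln 2 / 4) > t" using n unfolding exp_mult_ln2 by linarith
    have "(2::real) ^ n \<le> 2 ^ (M + 6)" by (intro power_increasing) (auto simp: M_def)
    then show "2 ^ (M + 6) > t" using n by linarith
  qed
  have "p \<in> CZ_exhaustion (orthant_of p) M" if p: "p \<in> C" for p
  proof -
    have c: "\<bar>fst p $ i\<bar> < 2 ^ (M + 6)" for i
    proof -
      have "\<bar>fst p $ i\<bar> \<le> norm (fst p)" by (rule component_le_norm_cart)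
      also have "\<dots> \<le> norm p" using norm_fst_le[of "fst p" "snd p"] by simp
      also have "\<dots> < 2 ^ (M + 6)" using B[OF p] big by (simp add: t_def)
      finally show ?thesis .
    qed
    have "fst p \<in> dyadic_cube (int (M + 6)) (orthant_of p)"
      unfolding mem_dyadic_cube_orthant[OF orthant_of_in_orthants]
      using c by (auto simp: orthant_of_def abs_less_iff minus_le_iff less_imp_le split: if_splits)
    moreover have "snd p \<le> exp (real (M + 6) * ln 2 / 4)"
    proof -
      have "snd p \<le> norm p" using norm_snd_le[of "snd p" "fst p"] by simp
      then show ?thesis using B[OF p] big by (simp add: t_def)
    qed
    moreover have "exp (- (real (M + 6) * ln 2 / 4)) \<le> snd p"
    proof -
      have "1 / snd p0 < exp (real (M + 6) * ln 2 / 4)" using big by (simp add: t_def)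
      then have "1 / exp (real (M + 6) * ln 2 / 4) < snd p0"
        using pos by (simp add: field_simps)
      then show ?thesis using p0(2)[OF p] by (simp add: exp_minus inverse_eq_divide)
    qed
    ultimately show ?thesis
      unfolding CZ_exhaustion_def by (simp add: mem_Times_iff)
  qed
  then show ?thesis by (rule that)
qed (use that in auto)

text \<open>
  The index of the dyadic cube determines the orthant: the cube $[m 2^k, (m+1) 2^k)$ lies to the
  right of $0$ if $m \ge 0$ and to the left of $0$ if $m \le -1$.
\<close>

lemma CZ_set_in_CZ_exhaustion:
  assumes "R \<in> CZ_sets"
  obtains q n where "q \<in> orthants" "R \<subseteq> CZ_exhaustion q n"
proof -
  obtain C where C: "compact C" "C \<subseteq> half_space" "R \<subseteq> C"
    using CZ_set_compact_hull[OF assms] by metis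
  obtain n where n: "\<And>p. p \<in> C \<Longrightarrow> p \<in> CZ_exhaustion (orthant_of p) n"
    using compact_in_CZ_exhaustion[OF C(1,2)] by metis
  obtain k m c r where R: "R = dyadic_cube k m \<times> {c * exp (- r)..c * exp r}"
    using assms unfolding CZ_sets_def by blast
  define q :: "'a \<Rightarrow> int" where "q = (\<lambda>i. if 0 \<le> m i then 0 else -1)"
  have "orthant_of p = q" if p: "p \<in> R" for p
  proof
    fix i
    have x: "of_int (m i) * 2 powi k \<le> fst p $ i" "fst p $ i < (of_int (m i) + 1) * 2 powi k"
      using p unfolding R dyadic_cube_def by auto
    show "orthant_of p i = q i"
    proof (cases "0 \<le> m i")
      case True
      then have "0 \<le> of_int (m i) * (2::real) powi k" by simp
      then have "0 \<le> fst p $ i" using x(1) by (rule order_trans)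
      then show ?thesis using True by (simp add: orthant_of_def q_def)
    next
      case False
      then have "of_int (m i) + 1 \<le> (0::real)" by linarith
      then have "(of_int (m i) + 1) * (2::real) powi k \<le> 0"
        by (intro mult_nonpos_nonneg) auto
      then have "fst p $ i < 0" using x(2) by (rule order_less_le_trans[rotated])
      then show ?thesis using False by (simp add: orthant_of_def q_def)
    qed
  qed
  then have "R \<subseteq> CZ_exhaustion q n" using n C(3) by (metis subset_iff)
  moreover have "q \<in> orthants" by (simp add: q_def orthants_def)
  ultimately show ?thesis using that by blast
qed

section \<open>Transposes and kernels\<close>

lemma Lp2_iff: "f \<in> Lp 2 \<longleftrightarrow> square_integrable rho f"
  by (simp add: Lp_def square_integrable_def)

lemma Lp2_norm: "Lp_norm 2 f = sqrt (sq_norm rho f)"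
proof -
  have "Lp_norm 2 f = (sq_norm rho f) powr (1/2)"
    by (simp add: Lp_norm_def sq_norm_def)
  then show ?thesis by (simp add: powr_half_sqrt)
qed

lemma Lp1_iff: "f \<in> Lp 1 \<longleftrightarrow> integrable rho f"
  by (auto simp: Lp_def integrable_norm_iff intro: borel_measurable_integrable)

lemma Lp1_norm: "Lp_norm 1 f = (\<integral>x. norm (f x) \<partial>rho)"
  by (simp add: Lp_norm_def)

lemma sq_norm_eq_0_imp_AE:
  assumes "square_integrable M f" "sq_norm M f = 0"
  shows "AE x in M. f x = 0"
  using assms integral_nonneg_eq_0_iff_AE[of M "\<lambda>x. (norm (f x))\<^sup>2"]
  by (simp add: square_integrable_def sq_norm_def)

lemma square_integrable_eqI_AE:
  assumes u: "square_integrable M u" and v: "square_integrable M v"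
    and eq: "\<And>f. square_integrable M f \<Longrightarrow> (\<integral>x. f x * u x \<partial>M) = (\<integral>x. f x * v x \<partial>M)"
  shows "AE x in M. u x = v x"
proof -
  let ?w = "\<lambda>x. u x - v x"
  have w: "square_integrable M ?w" by (intro square_integrable_diff u v)
  note c = square_integrable_cnj[OF w]
  have "complex_of_real (sq_norm M ?w) = (\<integral>x. of_real ((norm (?w x))\<^sup>2) \<partial>M)"
    unfolding sq_norm_def by (rule integral_complex_of_real[symmetric])
  also have "\<dots> = (\<integral>x. cnj (?w x) * u x - cnj (?w x) * v x \<partial>M)"
    by (intro Bochner_Integration.integral_cong refl)
       (simp only: complex_norm_square right_diff_distrib[symmetric] left_diff_distrib[symmetric] mult.commute)
  also have "\<dots> = 0"
    using eq[OF c] integrable_mult_square_integrable[OF c u] integrable_mult_square_integrable[OF c v] by simp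
  finally have "sq_norm M ?w = 0" by simp
  then show ?thesis using sq_norm_eq_0_imp_AE[OF w] by simp
qed

lemma bounded_on_L2_iff:
  fixes T :: "'n::finite cfun \<Rightarrow> 'n cfun"
  shows "bounded_on_L2 T \<longleftrightarrow>
    (\<forall>f g. square_integrable rho f \<longrightarrow> square_integrable rho g \<longrightarrow>
       (AE x in rho. T (\<lambda>x. f x + g x) x = T f x + T g x)) \<and>
    (\<forall>c f. square_integrable rho f \<longrightarrow> (AE x in rho. T (\<lambda>x. c * f x) x = c * T f x)) \<and>
    (\<forall>f. square_integrable rho f \<longrightarrow> square_integrable rho (T f)) \<and>
    (\<exists>C. \<forall>f. square_integrable rho f \<longrightarrow> sqrt (sq_norm rho (T f)) \<le> C * sqrt (sq_norm rho f))"
proof -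
  have "Lp 2 = Collect (square_integrable (rho :: 'n pt measure))"
    using Lp2_iff by blast
  then show ?thesis
    by (simp add: bounded_on_L2_def linear_on_upto_def ae_eq_def Lp2_norm Ball_def)
qed

lemma bounded_on_L2_D:
  assumes "bounded_on_L2 T"
  shows bounded_on_L2_square_integrable: "square_integrable rho f \<Longrightarrow> square_integrable rho (T f)"
    and bounded_on_L2_add: "square_integrable rho f \<Longrightarrow> square_integrable rho g \<Longrightarrow>
          AE x in rho. T (\<lambda>x. f x + g x) x = T f x + T g x"
    and bounded_on_L2_cmult: "square_integrable rho f \<Longrightarrow> AE x in rho. T (\<lambda>x. c * f x) x = c * T f x"
  using assms unfolding bounded_on_L2_iff by blast+

lemma bounded_on_L2_bound:
  assumes "bounded_on_L2 T"
  obtains C where "C \<ge> 0" "\<And>f. square_integrable rho f \<Longrightarrow> sq_norm rho (T f) \<le> C * sq_norm rho f"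
proof -
  obtain C where C: "\<And>f. square_integrable rho f \<Longrightarrow> sqrt (sq_norm rho (T f)) \<le> C * sqrt (sq_norm rho f)"
    using assms unfolding bounded_on_L2_iff by blast
  have "sq_norm rho (T f) \<le> C\<^sup>2 * sq_norm rho f" if "square_integrable rho f" for f
  proof -
    have "(sqrt (sq_norm rho (T f)))\<^sup>2 \<le> (C * sqrt (sq_norm rho f))\<^sup>2"
      using C[OF that] by (intro power_mono) auto
    then show ?thesis by (simp add: power_mult_distrib)
  qed
  then show ?thesis using that[of "C\<^sup>2"] by simp
qed

lemma bounded_on_L2_cong_AE:
  fixes T :: "'n::finite cfun \<Rightarrow> 'n cfun"
  assumes T: "bounded_on_L2 T" and f: "square_integrable rho f" and g: "square_integrable rho g"
    and eq: "AE x in rho. f x = g x"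
  shows "AE x in rho. T f x = T g x"
proof -
  obtain C where C: "C \<ge> 0" "\<And>f. square_integrable rho f \<Longrightarrow> sq_norm rho (T f) \<le> C * sq_norm rho f"
    using bounded_on_L2_bound[OF T] by metis
  note g' = square_integrable_cmult[OF g, of "-1"]
  let ?d = "\<lambda>x. f x + (-1) * g x"
  have d: "square_integrable rho ?d" by (intro square_integrable_add f g')
  have "sq_norm rho ?d = (\<integral>x. 0 \<partial>(rho :: 'n pt measure))"
    unfolding sq_norm_def using d eq unfolding square_integrable_def
    by (intro integral_cong_AE) (auto elim: eventually_mono)
  then have z: "sq_norm rho ?d = 0" by simp
  have "sq_norm rho (T ?d) \<le> 0" using C(2)[OF d] unfolding z by simp
  then have "sq_norm rho (T ?d) = 0" by (intro order_antisym sq_norm_nonneg)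
  then have "AE x in rho. T ?d x = 0"
    using sq_norm_eq_0_imp_AE bounded_on_L2_square_integrable[OF T d] by blast
  with bounded_on_L2_add[OF T f g'] bounded_on_L2_cmult[OF T g, of "-1"]
  show ?thesis by eventually_elim simp
qed

text \<open>
  The transpose is taken with respect to the bilinear pairing $\int f \phi\,d\rho$ without
  conjugation, so that its kernel is the transposed kernel $K(y,x)$ itself.
\<close>

definition is_transpose :: "('n::finite cfun \<Rightarrow> 'n cfun) \<Rightarrow> ('n cfun \<Rightarrow> 'n cfun) \<Rightarrow> bool" where
  "is_transpose T S \<longleftrightarrow> (\<forall>\<phi>. square_integrable rho \<phi> \<longrightarrow> square_integrable rho (S \<phi>)) \<and>
     (\<forall>f \<phi>. square_integrable rho f \<longrightarrow> square_integrable rho \<phi> \<longrightarrow>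
        (\<integral>x. T f x * \<phi> x \<partial>rho) = (\<integral>x. f x * S \<phi> x \<partial>rho))"

lemma transpose_exists:
  assumes T: "bounded_on_L2 T"
  obtains S where "is_transpose T S"
proof -
  obtain C where C: "C \<ge> 0" "\<And>f. square_integrable rho f \<Longrightarrow> sq_norm rho (T f) \<le> C * sq_norm rho f"
    using bounded_on_L2_bound[OF T] by metis
  have "\<exists>g. square_integrable rho g \<and> (\<forall>f. square_integrable rho f \<longrightarrow>
      (\<integral>x. T f x * \<phi> x \<partial>rho) = (\<integral>x. f x * g x \<partial>rho))" if \<phi>: "square_integrable rho \<phi>" for \<phi>
  proof -
    note Tsq = bounded_on_L2_square_integrable[OF T]
    let ?l = "\<lambda>f. \<integral>x. T f x * \<phi> x \<partial>rho"
    have add: "?l (\<lambda>x. f x + g x) = ?l f + ?l g" if f: "square_integrable rho f" and g: "square_integrable rho g" for f g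
    proof -
      note [measurable] = square_integrable_measurable[OF Tsq[OF square_integrable_add[OF f g]]]
        square_integrable_measurable[OF Tsq[OF f]] square_integrable_measurable[OF Tsq[OF g]]
        square_integrable_measurable[OF \<phi>]
      have "?l (\<lambda>x. f x + g x) = (\<integral>x. T f x * \<phi> x + T g x * \<phi> x \<partial>rho)"
        using bounded_on_L2_add[OF T f g]
        by (intro integral_cong_AE) (measurable, elim eventually_mono, simp only: distrib_right)
      also have "\<dots> = ?l f + ?l g"
        by (intro Bochner_Integration.integral_add integrable_mult_square_integrable Tsq f g \<phi>)
      finally show ?thesis .
    qed
    have cmult: "?l (\<lambda>x. c * f x) = c * ?l f" if f: "square_integrable rho f" for c f
    proof -
      note [measurable] = square_integrable_measurable[OF Tsq[OF square_integrable_cmult[OF f, of c]]]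
        square_integrable_measurable[OF Tsq[OF f]] square_integrable_measurable[OF \<phi>]
      have "?l (\<lambda>x. c * f x) = (\<integral>x. c * (T f x * \<phi> x) \<partial>rho)"
        using bounded_on_L2_cmult[OF T f, of c]
        by (intro integral_cong_AE) (measurable, elim eventually_mono, simp only: mult.assoc)
      then show ?thesis by simp
    qed
    have bound: "(norm (?l f))\<^sup>2 \<le> (C * sq_norm rho \<phi>) * sq_norm rho f" if f: "square_integrable rho f" for f
    proof -
      have "(norm (?l f))\<^sup>2 \<le> sq_norm rho (T f) * sq_norm rho \<phi>"
        by (intro Cauchy_Schwarz_norm Tsq f \<phi>)
      also have "\<dots> \<le> (C * sq_norm rho f) * sq_norm rho \<phi>"
        by (intro mult_right_mono C f) simp
      finally show ?thesis by (simp add: mult_ac)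
    qed
    show ?thesis
    proof (rule L2_Riesz_representation[of rho ?l "C * sq_norm rho \<phi>", OF add cmult bound])
      fix g assume "square_integrable rho g" "\<And>f. square_integrable rho f \<Longrightarrow> ?l f = (\<integral>x. f x * g x \<partial>rho)"
      then show ?thesis by blast
    qed
  qed
  then show ?thesis using that unfolding is_transpose_def by metis
qed

lemma transpose_bounded_on_L2:
  fixes T :: "'n::finite cfun \<Rightarrow> 'n cfun"
  assumes T: "bounded_on_L2 T" and S: "is_transpose T S"
  shows "bounded_on_L2 S"
proof -
  obtain C where C: "C \<ge> 0" "\<And>f. square_integrable rho f \<Longrightarrow> sq_norm rho (T f) \<le> C * sq_norm rho f"
    using bounded_on_L2_bound[OF T] by metis
  have Ssq: "square_integrable rho (S \<phi>)" if "square_integrable rho \<phi>" for \<phi>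
    using S that by (simp add: is_transpose_def)
  have dual: "(\<integral>x. f x * S \<phi> x \<partial>rho) = (\<integral>x. T f x * \<phi> x \<partial>rho)"
    if "square_integrable rho f" "square_integrable rho \<phi>" for f \<phi>
    using S that by (simp add: is_transpose_def)
  note Tsq = bounded_on_L2_square_integrable[OF T]
  note int = integrable_mult_square_integrable
  have "AE x in rho. S (\<lambda>x. f x + g x) x = S f x + S g x"
    if f: "square_integrable rho f" and g: "square_integrable rho g" for f g
  proof (rule square_integrable_eqI_AE)
    fix h :: "'n cfun" assume h: "square_integrable rho h"
    show "(\<integral>x. h x * S (\<lambda>x. f x + g x) x \<partial>rho) = (\<integral>x. h x * (S f x + S g x) \<partial>rho)"
      using dual[OF h square_integrable_add[OF f g]] dual[OF h f] dual[OF h g]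
        int[OF Tsq[OF h] f] int[OF Tsq[OF h] g] int[OF h Ssq[OF f]] int[OF h Ssq[OF g]]
      by (simp add: distrib_left)
  qed (intro Ssq square_integrable_add f g)+
  moreover have "AE x in rho. S (\<lambda>x. c * f x) x = c * S f x" if f: "square_integrable rho f" for c and f :: "'n cfun"
  proof (rule square_integrable_eqI_AE)
    fix h :: "'n cfun" assume h: "square_integrable rho h"
    show "(\<integral>x. h x * S (\<lambda>x. c * f x) x \<partial>rho) = (\<integral>x. h x * (c * S f x) \<partial>rho)"
      using dual[OF h square_integrable_cmult[OF f]] dual[OF h f]
      by (simp add: mult.left_commute)
  qed (intro Ssq square_integrable_cmult f)+
  moreover have "sqrt (sq_norm rho (S f)) \<le> sqrt C * sqrt (sq_norm rho f)" if f: "square_integrable rho f" for f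
  proof -
    let ?h = "\<lambda>x. cnj (S f x)"
    have h: "square_integrable rho ?h" by (intro square_integrable_cnj Ssq f)
    have "complex_of_real (sq_norm rho (S f)) = (\<integral>x. of_real ((norm (S f x))\<^sup>2) \<partial>rho)"
      unfolding sq_norm_def by (rule integral_complex_of_real[symmetric])
    also have "\<dots> = (\<integral>x. ?h x * S f x \<partial>rho)"
      by (intro Bochner_Integration.integral_cong refl) (simp only: complex_norm_square mult.commute)
    also have "\<dots> = (\<integral>x. T ?h x * f x \<partial>rho)" by (rule dual[OF h f])
    finally have "norm (complex_of_real (sq_norm rho (S f))) = norm (\<integral>x. T ?h x * f x \<partial>rho)" by simp
    then have "(sq_norm rho (S f))\<^sup>2 = (norm (\<integral>x. T ?h x * f x \<partial>rho))\<^sup>2" by simp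
    also have "\<dots> \<le> sq_norm rho (T ?h) * sq_norm rho f"
      by (intro Cauchy_Schwarz_norm Tsq h f)
    also have "\<dots> \<le> (C * sq_norm rho (S f)) * sq_norm rho f"
      using C(2)[OF h] by (intro mult_right_mono) (simp_all add: sq_norm_cnj)
    finally have *: "sq_norm rho (S f) * sq_norm rho (S f) \<le> sq_norm rho (S f) * (C * sq_norm rho f)"
      by (simp add: power2_eq_square mult_ac)
    have "sq_norm rho (S f) \<le> C * sq_norm rho f"
    proof (cases "sq_norm rho (S f) = 0")
      case True then show ?thesis using C(1) by simp
    next
      case False
      then have "0 < sq_norm rho (S f)" using sq_norm_nonneg[of rho "S f"] by linarith
      then show ?thesis using * by (simp only: mult_le_cancel_left_pos)
    qed
    then show ?thesis by (simp add: real_sqrt_mult[symmetric])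
  qed
  ultimately show ?thesis
    unfolding bounded_on_L2_iff using Ssq by blast
qed

definition offdiag :: "('n::finite pt \<times> 'n pt) set" where
  "offdiag = {(x, y). x \<in> half_space \<and> y \<in> half_space \<and> x \<noteq> y}"

text \<open>
  Extending the kernel by zero outside \<open>offdiag\<close> makes it Borel measurable as a whole, and the
  representation of the operator is only demanded for functions that vanish exactly outside a
  compact set. In this form the notion is stable under transposition.
\<close>

definition regular_kernel ::
  "('n::finite cfun \<Rightarrow> 'n cfun) \<Rightarrow> ('n pt \<Rightarrow> 'n pt \<Rightarrow> complex) \<Rightarrow> bool" where
  "regular_kernel T k \<longleftrightarrow>
     (\<forall>x y. (x, y) \<notin> offdiag \<longrightarrow> k x y = 0) \<and>
     (\<forall>C. compact C \<and> C \<subseteq> offdiag \<longrightarrow> set_integrable (rho \<Otimes>\<^sub>M rho) C (case_prod k)) \<and>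
     (\<forall>f F B. f \<in> borel_measurable borel \<and> compact F \<and> F \<subseteq> half_space \<and>
        (\<forall>y. norm (f y) \<le> B) \<and> (\<forall>y. y \<notin> F \<longrightarrow> f y = 0) \<longrightarrow>
        (AE x in rho. x \<notin> F \<longrightarrow> T f x = (\<integral>y. k x y * f y \<partial>rho)))"

lemma regular_kernelD:
  assumes "regular_kernel T k" "f \<in> borel_measurable borel" "compact F" "F \<subseteq> half_space"
    "\<And>y. norm (f y) \<le> B" "\<And>y. y \<notin> F \<Longrightarrow> f y = 0"
  shows "AE x in rho. x \<notin> F \<longrightarrow> T f x = (\<integral>y. k x y * f y \<partial>rho)"
  using assms unfolding regular_kernel_def by blast

lemma regular_kernel_of_has_kernel:
  assumes "has_kernel T K"
  shows "regular_kernel T (\<lambda>x y. if (x, y) \<in> offdiag then K x y else 0)"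
proof -
  let ?k = "\<lambda>x y. if (x, y) \<in> offdiag then K x y else 0"
  have 1: "set_integrable (rho \<Otimes>\<^sub>M rho) C (case_prod ?k)" if "compact C" "C \<subseteq> offdiag" for C
  proof -
    have "set_integrable (rho \<Otimes>\<^sub>M rho) C (\<lambda>(x, y). K x y)"
      using assms that unfolding has_kernel_def offdiag_def by blast
    then show ?thesis
      unfolding set_integrable_def
      by (rule Bochner_Integration.integrable_cong[THEN iffD1, OF refl, rotated])
         (use that in \<open>auto simp: indicator_def split: if_splits\<close>)
  qed
  have 2: "AE x in rho. x \<notin> F \<longrightarrow> T f x = (\<integral>y. ?k x y * f y \<partial>rho)"
    if f: "f \<in> borel_measurable borel" "\<And>y. norm (f y) \<le> B" "\<And>y. y \<notin> F \<Longrightarrow> f y = 0"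
      and F: "compact F" "F \<subseteq> half_space" for f F B
  proof -
    have sub: "{x \<in> half_space. f x \<noteq> 0} \<subseteq> F" using f(3) by blast
    have cl: "closure {x \<in> half_space. f x \<noteq> 0} \<subseteq> F"
      using sub F(1) by (simp add: closure_minimal compact_imp_closed)
    then have supp_eq: "supp f = closure {x \<in> half_space. f x \<noteq> 0}"
      using F(2) by (auto simp: supp_def)
    then have "compact (supp f)"
      using compact_Int_closed[OF F(1) closed_closure] Int_absorb1[OF cl] by metis
    moreover have "bounded (f ` half_space)" using f(2) unfolding bounded_iff by blast
    ultimately have "AE x in rho. x \<notin> supp f \<longrightarrow> T f x = (\<integral>y. K x y * f y \<partial>rho)"
      using assms f(1) unfolding has_kernel_def by simp
    with AE_rho_half_space show ?thesis
    proof eventually_elim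
      case (elim x)
      show ?case
      proof
        assume x: "x \<notin> F"
        then have "(\<lambda>y. K x y * f y) = (\<lambda>y. ?k x y * f y)"
          using f(3) F(2) elim(1) by (force simp: offdiag_def fun_eq_iff)
        then show "T f x = (\<integral>y. ?k x y * f y \<partial>rho)" using elim(2) x cl supp_eq by auto
      qed
    qed
  qed
  show ?thesis unfolding regular_kernel_def using 1 2 by auto
qed

lemma open_sigma_compact:
  fixes U :: "'a::euclidean_space set"
  assumes "open U"
  shows "\<exists>C. (\<forall>n::nat. compact (C n)) \<and> (\<forall>n. C n \<subseteq> U) \<and> (\<forall>n. C n \<subseteq> C (Suc n)) \<and> \<Union> (range C) = U"
proof (rule open_Union_compact_subsets[OF assms])
  fix C :: "nat \<Rightarrow> 'a set"
  assume C: "\<And>n. compact (C n)" "\<And>n. C n \<subseteq> U" "\<And>n. C n \<subseteq> interior (C (Suc n))"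
    "\<Union> (range C) = U"
  have "C n \<subseteq> C (Suc n)" for n using C(3) interior_subset by (rule order_trans)
  then show ?thesis using C(1,2,4) by (intro exI[of _ C]) auto
qed

lemma open_offdiag: "open (offdiag :: ('n::finite pt \<times> 'n pt) set)"
proof -
  have eq: "offdiag = half_space \<times> half_space \<inter> {p :: 'n pt \<times> 'n pt. fst p \<noteq> snd p}"
    by (auto simp: offdiag_def)
  moreover have "open {p :: 'n pt \<times> 'n pt. fst p \<noteq> snd p}"
    by (intro open_Collect_neq continuous_intros)
  ultimately show ?thesis
    unfolding eq by (intro open_Int open_Times open_half_space)
qed

text \<open>
  Local integrability off the diagonal gives measurability on each compact piece, and the open set
  \<open>offdiag\<close> is a countable increasing union of such pieces.
\<close>

lemma regular_kernel_measurable: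
  fixes T :: "'n::finite cfun \<Rightarrow> 'n cfun"
  assumes "regular_kernel T k"
  shows "case_prod k \<in> borel_measurable (rho \<Otimes>\<^sub>M rho)"
proof -
  obtain C :: "nat \<Rightarrow> ('n pt \<times> 'n pt) set" where C: "\<And>n. compact (C n)" "\<And>n. C n \<subseteq> offdiag"
    "\<And>n. C n \<subseteq> C (Suc n)" "\<Union> (range C) = offdiag"
    using open_sigma_compact[OF open_offdiag] by metis
  have mono: "C m \<subseteq> C n" if "m \<le> n" for m n
    using that by (rule lift_Suc_mono_le[rotated]) (use C(3) in blast)
  have lim: "(\<lambda>n. indicator (C n) p *\<^sub>R case_prod k p) \<longlonglongrightarrow> case_prod k p" for p
  proof (cases "p \<in> offdiag")
    case True
    then obtain m where "p \<in> C m" using C(4) by blast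
    then have "indicator (C n) p *\<^sub>R case_prod k p = case_prod k p" if "n \<ge> m" for n
      using mono[OF that] by auto
    then show ?thesis by (intro tendsto_eventually eventually_sequentiallyI)
  next
    case False
    then have "case_prod k p = 0" using assms by (cases p) (auto simp: regular_kernel_def)
    then show ?thesis by simp
  qed
  have m: "(\<lambda>p. indicator (C n) p *\<^sub>R case_prod k p) \<in> borel_measurable (rho \<Otimes>\<^sub>M rho)" for n
    using assms C(1,2)[of n] unfolding regular_kernel_def set_integrable_def
    by (intro borel_measurable_integrable) blast
  show ?thesis by (rule borel_measurable_LIMSEQ_metric[OF m lim])
qed

lemma rho_ae_eqI_compact:
  fixes u v :: "'n::finite cfun"
  assumes C: "compact C" "C \<subseteq> half_space"
    and u: "set_integrable rho C u" and v: "set_integrable rho C v"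
    and eq: "\<And>A. A \<in> sets borel \<Longrightarrow> A \<subseteq> C \<Longrightarrow> (LINT x:A|rho. u x) = (LINT x:A|rho. v x)"
  shows "AE x in rho. x \<in> C \<longrightarrow> u x = v x"
proof -
  have Cb: "C \<in> sets borel" using C(1) by (simp add: borel_compact)
  have "AE x in rho. indicator C x *\<^sub>R u x = indicator C x *\<^sub>R v x"
  proof (rule rho.density_unique_banach)
    fix A :: "'n pt set" assume "A \<in> sets rho"
    then have "A \<inter> C \<in> sets borel" using Cb by auto
    moreover have "indicat_real A x *\<^sub>R indicat_real C x *\<^sub>R w = indicat_real (A \<inter> C) x *\<^sub>R w"
      for x :: "'n pt" and w :: complex
      by (simp add: indicator_inter_arith)
    ultimately show "(LINT x:A|rho. indicator C x *\<^sub>R u x) = (LINT x:A|rho. indicator C x *\<^sub>R v x)"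
      using eq[of "A \<inter> C"] by (simp only: set_lebesgue_integral_def Int_lower2)
  qed (use u v in \<open>auto simp: set_integrable_def\<close>)
  then show ?thesis by eventually_elim auto
qed

lemma square_integrable_bounded_support:
  fixes f :: "'n::finite cfun"
  assumes [measurable]: "f \<in> borel_measurable borel" "F \<in> sets borel" and F: "emeasure rho F < \<infinity>"
    and B: "\<And>y. norm (f y) \<le> B" and z: "\<And>y. y \<notin> F \<Longrightarrow> f y = 0"
  shows "square_integrable rho f" "integrable rho f"
proof -
  have Fint: "integrable rho (\<lambda>x. c * indicator F x :: real)" for c
    using F by (intro integrable_mult_right integrable_real_indicator) auto
  have "(norm (f x))\<^sup>2 \<le> B\<^sup>2 * indicator F x" for x
    using power_mono[OF B[of x] norm_ge_zero, of 2] z[of x] by (cases "x \<in> F") auto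
  then show "square_integrable rho f"
    unfolding square_integrable_def
    by (auto intro!: Bochner_Integration.integrable_bound[OF Fint[of "B\<^sup>2"]] AE_I2)
  have "norm (f x) \<le> B * indicator F x" for x
    using B[of x] z[of x] by (cases "x \<in> F") auto
  then show "integrable rho f"
    by (intro Bochner_Integration.integrable_bound[OF Fint[of B]] AE_I2) (auto intro: order_trans[OF _ abs_ge_self])
qed

text \<open>
  Away from the compact set that carries $f$, the function $Sf$ is identified by its integrals
  against indicators of small sets $A$: the transpose turns them into integrals of $T 1_A$ over
  that set, where the kernel of $T$ is available, and Fubini applies since the kernel is
  integrable on products of disjoint compact sets.
\<close>

lemma regular_kernel_transpose:
  fixes T S :: "'n::finite cfun \<Rightarrow> 'n cfun"
  assumes T: "bounded_on_L2 T" and k: "regular_kernel T k" and S: "is_transpose T S"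
  shows "regular_kernel S (\<lambda>x y. k y x)"
proof -
  have zero: "(x, y) \<notin> offdiag \<Longrightarrow> k y x = 0" for x y
  proof -
    assume "(x, y) \<notin> offdiag"
    then have "(y, x) \<notin> offdiag" by (auto simp: offdiag_def)
    then show "k y x = 0" using k unfolding regular_kernel_def by blast
  qed
  have loc: "set_integrable (rho \<Otimes>\<^sub>M rho) C (\<lambda>(x, y). k y x)" if C: "compact C" "C \<subseteq> offdiag" for C
  proof -
    let ?C = "prod.swap ` C"
    have "compact ?C" using C(1) by (intro compact_continuous_image continuous_on_swap)
    moreover have "?C \<subseteq> offdiag" using C(2) by (auto simp: offdiag_def)
    ultimately have "integrable (rho \<Otimes>\<^sub>M rho) (\<lambda>p. indicator ?C p *\<^sub>R case_prod k p)"
      using k unfolding regular_kernel_def set_integrable_def by blast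
    from rho_pair.integrable_product_swap[OF this]
    show ?thesis unfolding set_integrable_def
      by (rule Bochner_Integration.integrable_cong[THEN iffD1, OF refl, rotated]) (force simp: indicator_def)
  qed
  note [measurable] = regular_kernel_measurable[OF k]
  have repr: "AE x in rho. x \<notin> F \<longrightarrow> S f x = (\<integral>y. k y x * f y \<partial>rho)"
    if f[measurable]: "f \<in> borel_measurable borel" and B: "\<And>y. norm (f y) \<le> B"
      and z: "\<And>y. y \<notin> F \<Longrightarrow> f y = 0" and F: "compact F" "F \<subseteq> half_space" for f F B
  proof -
    have Fb[measurable]: "F \<in> sets borel" using F(1) by (simp add: borel_compact)
    have fsq: "square_integrable rho f"
      by (rule square_integrable_bounded_support[OF f Fb emeasure_rho_compact[OF F] B z])
    have Ssq: "square_integrable rho (S f)" using S fsq by (simp add: is_transpose_def)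
    have op: "open (half_space - F)" using F(1) by (intro open_Diff open_half_space compact_imp_closed)
    obtain C :: "nat \<Rightarrow> 'n pt set" where C: "\<And>n. compact (C n)" "\<And>n. C n \<subseteq> half_space - F"
      "\<Union> (range C) = half_space - F"
      using open_sigma_compact[OF op] by metis
    have "AE x in rho. x \<in> C n \<longrightarrow> S f x = (\<integral>y. k y x * f y \<partial>rho)" for n
    proof (rule rho_ae_eqI_compact)
      show "compact (C n)" "C n \<subseteq> half_space" using C by auto
      have Cb[measurable]: "C n \<in> sets borel" using C(1) by (simp add: borel_compact)
      have fin: "emeasure rho (C n) < \<infinity>" using C by (intro emeasure_rho_compact) auto
      have indsq: "square_integrable rho (\<lambda>x. indicator A x)" if "A \<in> sets borel" "A \<subseteq> C n" for A
        by (rule square_integrable_bounded_support[where F = "C n" and B = 1])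
           (use that fin in \<open>auto simp: indicator_def\<close>)
      have "integrable rho (\<lambda>x. indicator (C n) x * S f x)"
        using integrable_mult_square_integrable[OF indsq[of "C n"] Ssq] by simp
      then show "set_integrable rho (C n) (S f)"
        unfolding set_integrable_def
        by (rule Bochner_Integration.integrable_cong[THEN iffD1, OF refl, rotated]) (auto simp: indicator_def)
      have "compact (C n \<times> F)" "C n \<times> F \<subseteq> offdiag"
        using C F by (auto intro: compact_Times simp: offdiag_def)
      from loc[OF this] have "integrable (rho \<Otimes>\<^sub>M rho) (\<lambda>(x, y). indicator (C n \<times> F) (x, y) *\<^sub>R k y x)"
        unfolding set_integrable_def by (simp add: case_prod_unfold)
      then have G: "integrable (rho \<Otimes>\<^sub>M rho) (\<lambda>p. B *\<^sub>R (indicator (C n \<times> F) p *\<^sub>R k (snd p) (fst p)))"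
        unfolding case_prod_unfold by (intro integrable_scaleR_right) simp
      have P: "integrable (rho \<Otimes>\<^sub>M rho) (\<lambda>(x, y). indicator A x *\<^sub>R (k y x * f y))"
        if A[measurable]: "A \<in> sets borel" and AC: "A \<subseteq> C n" for A
      proof (rule Bochner_Integration.integrable_bound[OF G])
        show "(\<lambda>(x, y). indicator A x *\<^sub>R (k y x * f y)) \<in> borel_measurable (rho \<Otimes>\<^sub>M rho)"
        proof -
          have "(\<lambda>p. k (snd p) (fst p)) \<in> borel_measurable (rho \<Otimes>\<^sub>M rho)"
            using measurable_pair_swap[OF regular_kernel_measurable[OF k]] by (simp add: case_prod_unfold)
          moreover have "(\<lambda>p. f (snd p)) \<in> borel_measurable (rho \<Otimes>\<^sub>M rho)"
            by (rule measurable_compose[OF measurable_snd]) measurable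
          moreover have "(\<lambda>p. indicat_real A (fst p)) \<in> borel_measurable (rho \<Otimes>\<^sub>M rho)"
            by (rule measurable_compose[OF measurable_fst]) measurable
          ultimately show ?thesis
            unfolding case_prod_unfold by (intro borel_measurable_scaleR borel_measurable_times)
        qed
        have "norm (indicator A x *\<^sub>R (k y x * f y)) \<le> B * indicator (C n \<times> F) (x, y) * norm (k y x)" for x y
          using mult_left_mono[OF B[of y] norm_ge_zero[of "k y x"]] z[of y] AC order_trans[OF norm_ge_zero B[of y]]
          by (auto simp: indicator_def norm_mult mult.commute)
        then show "AE p in rho \<Otimes>\<^sub>M rho. norm (case p of (x, y) \<Rightarrow> indicator A x *\<^sub>R (k y x * f y))
            \<le> norm (B *\<^sub>R (indicator (C n \<times> F) p *\<^sub>R k (snd p) (fst p)))"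
          using order_trans[OF norm_ge_zero B] by (intro AE_I2) (auto simp: case_prod_unfold)
      qed
      have int: "integrable rho (\<lambda>x. \<integral>y. indicator A x *\<^sub>R (k y x * f y) \<partial>rho)"
        if "A \<in> sets borel" "A \<subseteq> C n" for A
        using rho_pair.integrable_fst[OF P[OF that]] by simp
      show "set_integrable rho (C n) (\<lambda>x. \<integral>y. k y x * f y \<partial>rho)"
        unfolding set_integrable_def using int[of "C n"] by simp
      fix A :: "'n pt set" assume A: "A \<in> sets borel" "A \<subseteq> C n"
      note A(1)[measurable]
      have Tk: "AE y in rho. y \<notin> C n \<longrightarrow> T (indicator A) y = (\<integral>x. k y x * indicator A x \<partial>rho)"
        by (rule regular_kernelD[OF k, where B = 1]) (use A C(1,2)[of n] in \<open>auto simp: indicator_def\<close>)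
      have "(LINT x:A|rho. S f x) = (\<integral>x. indicator A x * S f x \<partial>rho)"
        unfolding set_lebesgue_integral_def by (intro Bochner_Integration.integral_cong) (auto simp: indicator_def)
      also have "\<dots> = (\<integral>y. T (indicator A) y * f y \<partial>rho)"
        using S indsq[OF A] fsq by (simp add: is_transpose_def)
      also have "\<dots> = (\<integral>y. (\<integral>x. indicator A x *\<^sub>R (k y x * f y) \<partial>rho) \<partial>rho)"
      proof (rule integral_cong_AE)
        show "(\<lambda>y. T (indicator A) y * f y) \<in> borel_measurable rho"
          using bounded_on_L2_square_integrable[OF T indsq[OF A]] by measurable
        show "(\<lambda>y. \<integral>x. indicator A x *\<^sub>R (k y x * f y) \<partial>rho) \<in> borel_measurable rho"
          using rho_pair.integrable_snd[OF P[OF A]] by (rule borel_measurable_integrable)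
        show "AE y in rho. T (indicator A) y * f y = (\<integral>x. indicator A x *\<^sub>R (k y x * f y) \<partial>rho)"
          using Tk
        proof eventually_elim
          case (elim y)
          have "(\<integral>x. indicator A x *\<^sub>R (k y x * f y) \<partial>rho) = (\<integral>x. (k y x * indicator A x) * f y \<partial>rho)"
            by (intro Bochner_Integration.integral_cong) (auto simp: indicator_def)
          also have "\<dots> = (\<integral>x. k y x * indicator A x \<partial>rho) * f y" by simp
          finally show ?case using elim z[of y] C(2)[of n] by (cases "y \<in> F") auto
        qed
      qed
      also have "\<dots> = (\<integral>x. (\<integral>y. indicator A x *\<^sub>R (k y x * f y) \<partial>rho) \<partial>rho)"
        by (rule rho_pair.Fubini_integral[OF P[OF A]])
      also have "\<dots> = (LINT x:A|rho. (\<integral>y. k y x * f y \<partial>rho))"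
        unfolding set_lebesgue_integral_def by simp
      finally show "(LINT x:A|rho. S f x) = (LINT x:A|rho. (\<integral>y. k y x * f y \<partial>rho))" .
    qed
    then have "AE x in rho. \<forall>n. x \<in> C n \<longrightarrow> S f x = (\<integral>y. k y x * f y \<partial>rho)"
      unfolding AE_all_countable by blast
    with AE_rho_half_space show ?thesis
      by eventually_elim (use C(3) in blast)
  qed
  show ?thesis unfolding regular_kernel_def using zero loc repr by blast
qed

section \<open>Atoms and mean oscillation\<close>

text \<open>
  Exact representatives of multiples of atoms: the size and support conditions hold everywhere
  and not only almost everywhere.
\<close>

definition cancelling :: "'n::finite pt set \<Rightarrow> real \<Rightarrow> 'n cfun \<Rightarrow> bool" where
  "cancelling R M a \<longleftrightarrow> a \<in> borel_measurable borel \<and> (\<forall>x. norm (a x) \<le> M) \<and>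
     (\<forall>x. x \<notin> R \<longrightarrow> a x = 0) \<and> (\<integral>x. a x \<partial>rho) = 0"

lemma cancellingD:
  assumes "cancelling R M a"
  shows "a \<in> borel_measurable borel" "norm (a x) \<le> M" "x \<notin> R \<Longrightarrow> a x = 0" "(\<integral>x. a x \<partial>rho) = 0"
  using assms unfolding cancelling_def by blast+

lemma cancelling_square_integrable:
  assumes "R \<in> CZ_sets" "cancelling R M a"
  shows "square_integrable rho a" "integrable rho a"
  using square_integrable_bounded_support[of a R M] CZ_set_measurable[OF assms(1)]
    emeasure_CZ_set_finite[OF assms(1)] cancellingD[OF assms(2)] by metis+

lemma cancelling_norm_integral:
  assumes R: "R \<in> CZ_sets" and a: "cancelling R M a"
  shows "(\<integral>x. norm (a x) \<partial>rho) \<le> M * measure rho R" "sq_norm rho a \<le> M\<^sup>2 * measure rho R"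
proof -
  have ind: "integrable rho (\<lambda>x. c * indicator R x :: real)" for c
    using CZ_set_measurable[OF R] emeasure_CZ_set_finite[OF R]
    by (intro integrable_mult_right integrable_real_indicator) auto
  have i: "(\<integral>x. c * indicator R x \<partial>rho) = c * measure rho R" for c :: real
    by simp
  have bd: "norm (a x) \<le> M * indicator R x" for x
    using cancellingD(2,3)[OF a, of x] by (cases "x \<in> R") auto
  have bd2: "(norm (a x))\<^sup>2 \<le> M\<^sup>2 * indicator R x" for x
    using cancellingD(2,3)[OF a, of x] power_mono[of "norm (a x)" M 2] by (cases "x \<in> R") auto
  show "(\<integral>x. norm (a x) \<partial>rho) \<le> M * measure rho R"
    unfolding i[symmetric] using cancelling_square_integrable[OF R a]
    by (intro integral_mono ind bd) auto
  show "sq_norm rho a \<le> M\<^sup>2 * measure rho R"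
    unfolding i[symmetric] sq_norm_def using cancelling_square_integrable[OF R a]
    by (intro integral_mono ind bd2) (auto simp: square_integrable_def)
qed

lemma inverse_emeasure_CZ_set:
  "R \<in> CZ_sets \<Longrightarrow> 1 / emeasure rho R = ennreal (1 / measure rho R)"
  using measure_CZ_set_pos[of R] by (simp add: emeasure_CZ_set ennreal_1[symmetric] divide_ennreal del: ennreal_1)

lemma cancelling_imp_atom:
  assumes R: "R \<in> CZ_sets" and a: "cancelling R (1 / measure rho R) a"
  shows "atom a"
proof -
  have "Linf_norm a \<le> 1 / emeasure rho R"
    unfolding Linf_norm_def inverse_emeasure_CZ_set[OF R]
    using cancellingD(1)[OF a] cancellingD(2)[OF a] by (intro esssup_I AE_I2 ennreal_leI) auto
  moreover have "AE x in rho. x \<notin> R \<longrightarrow> a x = 0"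
    using cancellingD(3)[OF a] by (intro AE_I2) blast
  ultimately show ?thesis
    unfolding atom_def Lp1_iff using R cancelling_square_integrable(2)[OF R a] cancellingD(4)[OF a] by blast
qed

lemma atom_representative:
  assumes "atom a"
  obtains R b where "R \<in> CZ_sets" "cancelling R (1 / measure rho R) b" "AE x in rho. a x = b x"
proof -
  obtain R where R: "R \<in> CZ_sets" "AE x in rho. x \<notin> R \<longrightarrow> a x = 0"
    "Linf_norm a \<le> 1 / emeasure rho R" "(\<integral>x. a x \<partial>rho) = 0" and int: "integrable rho a"
    using assms unfolding atom_def Lp1_iff by blast
  note [measurable] = borel_measurable_integrable[OF int] CZ_set_measurable[OF R(1)]
  define M where "M = 1 / measure rho R"
  have M: "M \<ge> 0" by (simp add: M_def)
  have "AE x in rho. ennreal (norm (a x)) \<le> Linf_norm a"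
    unfolding Linf_norm_def by (rule esssup_AE)
  then have bd: "AE x in rho. norm (a x) \<le> M"
    using R(3) M unfolding inverse_emeasure_CZ_set[OF R(1)] M_def
    by (auto elim!: eventually_mono dest: order_trans simp: ennreal_le_iff)
  define b where "b x = (if x \<in> R \<and> norm (a x) \<le> M then a x else 0)" for x
  have eq: "AE x in rho. a x = b x"
    using bd R(2) by eventually_elim (auto simp: b_def)
  have bm: "b \<in> borel_measurable borel"
  proof -
    have "b \<in> borel_measurable rho" unfolding b_def by measurable
    then show ?thesis by simp
  qed
  have "(\<integral>x. b x \<partial>rho) = (\<integral>x. a x \<partial>rho)"
    using eq bm by (intro integral_cong_AE) (auto elim!: eventually_mono)
  then have "(\<integral>x. b x \<partial>rho) = 0" using R(4) by simp
  moreover have "norm (b x) \<le> M" "x \<notin> R \<Longrightarrow> b x = 0" for x using M by (auto simp: b_def)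
  ultimately have "cancelling R M b"
    unfolding cancelling_def using bm by blast
  then show ?thesis using that R(1) eq by (auto simp: M_def)
qed

lemma atom_square_integrable:
  assumes "atom a"
  shows "square_integrable rho a" "integrable rho a"
proof -
  obtain R b where b: "R \<in> CZ_sets" "cancelling R (1 / measure rho R) b" "AE x in rho. a x = b x"
    using atom_representative[OF assms] by metis
  show int: "integrable rho a" using assms by (simp add: atom_def Lp1_iff)
  have "integrable rho (\<lambda>x. (norm (a x))\<^sup>2) \<longleftrightarrow> integrable rho (\<lambda>x. (norm (b x))\<^sup>2)"
    using borel_measurable_integrable[OF int] b(2,3)
    by (intro integrable_cong_AE) (auto simp: cancelling_def elim!: eventually_mono)
  then show "square_integrable rho a"
    using cancelling_square_integrable[OF b(1,2)] int unfolding square_integrable_def by auto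
qed

lemma set_integral_eq_indicator:
  fixes f :: "'a \<Rightarrow> complex"
  shows "(LINT x:A|M. f x) = (\<integral>x. indicator A x * f x \<partial>M)"
    and "set_integrable M A f \<longleftrightarrow> integrable M (\<lambda>x. indicator A x * f x)"
proof -
  have *: "(\<lambda>x. indicat_real A x *\<^sub>R f x) = (\<lambda>x. indicator A x * f x)"
    by (auto simp: indicator_def)
  show "(LINT x:A|M. f x) = (\<integral>x. indicator A x * f x \<partial>M)"
    and "set_integrable M A f \<longleftrightarrow> integrable M (\<lambda>x. indicator A x * f x)"
    unfolding set_lebesgue_integral_def set_integrable_def * by simp_all
qed

lemma integrable_set_integrable_times_bounded:
  fixes w b :: "'n::finite cfun"
  assumes R: "R \<in> sets borel" and w: "set_integrable rho R w" and wm: "w \<in> borel_measurable borel"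
    and b: "b \<in> borel_measurable borel" "\<And>x. norm (b x) \<le> M" "\<And>x. x \<notin> R \<Longrightarrow> b x = 0"
  shows "integrable rho (\<lambda>x. w x * b x)"
proof (rule Bochner_Integration.integrable_bound)
  show "integrable rho (\<lambda>x. of_real M * (indicator R x * w x))"
    using w unfolding set_integral_eq_indicator by simp
  have "norm (w x * b x) \<le> norm (of_real M * (indicator R x * w x))" for x
    using mult_left_mono[OF b(2)[of x] norm_ge_zero[of "w x"]] b(3)[of x] order_trans[OF norm_ge_zero b(2)[of x]]
    by (cases "x \<in> R") (auto simp: norm_mult mult.commute)
  then show "AE x in rho. norm (w x * b x) \<le> norm (of_real M * (indicator R x * w x))"
    by (intro AE_I2)
qed (use wm b in measurable)

text \<open>
  Duality: testing with the conjugate sign of $w - w_R$, made cancelling by subtracting its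
  average, recovers the mean oscillation of $w$ over $R$; subtracting the average costs the
  factor $2$.
\<close>

lemma oscillation_le_of_atoms:
  fixes w :: "'n::finite cfun"
  assumes R: "R \<in> CZ_sets" and wm: "w \<in> borel_measurable borel" and w: "set_integrable rho R w"
    and M: "\<And>b. cancelling R (1 / measure rho R) b \<Longrightarrow> norm (\<integral>x. w x * b x \<partial>rho) \<le> M"
  shows "(\<integral>x. indicator R x * norm (w x - average R w) \<partial>rho) \<le> 2 * M * measure rho R"
    and "integrable rho (\<lambda>x. indicator R x * norm (w x - average R w))"
proof -
  define m where "m = measure rho R"
  have m: "m > 0" using measure_CZ_set_pos[OF R] by (simp add: m_def)
  note Rm[measurable] = CZ_set_measurable[OF R]
  note wm[measurable]
  define c where "c = average R w"
  define v where "v x = w x - c" for x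
  have vm[measurable]: "v \<in> borel_measurable borel" unfolding v_def by measurable
  note indi = indicator_integral_complex(1)[of R rho, unfolded sets_rho, OF Rm emeasure_CZ_set_finite[OF R]]
  have int_ind: "(\<integral>x. indicator R x \<partial>rho) = complex_of_real m"
    using indicator_integral_complex(2)[of R rho] Rm emeasure_CZ_set_finite[OF R] by (simp add: m_def)
  have wi: "integrable rho (\<lambda>x. indicator R x * w x)" using w by (simp only: set_integral_eq_indicator)
  have vi: "integrable rho (\<lambda>x. indicator R x * v x)"
    using wi indi unfolding v_def right_diff_distrib by (intro Bochner_Integration.integrable_diff) auto
  then have vs: "set_integrable rho R v" by (simp only: set_integral_eq_indicator)
  have cm: "c * of_real m = (\<integral>x. indicator R x * w x \<partial>rho)"
    using m unfolding c_def average_def set_integral_eq_indicator by (simp add: m_def scaleR_conv_of_real)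
  have v0: "(\<integral>x. indicator R x * v x \<partial>rho) = 0"
  proof -
    have "(\<integral>x. indicator R x * v x \<partial>rho) = (\<integral>x. indicator R x * w x - indicator R x * c \<partial>rho)"
      by (simp add: v_def right_diff_distrib)
    also have "\<dots> = 0"
      using wi indi cm int_ind by (subst Bochner_Integration.integral_diff) (auto simp: mult.commute)
    finally show ?thesis .
  qed
  \<comment> \<open>$s$ is the conjugate sign, $e$ its average, and $b$ the resulting atom\<close>
  define s where "s x = indicator R x * cnj (sgn (v x))" for x
  have sm[measurable]: "s \<in> borel_measurable borel"
  proof -
    have "(\<lambda>x. cnj (sgn (v x))) \<in> borel_measurable borel"
      by (rule measurable_compose[OF _ borel_measurable_continuous_onI[of cnj]])
         (auto intro: continuous_intros simp: sgn_div_norm)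
    then show ?thesis unfolding s_def by measurable
  qed
  have s1: "norm (s x) \<le> 1" and sR: "x \<notin> R \<Longrightarrow> s x = 0" for x
    by (auto simp: s_def indicator_def norm_sgn)
  have si: "integrable rho s"
    by (rule square_integrable_bounded_support(2)[OF sm Rm emeasure_CZ_set_finite[OF R] s1 sR])
  define e where "e = (\<integral>x. s x \<partial>rho) / of_real m"
  have e1: "norm e \<le> 1"
  proof -
    have "norm (\<integral>x. s x \<partial>rho) \<le> (\<integral>x. norm (s x) \<partial>rho)" by (rule integral_norm_bound)
    also have "\<dots> \<le> (\<integral>x. indicator R x \<partial>rho)"
    proof (intro integral_mono)
      show "integrable rho (\<lambda>x. norm (s x))" using si by simp
      show "integrable rho (indicator R :: _ \<Rightarrow> real)"
        using emeasure_CZ_set_finite[OF R] by (intro integrable_real_indicator) auto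
      show "norm (s x) \<le> indicator R x" for x using s1[of x] sR[of x] by (cases "x \<in> R") auto
    qed
    also have "\<dots> = m" by (simp add: m_def)
    finally show ?thesis using m by (simp add: e_def norm_divide)
  qed
  define b where "b x = (s x - e * indicator R x) / of_real (2 * m)" for x
  have b: "cancelling R (1 / measure rho R) b"
    unfolding cancelling_def
  proof (intro conjI allI impI)
    show "b \<in> borel_measurable borel" unfolding b_def by measurable
    fix x
    have "norm (s x - e * indicator R x) \<le> norm (s x) + norm (e * indicator R x)"
      by (rule norm_triangle_ineq4)
    also have "\<dots> \<le> 1 + 1 * 1"
      using s1 e1 unfolding norm_mult by (intro add_mono mult_mono) (auto simp: indicator_def)
    finally show "norm (b x) \<le> 1 / measure rho R"
      using m by (simp add: b_def norm_divide m_def[symmetric] field_simps)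
    show "x \<notin> R \<Longrightarrow> b x = 0" using sR by (simp add: b_def)
  next
    have "(\<integral>x. s x - e * indicator R x \<partial>rho) = 0"
      using si indi int_ind m by (subst Bochner_Integration.integral_diff) (auto simp: e_def)
    then show "(\<integral>x. b x \<partial>rho) = 0" unfolding b_def by simp
  qed
  have pt: "complex_of_real (indicator R x * norm (v x)) = v x * s x" for x
    by (cases "x \<in> R")
       (auto simp: s_def sgn_div_norm scaleR_conv_of_real complex_norm_square[symmetric]
          power2_eq_square divide_simps mult.assoc[symmetric] mult.commute[of "inverse _"] simp del: of_real_mult
          simp flip: of_real_mult)
  have vsi: "integrable rho (\<lambda>x. v x * s x)"
    by (rule integrable_set_integrable_times_bounded[OF Rm vs vm sm s1 sR])
  have nvi: "integrable rho (\<lambda>x. indicator R x * norm (v x))"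
  proof -
    have "(\<lambda>x. norm (indicator R x * v x)) = (\<lambda>x. indicator R x * norm (v x))"
      by (auto simp: norm_mult indicator_def)
    then show ?thesis using integrable_norm[OF vi] by metis
  qed
  then show "integrable rho (\<lambda>x. indicator R x * norm (w x - average R w))"
    by (simp add: v_def c_def)
  have bm: "b \<in> borel_measurable borel" "\<And>x. norm (b x) \<le> 1 / measure rho R" "\<And>x. x \<notin> R \<Longrightarrow> b x = 0"
    and b0: "(\<integral>x. b x \<partial>rho) = 0"
    using cancellingD[OF b] by auto
  have bi: "integrable rho b" by (rule cancelling_square_integrable[OF R b])
  have wbi: "integrable rho (\<lambda>x. w x * b x)"
    by (rule integrable_set_integrable_times_bounded[OF Rm w wm bm])
  have "complex_of_real (\<integral>x. indicator R x * norm (v x) \<partial>rho) = (\<integral>x. v x * s x \<partial>rho)"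
    unfolding pt[symmetric] by (rule integral_complex_of_real[symmetric])
  also have "\<dots> = (\<integral>x. v x * s x - e * (indicator R x * v x) \<partial>rho)"
    using vsi vi v0 by (subst Bochner_Integration.integral_diff) auto
  also have "\<dots> = (\<integral>x. of_real (2 * m) * (w x * b x - c * b x) \<partial>rho)"
    using m by (intro Bochner_Integration.integral_cong) (auto simp: b_def v_def field_simps)
  also have "\<dots> = of_real (2 * m) * (\<integral>x. w x * b x \<partial>rho)"
    using wbi bi b0 by simp
  finally have "norm (complex_of_real (\<integral>x. indicator R x * norm (v x) \<partial>rho))
      = norm (of_real (2 * m) * (\<integral>x. w x * b x \<partial>rho))" by (rule arg_cong)
  then have "\<bar>\<integral>x. indicator R x * norm (v x) \<partial>rho\<bar> = 2 * m * norm (\<integral>x. w x * b x \<partial>rho)"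
    using m by (simp add: norm_mult)
  also have "\<dots> \<le> 2 * m * M" using M[OF b] m by (intro mult_left_mono) auto
  finally show "(\<integral>x. indicator R x * norm (w x - average R w) \<partial>rho) \<le> 2 * M * measure rho R"
    by (simp add: v_def c_def m_def mult_ac abs_le_iff)
qed

text \<open>
  The mean oscillation vanishes by the duality estimate with bound $0$.
\<close>

lemma AE_eq_average_of_cancelling:
  assumes R: "R \<in> CZ_sets" and wm: "w \<in> borel_measurable borel" and w: "set_integrable rho R w"
    and z: "\<And>b. cancelling R (1 / measure rho R) b \<Longrightarrow> (\<integral>x. w x * b x \<partial>rho) = 0"
  shows "AE x in rho. x \<in> R \<longrightarrow> w x = average R w"
proof -
  note o = oscillation_le_of_atoms[OF R wm w, of 0, simplified]
  have "(\<integral>x. indicator R x * norm (w x - average R w) \<partial>rho) \<le> 0" using o(1) z by simp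
  moreover have "0 \<le> (\<integral>x. indicator R x * norm (w x - average R w) \<partial>rho)" by (intro Bochner_Integration.integral_nonneg) auto
  ultimately have "(\<integral>x. indicator R x * norm (w x - average R w) \<partial>rho) = 0" by simp
  moreover have "integrable rho (\<lambda>x. indicator R x * norm (w x - average R w))" using o(2) z by simp
  ultimately have "AE x in rho. indicator R x * norm (w x - average R w) = 0"
    by (subst (asm) integral_nonneg_eq_0_iff_AE) auto
  then show ?thesis by eventually_elim (auto simp: indicator_def split: if_splits)
qed

text \<open>
  Clipping $w$ at height $k$ by the nearest-point projection onto a disk does not increase
  distances, so the pairings of the clipped functions with atoms stay bounded. This is what
  makes the pairing of a possibly unbounded $w$ with infinite sums of atoms meaningful.
\<close>

definition clip :: "nat \<Rightarrow> complex \<Rightarrow> complex" where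
  "clip k = closest_point (cball 0 (real k))"

lemma clip_dist: "norm (clip k z - clip k z') \<le> norm (z - z')"
  unfolding clip_def using closest_point_lipschitz[of "cball 0 (real k)" z z'] by (simp add: dist_norm)

lemma clip_norm_le: "norm (clip k z) \<le> real k"
  using closest_point_in_set[of "cball (0::complex) (real k)" z] by (simp add: clip_def)

lemma clip_self: "norm z \<le> real k \<Longrightarrow> clip k z = z"
  by (simp add: clip_def closest_point_self)

lemma clip_norm_le_norm: "norm (clip k z) \<le> norm z"
  using clip_dist[of k z 0] clip_self[of 0 k] by simp

lemma clip_tendsto: "(\<lambda>k. clip k z) \<longlonglongrightarrow> z"
proof -
  obtain N where "norm z \<le> real N" using real_arch_simple by blast
  then have "clip k z = z" if "k \<ge> N" for k using that by (intro clip_self) linarith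
  then show ?thesis by (intro tendsto_eventually eventually_sequentiallyI)
qed

lemma clip_measurable [measurable]: "clip k \<in> borel_measurable borel"
  unfolding clip_def
  by (intro borel_measurable_continuous_onI continuous_on_closest_point) auto

lemma clip_cancelling_bound:
  assumes R: "R \<in> CZ_sets" and wm: "w \<in> borel_measurable borel" and w: "set_integrable rho R w"
    and M: "\<And>b. cancelling R (1 / measure rho R) b \<Longrightarrow> norm (\<integral>x. w x * b x \<partial>rho) \<le> M"
    and b: "cancelling R (1 / measure rho R) b"
  shows "norm (\<integral>x. clip k (w x) * b x \<partial>rho) \<le> 2 * M"
proof -
  note wm[measurable]
  note Rm[measurable] = CZ_set_measurable[OF R]
  define m where "m = measure rho R"
  have m: "m > 0" using measure_CZ_set_pos[OF R] by (simp add: m_def)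
  define c where "c = clip k (average R w)"
  note o = oscillation_le_of_atoms[OF R wm w M]
  have bm[measurable]: "b \<in> borel_measurable borel" and b1: "\<And>x. norm (b x) \<le> 1 / m"
    and bR: "\<And>x. x \<notin> R \<Longrightarrow> b x = 0" and b0: "(\<integral>x. b x \<partial>rho) = 0"
    using cancellingD[OF b] by (auto simp: m_def)
  have bi: "integrable rho b" by (rule cancelling_square_integrable[OF R b])
  have cb: "integrable rho (\<lambda>x. clip k (w x) * b x)"
  proof (rule Bochner_Integration.integrable_bound[OF integrable_mult_right[OF integrable_norm[OF bi], of "real k"]])
    show "AE x in rho. norm (clip k (w x) * b x) \<le> norm (real k * norm (b x))"
      by (intro AE_I2) (auto simp: norm_mult intro!: mult_right_mono clip_norm_le)
  qed measurable
  have "(\<integral>x. clip k (w x) * b x \<partial>rho) = (\<integral>x. clip k (w x) * b x - c * b x \<partial>rho)"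
    using cb bi b0 by simp
  also have "norm \<dots> \<le> (\<integral>x. norm (clip k (w x) * b x - c * b x) \<partial>rho)" by (rule integral_norm_bound)
  also have "\<dots> \<le> (\<integral>x. 1 / m * (indicator R x * norm (w x - average R w)) \<partial>rho)"
  proof (intro integral_mono)
    show "integrable rho (\<lambda>x. norm (clip k (w x) * b x - c * b x))"
      using cb bi by (intro integrable_norm Bochner_Integration.integrable_diff integrable_mult_right)
    show "integrable rho (\<lambda>x. 1 / m * (indicator R x * norm (w x - average R w)))"
      using o(2) by (intro integrable_mult_right) auto
    fix x
    have "norm (clip k (w x) * b x - c * b x) = norm (clip k (w x) - c) * norm (b x)"
      by (simp add: left_diff_distrib[symmetric] norm_mult)
    also have "\<dots> \<le> 1 / m * (indicator R x * norm (w x - average R w))"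
    proof (cases "x \<in> R")
      case True
      have "norm (clip k (w x) - c) * norm (b x) \<le> norm (w x - average R w) * (1 / m)"
        unfolding c_def by (intro mult_mono clip_dist b1) auto
      then show ?thesis using True by (simp add: mult.commute)
    qed (simp add: bR)
    finally show "norm (clip k (w x) * b x - c * b x) \<le> 1 / m * (indicator R x * norm (w x - average R w))" .
  qed
  also have "\<dots> = 1 / m * (\<integral>x. indicator R x * norm (w x - average R w) \<partial>rho)" by simp
  also have "\<dots> \<le> 1 / m * (2 * M * m)"
    using o(1) m by (intro mult_left_mono) (auto simp: m_def)
  also have "\<dots> = 2 * M" using m by simp
  finally show ?thesis .
qed

lemma BMO_norm_le:
  fixes w :: "'n::finite cfun"
  assumes wm: "w \<in> borel_measurable borel" and w: "\<And>R. R \<in> CZ_sets \<Longrightarrow> set_integrable rho R w"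
    and M: "\<And>R b. R \<in> CZ_sets \<Longrightarrow> cancelling R (1 / measure rho R) b \<Longrightarrow> norm (\<integral>x. w x * b x \<partial>rho) \<le> M"
  shows "BMO_norm w \<le> ennreal (2 * M)"
  unfolding BMO_norm_def
proof (rule SUP_least)
  fix R :: "'n pt set" assume R: "R \<in> CZ_sets"
  note o = oscillation_le_of_atoms[OF R wm w[OF R] M[OF R]]
  have m: "measure rho R > 0" by (rule measure_CZ_set_pos[OF R])
  have "(\<integral>\<^sup>+x\<in>R. ennreal (norm (w x - average R w)) \<partial>rho)
      = (\<integral>\<^sup>+x. ennreal (indicator R x * norm (w x - average R w)) \<partial>rho)"
    by (intro nn_integral_cong) (auto simp: indicator_def)
  also have "\<dots> = ennreal (\<integral>x. indicator R x * norm (w x - average R w) \<partial>rho)"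
    using o(2) by (intro nn_integral_eq_integral) auto
  also have "\<dots> \<le> ennreal (2 * M * measure rho R)" using o(1) by (intro ennreal_leI) auto
  finally have "1 / emeasure rho R * (\<integral>\<^sup>+x\<in>R. ennreal (norm (w x - average R w)) \<partial>rho)
      \<le> ennreal (1 / measure rho R) * ennreal (2 * M * measure rho R)"
    unfolding inverse_emeasure_CZ_set[OF R] by (rule mult_left_mono) simp
  also have "\<dots> = ennreal (2 * M)"
    using m ennreal_mult'[of "1 / measure rho R" "2 * M * measure rho R"] by simp
  finally show "1 / emeasure rho R * (\<integral>\<^sup>+x\<in>R. ennreal (norm (w x - average R w)) \<partial>rho) \<le> ennreal (2 * M)" .
qed

lemma rho_AE_eqI:
  fixes u v :: "'n::finite cfun"
  assumes u: "\<And>C. compact C \<Longrightarrow> C \<subseteq> half_space \<Longrightarrow> set_integrable rho C u"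
    and v: "\<And>C. compact C \<Longrightarrow> C \<subseteq> half_space \<Longrightarrow> set_integrable rho C v"
    and eq: "\<And>A C. compact C \<Longrightarrow> C \<subseteq> half_space \<Longrightarrow> A \<in> sets borel \<Longrightarrow> A \<subseteq> C \<Longrightarrow>
      (LINT x:A|rho. u x) = (LINT x:A|rho. v x)"
  shows "AE x in rho. u x = v x"
proof -
  obtain C :: "nat \<Rightarrow> 'n pt set" where C: "\<And>n. compact (C n)" "\<And>n. C n \<subseteq> half_space"
    "\<Union> (range C) = half_space"
    using open_sigma_compact[OF open_half_space] by metis
  have "AE x in rho. x \<in> C n \<longrightarrow> u x = v x" for n
    by (rule rho_ae_eqI_compact[OF C(1,2) u[OF C(1,2)] v[OF C(1,2)] eq[OF C(1,2)]])
  then have "AE x in rho. \<forall>n. x \<in> C n \<longrightarrow> u x = v x" unfolding AE_all_countable by blast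
  with AE_rho_half_space show ?thesis by eventually_elim (use C(3) in blast)
qed

lemma square_integrable_indicator:
  assumes "A \<in> sets borel" "A \<subseteq> B" "B \<in> sets borel" "emeasure rho B < \<infinity>"
  shows "square_integrable rho (indicator A)"
  by (rule square_integrable_bounded_support(1)[of _ B 1])
     (use assms in \<open>auto simp: indicator_def\<close>)

lemma square_integrable_set_integrable:
  assumes "square_integrable rho w" "A \<in> sets borel" "emeasure rho A < \<infinity>"
  shows "set_integrable rho A w"
  unfolding set_integral_eq_indicator
  by (intro integrable_mult_square_integrable square_integrable_indicator[of A A] assms order_refl)

section \<open>Atoms under a singular integral operator\<close>

text \<open>
  The sets \<open>D R\<close> stand for the dilated sets $R^*$; they are a parameter so that an operator and
  its transpose share them.
\<close>

locale singular_integral =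
  fixes T :: "'n::finite cfun \<Rightarrow> 'n cfun" and k :: "'n pt \<Rightarrow> 'n pt \<Rightarrow> complex"
    and D :: "'n pt set \<Rightarrow> 'n pt set" and \<kappa> :: real
  assumes bounded_L2: "bounded_on_L2 T" and kernel: "regular_kernel T k"
    and D_open: "R \<in> CZ_sets \<Longrightarrow> open (D R)" and subset_D: "R \<in> CZ_sets \<Longrightarrow> R \<subseteq> D R"
    and D_measure: "R \<in> CZ_sets \<Longrightarrow> emeasure rho (D R) \<le> ennreal \<kappa> * emeasure rho R"
begin

definition hormander :: "real \<Rightarrow> bool" where
  "hormander A \<longleftrightarrow> A \<ge> 0 \<and> (\<forall>R\<in>CZ_sets. \<forall>y\<in>R. \<forall>z\<in>R.
     (\<integral>\<^sup>+x\<in>half_space - D R. ennreal (norm (k x y - k x z)) \<partial>rho) \<le> ennreal A)"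

lemma D_borel: "R \<in> CZ_sets \<Longrightarrow> D R \<in> sets borel"
  using D_open by auto

lemma D_finite:
  assumes R: "R \<in> CZ_sets"
  shows "emeasure rho (D R) < \<infinity>" "measure rho (D R) \<le> max \<kappa> 0 * measure rho R"
proof -
  have le: "emeasure rho (D R) \<le> ennreal (max \<kappa> 0 * measure rho R)"
    using D_measure[OF R] unfolding emeasure_CZ_set[OF R]
    by (cases "\<kappa> \<ge> 0") (auto simp: ennreal_mult max_def ennreal_neg)
  then show "emeasure rho (D R) < \<infinity>" by (rule le_less_trans) simp
  show "measure rho (D R) \<le> max \<kappa> 0 * measure rho R"
    using le unfolding measure_def by (intro enn2real_leI) auto
qed

text \<open>
  Off the dilated set the kernel may be replaced by its increment, because $a$ has integral $0$.
  If $y \<mapsto> k(x,y) a(y)$ is not integrable then neither is the integrand with the increment, and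
  both integrals are $0$ by convention.
\<close>

lemma representation_off_D:
  assumes R: "R \<in> CZ_sets" and a: "cancelling R M a"
  shows "AE x in rho. x \<in> half_space - D R \<longrightarrow> T a x = (\<integral>y. (k x y - k x z) * a y \<partial>rho)"
proof -
  obtain C where C: "compact C" "C \<subseteq> half_space" "R \<subseteq> C" "C - R \<in> null_sets rho"
    using CZ_set_compact_hull[OF R] by metis
  have "AE x in rho. x \<notin> C \<longrightarrow> T a x = (\<integral>y. k x y * a y \<partial>rho)"
  proof (rule regular_kernelD[OF kernel])
    show "\<And>y. y \<notin> C \<Longrightarrow> a y = 0" using cancellingD(3)[OF a] C(3) by blast
  qed (use cancellingD[OF a] C in auto)
  moreover have "AE x in rho. x \<notin> C - R" using C(4) by (rule AE_not_in)
  ultimately show ?thesis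
  proof eventually_elim
    case (elim x)
    have ai: "integrable rho a" by (rule cancelling_square_integrable[OF R a])
    have zi: "integrable rho (\<lambda>y. k x z * a y)" using ai by simp
    have eq: "(\<integral>y. k x y * a y \<partial>rho) = (\<integral>y. (k x y - k x z) * a y \<partial>rho)"
    proof (cases "integrable rho (\<lambda>y. k x y * a y)")
      case True
      then show ?thesis using zi cancellingD(4)[OF a] by (simp add: left_diff_distrib)
    next
      case False
      then have "\<not> integrable rho (\<lambda>y. (k x y - k x z) * a y)"
        using Bochner_Integration.integrable_add[OF _ zi, of "\<lambda>y. (k x y - k x z) * a y"]
        by (auto simp: left_diff_distrib)
      then show ?thesis using False by (simp add: not_integrable_integral_eq)
    qed
    show ?case using elim eq subset_D[OF R] by auto
  qed
qed

lemma increment_measurable: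
  assumes "a \<in> borel_measurable borel"
  shows "(\<lambda>(x, y). (k x y - k x z) * a y) \<in> borel_measurable (rho \<Otimes>\<^sub>M rho)"
proof -
  note k = regular_kernel_measurable[OF kernel]
  have "(\<lambda>p. k (fst p) (snd p)) \<in> borel_measurable (rho \<Otimes>\<^sub>M rho)"
    using k by (simp add: case_prod_unfold)
  moreover have "(\<lambda>p. k (fst p) z) \<in> borel_measurable (rho \<Otimes>\<^sub>M rho)"
    using measurable_compose[OF measurable_fst measurable_compose[OF measurable_Pair2'[of z rho rho] k]]
    by simp
  moreover have "(\<lambda>p. a (snd p)) \<in> borel_measurable (rho \<Otimes>\<^sub>M rho)"
    using measurable_compose[OF measurable_snd, of a rho borel] assms by simp
  ultimately show ?thesis
    unfolding case_prod_unfold by (intro borel_measurable_times borel_measurable_diff)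
qed

lemma increment_integral_le:
  assumes H: "hormander A" and R: "R \<in> CZ_sets" and a: "cancelling R M a" and z: "z \<in> R"
  shows "(\<integral>\<^sup>+x. \<integral>\<^sup>+y. indicator (half_space - D R) x * ennreal (norm ((k x y - k x z) * a y)) \<partial>rho \<partial>rho)
    \<le> ennreal (A * (\<integral>y. norm (a y) \<partial>rho))"
proof -
  let ?E = "half_space - D R"
  note [measurable] = D_borel[OF R] regular_kernel_measurable[OF kernel] cancellingD(1)[OF a]
  have inc: "(\<lambda>p. (k (fst p) (snd p) - k (fst p) z) * a (snd p)) \<in> borel_measurable (rho \<Otimes>\<^sub>M rho)"
    using increment_measurable[OF cancellingD(1)[OF a], of z] by (simp add: case_prod_unfold)
  have indm: "(\<lambda>p. indicator ?E (fst p) :: ennreal) \<in> borel_measurable (rho \<Otimes>\<^sub>M rho)"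
    by (rule measurable_compose[OF measurable_fst]) measurable
  have "(\<integral>\<^sup>+x. \<integral>\<^sup>+y. indicator ?E x * ennreal (norm ((k x y - k x z) * a y)) \<partial>rho \<partial>rho)
    = (\<integral>\<^sup>+y. \<integral>\<^sup>+x. indicator ?E x * ennreal (norm ((k x y - k x z) * a y)) \<partial>rho \<partial>rho)"
  proof (rule rho_pair.Fubini'[symmetric])
    have "(\<lambda>p. indicator ?E (fst p) * ennreal (norm ((k (fst p) (snd p) - k (fst p) z) * a (snd p))))
      \<in> borel_measurable (rho \<Otimes>\<^sub>M rho)"
      using inc indm by measurable
    then show "(\<lambda>(x, y). indicator ?E x * ennreal (norm ((k x y - k x z) * a y))) \<in> borel_measurable (rho \<Otimes>\<^sub>M rho)"
      by (simp add: case_prod_unfold)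
  qed
  also have "\<dots> \<le> (\<integral>\<^sup>+y. ennreal A * ennreal (norm (a y)) \<partial>rho)"
  proof (rule nn_integral_mono)
    fix y
    have km: "(\<lambda>x. k x w) \<in> borel_measurable rho" for w
      using measurable_compose[OF measurable_Pair2'[of w rho rho] regular_kernel_measurable[OF kernel]] by simp
    have "(\<integral>\<^sup>+x. indicator ?E x * ennreal (norm ((k x y - k x z) * a y)) \<partial>rho)
      = (\<integral>\<^sup>+x. (ennreal (norm (k x y - k x z)) * indicator ?E x) * ennreal (norm (a y)) \<partial>rho)"
      by (intro nn_integral_cong) (simp add: norm_mult ennreal_mult mult_ac)
    also have "\<dots> = (\<integral>\<^sup>+x\<in>?E. ennreal (norm (k x y - k x z)) \<partial>rho) * ennreal (norm (a y))"
      using km[of y] km[of z] D_borel[OF R] by (intro nn_integral_multc) measurable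
    also have "\<dots> \<le> ennreal A * ennreal (norm (a y))"
    proof (cases "y \<in> R")
      case True
      then show ?thesis using H R z unfolding hormander_def by (intro mult_right_mono) auto
    next
      case False
      then show ?thesis using cancellingD(3)[OF a] by simp
    qed
    finally show "(\<integral>\<^sup>+x. indicator ?E x * ennreal (norm ((k x y - k x z) * a y)) \<partial>rho)
      \<le> ennreal A * ennreal (norm (a y))" .
  qed
  also have "\<dots> = ennreal A * (\<integral>\<^sup>+y. ennreal (norm (a y)) \<partial>rho)"
    by (intro nn_integral_cmult) measurable
  also have "\<dots> = ennreal (A * (\<integral>y. norm (a y) \<partial>rho))"
    using cancelling_square_integrable(2)[OF R a] H
    by (subst nn_integral_eq_integral) (auto simp: ennreal_mult hormander_def)
  finally show ?thesis .
qed

text \<open>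
  On the dilated set, whose measure is comparable to that of $R$, Cauchy--Schwarz and the $L^2$
  bound control $Ta$; off it, the Hormander condition does.
\<close>

lemma cancelling_image_L1:
  assumes H: "hormander A"
  obtains C where "C \<ge> 0"
    "\<And>R a. R \<in> CZ_sets \<Longrightarrow> cancelling R (1 / measure rho R) a \<Longrightarrow>
       integrable rho (T a) \<and> (\<integral>x. norm (T a x) \<partial>rho) \<le> C"
proof -
  obtain B where B: "B \<ge> 0" "\<And>f. square_integrable rho f \<Longrightarrow> sq_norm rho (T f) \<le> B * sq_norm rho f"
    using bounded_on_L2_bound[OF bounded_L2] by metis
  have A: "A \<ge> 0" using H by (simp add: hormander_def)
  define C where "C = sqrt (max \<kappa> 0 * B) + A"
  have C: "C \<ge> 0" using A B(1) by (simp add: C_def)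
  have "integrable rho (T a) \<and> (\<integral>x. norm (T a x) \<partial>rho) \<le> C"
    if R: "R \<in> CZ_sets" and a: "cancelling R (1 / measure rho R) a" for R a
  proof -
    define m where "m = measure rho R"
    have m: "m > 0" using measure_CZ_set_pos[OF R] by (simp add: m_def)
    have asq: "square_integrable rho a" by (rule cancelling_square_integrable[OF R a])
    have Ta: "square_integrable rho (T a)" by (rule bounded_on_L2_square_integrable[OF bounded_L2 asq])
    note [measurable] = D_borel[OF R] square_integrable_measurable[OF Ta]
    have D_sq: "square_integrable rho (indicator (D R))"
      by (rule square_integrable_indicator[OF D_borel[OF R] order_refl D_borel[OF R] D_finite(1)[OF R]])
    have sqD: "sq_norm rho (indicator (D R)) = measure rho (D R)"
    proof -
      have "(\<lambda>x. (norm (indicator (D R) x :: complex))\<^sup>2) = indicator (D R)"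
        by (auto simp: indicator_def)
      then show ?thesis by (simp add: sq_norm_def)
    qed
    have "(\<integral>x. norm (indicator (D R) x :: complex) * norm (T a x) \<partial>rho)\<^sup>2
        \<le> sq_norm rho (indicator (D R)) * sq_norm rho (T a)"
      by (rule Cauchy_Schwarz_integral[OF D_sq Ta])
    also have "\<dots> \<le> (max \<kappa> 0 * m) * (B * ((1 / m)\<^sup>2 * m))"
    proof (rule mult_mono)
      show "sq_norm rho (indicator (D R)) \<le> max \<kappa> 0 * m"
        unfolding sqD m_def by (rule D_finite(2)[OF R])
      show "sq_norm rho (T a) \<le> B * ((1 / m)\<^sup>2 * m)"
        using B(2)[OF asq] mult_left_mono[OF cancelling_norm_integral(2)[OF R a] B(1)] by (simp add: m_def)
    qed (use m in auto)
    also have "\<dots> = max \<kappa> 0 * B" using m by (simp add: power2_eq_square)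
    finally have on: "(\<integral>x. norm (indicator (D R) x :: complex) * norm (T a x) \<partial>rho) \<le> sqrt (max \<kappa> 0 * B)"
      by (rule real_le_rsqrt)
    have oni: "integrable rho (\<lambda>x. norm (indicator (D R) x :: complex) * norm (T a x))"
      using integrable_norm[OF integrable_mult_square_integrable[OF D_sq Ta]] by (simp add: norm_mult)
    obtain z where z: "z \<in> R" using CZ_set_nonempty[OF R] by blast
    have a1: "(\<integral>x. norm (a x) \<partial>rho) \<le> 1"
      using cancelling_norm_integral(1)[OF R a] m by (simp add: m_def)
    have "(\<integral>\<^sup>+x. ennreal (norm (T a x)) \<partial>rho)
      \<le> (\<integral>\<^sup>+x. ennreal (norm (indicator (D R) x :: complex) * norm (T a x))
          + (\<integral>\<^sup>+y. indicator (half_space - D R) x * ennreal (norm ((k x y - k x z) * a y)) \<partial>rho) \<partial>rho)"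
    proof (rule nn_integral_mono_AE)
      show "AE x in rho. ennreal (norm (T a x)) \<le> ennreal (norm (indicator (D R) x :: complex) * norm (T a x))
          + (\<integral>\<^sup>+y. indicator (half_space - D R) x * ennreal (norm ((k x y - k x z) * a y)) \<partial>rho)"
        using representation_off_D[OF R a, of z] AE_rho_half_space
      proof eventually_elim
        case (elim x)
        show ?case
        proof (cases "x \<in> D R")
          case False
          then have x: "x \<in> half_space - D R" using elim by blast
          have "ennreal (norm (\<integral>y. (k x y - k x z) * a y \<partial>rho)) \<le> (\<integral>\<^sup>+y. ennreal (norm ((k x y - k x z) * a y)) \<partial>rho)"
            by (cases "integrable rho (\<lambda>y. (k x y - k x z) * a y)")
               (auto intro: integral_norm_bound_ennreal simp: not_integrable_integral_eq)
          then show ?thesis using x elim(1) by simp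
        qed simp
      qed
    qed
    also have "\<dots> = (\<integral>\<^sup>+x. ennreal (norm (indicator (D R) x :: complex) * norm (T a x)) \<partial>rho)
        + (\<integral>\<^sup>+x. \<integral>\<^sup>+y. indicator (half_space - D R) x * ennreal (norm ((k x y - k x z) * a y)) \<partial>rho \<partial>rho)"
    proof (rule nn_integral_add)
      have "(\<lambda>p. indicator (half_space - D R) (fst p) :: ennreal) \<in> borel_measurable (rho \<Otimes>\<^sub>M rho)"
        by (rule measurable_compose[OF measurable_fst]) measurable
      moreover have "(\<lambda>p. (k (fst p) (snd p) - k (fst p) z) * a (snd p)) \<in> borel_measurable (rho \<Otimes>\<^sub>M rho)"
        using increment_measurable[OF cancellingD(1)[OF a], of z] by (simp add: case_prod_unfold)
      ultimately have "(\<lambda>p. indicator (half_space - D R) (fst p) * ennreal (norm ((k (fst p) (snd p) - k (fst p) z) * a (snd p))))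
          \<in> borel_measurable (rho \<Otimes>\<^sub>M rho)" by measurable
      then have "(\<lambda>(x, y). indicator (half_space - D R) x * ennreal (norm ((k x y - k x z) * a y)))
          \<in> borel_measurable (rho \<Otimes>\<^sub>M rho)" by (simp add: case_prod_unfold)
      from rho.borel_measurable_nn_integral_fst[OF this]
      show "(\<lambda>x. \<integral>\<^sup>+y. indicator (half_space - D R) x * ennreal (norm ((k x y - k x z) * a y)) \<partial>rho)
          \<in> borel_measurable rho" by simp
    qed measurable
    also have "\<dots> \<le> ennreal (sqrt (max \<kappa> 0 * B)) + ennreal A"
    proof (rule add_mono)
      show "(\<integral>\<^sup>+x. ennreal (norm (indicator (D R) x :: complex) * norm (T a x)) \<partial>rho) \<le> ennreal (sqrt (max \<kappa> 0 * B))"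
        using oni on by (subst nn_integral_eq_integral) (auto intro: ennreal_leI)
      have "A * (\<integral>y. norm (a y) \<partial>rho) \<le> A" using mult_left_mono[OF a1 A] by simp
      then show "(\<integral>\<^sup>+x. \<integral>\<^sup>+y. indicator (half_space - D R) x * ennreal (norm ((k x y - k x z) * a y)) \<partial>rho \<partial>rho) \<le> ennreal A"
        using increment_integral_le[OF H R a z] ennreal_leI order_trans by blast
    qed
    also have "\<dots> = ennreal C" using A B(1) by (simp add: C_def ennreal_plus)
    finally have le: "(\<integral>\<^sup>+x. ennreal (norm (T a x)) \<partial>rho) \<le> ennreal C" .
    have i: "integrable rho (T a)"
      using le by (intro integrableI_bounded) (auto intro: le_less_trans)
    moreover have "(\<integral>x. norm (T a x) \<partial>rho) \<le> C"
      using le C i by (subst (asm) nn_integral_eq_integral) auto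
    ultimately show ?thesis by blast
  qed
  then show ?thesis using that C by blast
qed

lemma atom_image_L1:
  assumes H: "hormander A"
  obtains C where "C > 0"
    "\<And>a. atom a \<Longrightarrow> integrable rho (T a)" "\<And>a. atom a \<Longrightarrow> (\<integral>x. norm (T a x) \<partial>rho) \<le> C"
proof -
  obtain C where C: "C \<ge> 0"
    "\<And>R a. R \<in> CZ_sets \<Longrightarrow> cancelling R (1 / measure rho R) a \<Longrightarrow>
       integrable rho (T a) \<and> (\<integral>x. norm (T a x) \<partial>rho) \<le> C"
    using cancelling_image_L1[OF H] by metis
  have "integrable rho (T a) \<and> (\<integral>x. norm (T a x) \<partial>rho) \<le> C + 1" if a: "atom a" for a
  proof -
    obtain R b where b: "R \<in> CZ_sets" "cancelling R (1 / measure rho R) b" "AE x in rho. a x = b x"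
      using atom_representative[OF a] by metis
    have bsq: "square_integrable rho b" by (rule cancelling_square_integrable[OF b(1,2)])
    note asq = atom_square_integrable(1)[OF a]
    note Tm = square_integrable_measurable[OF bounded_on_L2_square_integrable[OF bounded_L2 asq]]
      square_integrable_measurable[OF bounded_on_L2_square_integrable[OF bounded_L2 bsq]]
    have ae: "AE x in rho. T a x = T b x"
      by (rule bounded_on_L2_cong_AE[OF bounded_L2 asq bsq b(3)])
    have "integrable rho (T a) \<longleftrightarrow> integrable rho (T b)"
      by (rule integrable_cong_AE[OF Tm ae])
    moreover have "(\<integral>x. norm (T a x) \<partial>rho) = (\<integral>x. norm (T b x) \<partial>rho)"
      using ae Tm by (intro integral_cong_AE) (auto elim: eventually_mono)
    ultimately show ?thesis using C(2)[OF b(1,2)] by simp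
  qed
  then show ?thesis using that[of "C + 1"] C(1) by auto
qed

end

section \<open>Extension to the Hardy space\<close>

text \<open>
  Integrals over relatively compact Borel sets separate locally integrable functions, in
  particular members of $L^1$ from members of $L^2$.
\<close>

definition test_set :: "'n::finite pt set \<Rightarrow> bool" where
  "test_set A \<longleftrightarrow> A \<in> sets borel \<and> (\<exists>C. compact C \<and> C \<subseteq> half_space \<and> A \<subseteq> C)"

lemma test_set_measure: "test_set A \<Longrightarrow> A \<in> sets borel" "test_set A \<Longrightarrow> emeasure rho A < \<infinity>"
proof -
  show "test_set A \<Longrightarrow> A \<in> sets borel" by (simp add: test_set_def)
  assume "test_set A"
  then obtain C where C: "compact C" "C \<subseteq> half_space" "A \<subseteq> C" by (auto simp: test_set_def)
  have "emeasure rho A \<le> emeasure rho C" using C by (intro emeasure_mono) (auto simp: borel_compact)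
  then show "emeasure rho A < \<infinity>" using emeasure_rho_compact[OF C(1,2)] by (rule le_less_trans)
qed

lemma test_set_square_integrable: "test_set A \<Longrightarrow> square_integrable rho (indicator A)"
  using square_integrable_indicator[of A A] test_set_measure[of A] by blast

lemma borel_measurable_rho_iff [simp]: "f \<in> borel_measurable rho \<longleftrightarrow> f \<in> borel_measurable borel"
  by (intro arg_cong[where f = "\<lambda>S. f \<in> S"] measurable_cong_sets) auto

context singular_integral
begin

text \<open>
  For a test set $A$ the function $g = T^t 1_A$ has bounded pairings with atoms. Pairing a sum of
  atoms with the clipped functions and letting the height tend to infinity, by dominated
  convergence for series, expresses $\int_A \sum_j c_j T a_j$ through the sum $h$ of the atomic
  series alone.
\<close>

lemma pairing_with_H1:
  assumes S: "is_transpose T S" and A: "test_set A"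
    and C: "\<And>a. atom a \<Longrightarrow> integrable rho (T a)" "\<And>a. atom a \<Longrightarrow> (\<integral>x. norm (T a x) \<partial>rho) \<le> C"
    and h: "integrable rho h" and dec: "atomic_decomp h c a"
  shows "(\<lambda>n. \<integral>x. h x * clip n (S (indicator A) x) \<partial>rho) \<longlonglongrightarrow>
    (\<integral>x. indicator A x * (\<Sum>j. c j * T (a j) x) \<partial>rho)"
proof -
  have sm: "summable (\<lambda>j. norm (c j))" and atoms: "atom (a j)" for j
    using dec by (auto simp: atomic_decomp_def)
  note Asq = test_set_square_integrable[OF A]
  define g where "g = S (indicator A)"
  have gsq: "square_integrable rho g" using S Asq by (simp add: g_def is_transpose_def)
  have gm[measurable]: "g \<in> borel_measurable borel" using square_integrable_measurable[OF gsq] by simp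
  have dual: "(\<integral>x. b x * g x \<partial>rho) = (\<integral>x. indicator A x * T b x \<partial>rho)" if "square_integrable rho b" for b
    using S that Asq by (simp add: is_transpose_def g_def mult.commute)
  have ind1: "norm (indicator A x :: complex) \<le> 1" for x by (simp add: indicator_def)
  have indm: "(indicator A :: 'n cfun) \<in> borel_measurable rho" using test_set_measure(1)[OF A] by simp
  have gM: "norm (\<integral>x. b x * g x \<partial>rho) \<le> C" if b: "atom b" for b
  proof -
    have "(\<integral>x. b x * g x \<partial>rho) = (\<integral>x. T b x * indicator A x \<partial>rho)"
      using dual[OF atom_square_integrable(1)[OF b]] by (simp add: mult.commute)
    also have "norm \<dots> \<le> 1 * (\<integral>x. norm (T b x) \<partial>rho)"
      by (rule integrable_times_bounded(2)[OF C(1)[OF b] indm ind1])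
    also have "\<dots> \<le> C" using C(2)[OF b] by simp
    finally show ?thesis .
  qed
  have clipM: "norm (\<integral>x. b x * clip n (g x) \<partial>rho) \<le> 2 * C" if b: "atom b" for b n
  proof -
    obtain R b' where b': "R \<in> CZ_sets" "cancelling R (1 / measure rho R) b'" "AE x in rho. b x = b' x"
      using atom_representative[OF b] by metis
    have "set_integrable rho R g"
      using gsq CZ_set_measurable[OF b'(1)] emeasure_CZ_set_finite[OF b'(1)]
      by (intro square_integrable_set_integrable) auto
    moreover have "norm (\<integral>x. g x * e x \<partial>rho) \<le> C" if "cancelling R (1 / measure rho R) e" for e
      using gM[OF cancelling_imp_atom[OF b'(1) that]] by (simp add: mult.commute)
    ultimately have "norm (\<integral>x. clip n (g x) * b' x \<partial>rho) \<le> 2 * C"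
      using b' by (intro clip_cancelling_bound[OF b'(1) gm]) auto
    moreover have "(\<integral>x. b x * clip n (g x) \<partial>rho) = (\<integral>x. clip n (g x) * b' x \<partial>rho)"
      using b'(3) borel_measurable_integrable[OF atom_square_integrable(2)[OF b]] cancellingD(1)[OF b'(2)]
      by (intro integral_cong_AE) (auto elim: eventually_mono)
    ultimately show ?thesis by simp
  qed
  define F where "F j n = (\<integral>x. (c j * a j x) * clip n (g x) \<partial>rho)" for j n
  have ai: "integrable rho (\<lambda>x. c j * a j x)" for j
    using atom_square_integrable(2)[OF atoms] by simp
  have clipm: "(\<lambda>x. clip n (g x)) \<in> borel_measurable rho" for n by simp
  have F_sums: "(\<lambda>j. F j n) sums (\<integral>x. h x * clip n (g x) \<partial>rho)" for n
    unfolding sums_def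
  proof (rule LIM_zero_cancel, rule Lim_null_comparison)
    have lim: "(\<lambda>N. \<integral>x. norm (h x - (\<Sum>j<N. c j * a j x)) \<partial>rho) \<longlonglongrightarrow> 0"
      using dec unfolding atomic_decomp_def Lp1_norm by blast
    show "(\<lambda>N. real n * (\<integral>x. norm (h x - (\<Sum>j<N. c j * a j x)) \<partial>rho)) \<longlonglongrightarrow> 0"
      by (rule tendsto_mult_right_zero[OF lim])
    show "\<forall>\<^sub>F N in sequentially. norm ((\<Sum>j<N. F j n) - (\<integral>x. h x * clip n (g x) \<partial>rho))
        \<le> real n * (\<integral>x. norm (h x - (\<Sum>j<N. c j * a j x)) \<partial>rho)"
    proof (intro always_eventually allI)
      fix N
      let ?d = "\<lambda>x. h x - (\<Sum>j<N. c j * a j x)"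
      have di: "integrable rho ?d" using h ai by auto
      have "(\<Sum>j<N. F j n) - (\<integral>x. h x * clip n (g x) \<partial>rho) = - (\<integral>x. ?d x * clip n (g x) \<partial>rho)"
        using integrable_times_bounded(1)[OF ai clipm clip_norm_le]
          integrable_times_bounded(1)[OF h clipm clip_norm_le]
        by (simp add: F_def left_diff_distrib sum_distrib_right)
      then show "norm ((\<Sum>j<N. F j n) - (\<integral>x. h x * clip n (g x) \<partial>rho)) \<le> real n * (\<integral>x. norm (?d x) \<partial>rho)"
        using integrable_times_bounded(2)[OF di clipm clip_norm_le] by simp
    qed
  qed
  have F_bound: "norm (F j n) \<le> norm (c j) * (2 * C)" for j n
    using clipM[OF atoms, of j n] by (simp add: F_def mult.assoc norm_mult mult_left_mono)
  have F_lim: "(\<lambda>n. F j n) \<longlonglongrightarrow> (\<integral>x. (c j * a j x) * g x \<partial>rho)" for j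
    unfolding F_def
  proof (rule integral_dominated_convergence[where w = "\<lambda>x. norm (c j * a j x * g x)"])
    have "integrable rho (\<lambda>x. c j * a j x * g x)"
      by (intro integrable_mult_square_integrable square_integrable_cmult atom_square_integrable atoms gsq)
    then show "integrable rho (\<lambda>x. norm (c j * a j x * g x))" "(\<lambda>x. c j * a j x * g x) \<in> borel_measurable rho"
      by (auto intro: borel_measurable_integrable)
    show "(\<lambda>x. c j * a j x * clip n (g x)) \<in> borel_measurable rho" for n
      using borel_measurable_integrable[OF ai[of j]] by simp
    show "AE x in rho. (\<lambda>n. c j * a j x * clip n (g x)) \<longlonglongrightarrow> c j * a j x * g x"
      by (intro AE_I2 tendsto_mult_left clip_tendsto)
    show "AE x in rho. norm (c j * a j x * clip n (g x)) \<le> norm (c j * a j x * g x)" for n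
      by (intro AE_I2) (simp add: norm_mult mult_left_mono clip_norm_le_norm)
  qed
  have Fg: "(\<integral>x. (c j * a j x) * g x \<partial>rho) = (\<integral>x. indicator A x * (c j * T (a j) x) \<partial>rho)" for j
    using dual[OF atom_square_integrable(1)[OF atoms]] by (simp add: mult.assoc mult.left_commute)
  have "(\<lambda>n. \<Sum>j. F j n) \<longlonglongrightarrow> (\<Sum>j. \<integral>x. (c j * a j x) * g x \<partial>rho)"
  proof -
    have "eventually (\<lambda>(j, n). norm (F j n) \<le> norm (c j) * (2 * C)) (sequentially \<times>\<^sub>F sequentially)"
      using F_bound by (intro always_eventually) auto
    from tannerys_theorem[OF F_lim this summable_mult2[OF sm] trivial_limit_sequentially]
    show ?thesis by blast
  qed
  moreover have "(\<Sum>j. F j n) = (\<integral>x. h x * clip n (g x) \<partial>rho)" for n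
    using F_sums by (rule sums_unique[symmetric])
  moreover have "(\<Sum>j. \<integral>x. (c j * a j x) * g x \<partial>rho) = (\<integral>x. indicator A x * (\<Sum>j. c j * T (a j) x) \<partial>rho)"
    unfolding Fg
  proof (rule sums_unique[symmetric, OF L1_series(3)[OF _ _ indm ind1]])
    show "integrable rho (\<lambda>x. c j * T (a j) x)" for j using C(1)[OF atoms] by simp
    show "summable (\<lambda>j. \<integral>x. norm (c j * T (a j) x) \<partial>rho)"
      by (rule summable_comparison_test'[OF summable_mult2[OF sm, of C]])
         (use C(2)[OF atoms] in \<open>auto simp: norm_mult intro!: mult_left_mono\<close>)
  qed
  ultimately show ?thesis unfolding g_def by simp
qed

text \<open>
  The extension assigns to $h$ a function $u$ whose integrals over test sets are the limits of the
  clipped pairings with $h$. Such a $u$ is unique almost everywhere, which yields at once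
  linearity, independence of the decomposition and agreement with $T$ on $L^2$, where
  dominated convergence identifies the limit. The sum $\sum_j c_j T a_j$ of any atomic
  decomposition is such a $u$, and gives the norm bound.
\<close>

theorem extends_H1_L1:
  assumes H: "hormander A"
  shows "extends_H1_L1 T"
proof -
  obtain S where S: "is_transpose T S" using transpose_exists[OF bounded_L2] by metis
  obtain C where C: "C > 0" "\<And>a. atom a \<Longrightarrow> integrable rho (T a)"
      "\<And>a. atom a \<Longrightarrow> (\<integral>x. norm (T a x) \<partial>rho) \<le> C"
    using atom_image_L1[OF H] by metis
  define paired where "paired h u \<longleftrightarrow> (\<forall>A. test_set A \<longrightarrow>
      (\<lambda>n. \<integral>x. h x * clip n (S (indicator A) x) \<partial>rho) \<longlonglongrightarrow> (\<integral>x. indicator A x * u x \<partial>rho))" for h u :: "'n cfun"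
  have Sm: "(\<lambda>x. clip n (S (indicator A) x)) \<in> borel_measurable rho" if "test_set A" for A n
    using S test_set_square_integrable[OF that] square_integrable_measurable[of rho "S (indicator A)"]
    by (simp add: is_transpose_def)
  have clip_int: "integrable rho (\<lambda>x. h x * clip n (S (indicator A) x))" if "integrable rho h" "test_set A" for h A n
    by (rule integrable_times_bounded(1)[OF that(1) Sm[OF that(2)] clip_norm_le])
  have ind_int: "integrable rho (\<lambda>x. indicator A x * u x)" if "integrable rho u" "test_set A" for A and u :: "'n cfun"
    using integrable_times_bounded(1)[OF that(1), of "indicator A" 1] test_set_measure(1)[OF that(2)]
    by (simp add: mult.commute indicator_def)
  have uniq: "ae_eq u v"
    if "paired h u" "paired h v" "\<And>A. test_set A \<Longrightarrow> set_integrable rho A u" "\<And>A. test_set A \<Longrightarrow> set_integrable rho A v"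
    for h u v
    unfolding ae_eq_def
  proof (rule rho_AE_eqI)
    fix K :: "'n pt set" assume K: "compact K" "K \<subseteq> half_space"
    then have "test_set K" by (auto simp: test_set_def borel_compact)
    then show "set_integrable rho K u" "set_integrable rho K v" using that by auto
    fix A :: "'n pt set" assume "A \<in> sets borel" "A \<subseteq> K"
    then have "test_set A" using K by (auto simp: test_set_def)
    then show "(LINT x:A|rho. u x) = (LINT x:A|rho. v x)"
      using that(1,2) LIMSEQ_unique unfolding paired_def set_integral_eq_indicator by blast
  qed
  have L1_set: "set_integrable rho A u" if "integrable rho u" "test_set A" for A and u :: "'n cfun"
    unfolding set_integral_eq_indicator by (rule ind_int[OF that])
  have ex: "\<exists>u. integrable rho u \<and> paired h u \<and> (\<integral>x. norm (u x) \<partial>rho) \<le> C * (\<Sum>j. norm (c j))"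
    if h: "integrable rho h" and dec: "atomic_decomp h c a" for h c a
  proof -
    have sm: "summable (\<lambda>j. norm (c j))" and atoms: "atom (a j)" for j
      using dec by (auto simp: atomic_decomp_def)
    let ?f = "\<lambda>j x. c j * T (a j) x"
    have i: "integrable rho (?f j)" for j using C(2)[OF atoms] by simp
    have le: "(\<integral>x. norm (?f j x) \<partial>rho) \<le> C * norm (c j)" for j
      using mult_left_mono[OF C(3)[OF atoms[of j]] norm_ge_zero[of "c j"]] by (simp add: norm_mult mult.commute)
    have s: "summable (\<lambda>j. \<integral>x. norm (?f j x) \<partial>rho)"
      by (rule summable_comparison_test'[OF summable_mult[OF sm, of C]]) (use le in simp)
    have "(\<Sum>j. \<integral>x. norm (?f j x) \<partial>rho) \<le> (\<Sum>j. C * norm (c j))"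
      by (rule suminf_le[OF le s summable_mult[OF sm]])
    also have "\<dots> = C * (\<Sum>j. norm (c j))" by (rule suminf_mult[OF sm])
    finally have "(\<integral>x. norm (\<Sum>j. ?f j x) \<partial>rho) \<le> C * (\<Sum>j. norm (c j))"
      using L1_series(2)[OF i s] by simp
    moreover have "paired h (\<lambda>x. \<Sum>j. ?f j x)"
      unfolding paired_def using pairing_with_H1[OF S _ C(2,3) h dec] by blast
    ultimately show ?thesis using L1_series(1)[OF i s] by blast
  qed
  define U where "U h = (SOME u. integrable rho u \<and> paired h u)" for h
  have U: "integrable rho (U h)" "paired h (U h)" if "integrable rho u" "paired h u" for h u
    using someI[of "\<lambda>u. integrable rho u \<and> paired h u" u] that by (auto simp: U_def)
  have H1: "integrable rho h \<and> (\<exists>c a. atomic_decomp h c a)" if "h \<in> H1" for h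
    using that unfolding H1_def Lp1_iff by blast
  have UH1: "integrable rho (U h)" "paired h (U h)" if h: "h \<in> H1" for h
  proof -
    obtain c a where "integrable rho h" "atomic_decomp h c a" using H1[OF h] by blast
    then obtain u where "integrable rho u" "paired h u" using ex by blast
    then show "integrable rho (U h)" "paired h (U h)" using U by blast+
  qed
  have add: "ae_eq (U (\<lambda>x. f x + g x)) (\<lambda>x. U f x + U g x)" if f: "f \<in> H1" and g: "g \<in> H1" for f g
  proof -
    have i: "integrable rho (\<lambda>x. U f x + U g x)" using UH1 f g by simp
    have p: "paired (\<lambda>x. f x + g x) (\<lambda>x. U f x + U g x)"
      unfolding paired_def
    proof (intro allI impI)
      fix A :: "'n pt set" assume A: "test_set A"
      have "(\<lambda>n. (\<integral>x. f x * clip n (S (indicator A) x) \<partial>rho) + (\<integral>x. g x * clip n (S (indicator A) x) \<partial>rho))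
        \<longlonglongrightarrow> (\<integral>x. indicator A x * U f x \<partial>rho) + (\<integral>x. indicator A x * U g x \<partial>rho)"
        using UH1(2)[OF f] UH1(2)[OF g] A by (intro tendsto_add) (auto simp: paired_def)
      then show "(\<lambda>n. \<integral>x. (f x + g x) * clip n (S (indicator A) x) \<partial>rho)
        \<longlonglongrightarrow> (\<integral>x. indicator A x * (U f x + U g x) \<partial>rho)"
        using clip_int[OF _ A] H1[OF f] H1[OF g] ind_int[OF UH1(1)[OF f] A] ind_int[OF UH1(1)[OF g] A]
        by (simp add: distrib_left distrib_right)
    qed
    show ?thesis by (rule uniq[OF U(2)[OF i p] p]) (use U(1)[OF i p] i L1_set in auto)
  qed
  have cmult: "ae_eq (U (\<lambda>x. d * f x)) (\<lambda>x. d * U f x)" if f: "f \<in> H1" for d f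
  proof -
    have i: "integrable rho (\<lambda>x. d * U f x)" using UH1 f by simp
    have p: "paired (\<lambda>x. d * f x) (\<lambda>x. d * U f x)"
      unfolding paired_def
    proof (intro allI impI)
      fix A :: "'n pt set" assume A: "test_set A"
      have "(\<lambda>n. d * (\<integral>x. f x * clip n (S (indicator A) x) \<partial>rho)) \<longlonglongrightarrow> d * (\<integral>x. indicator A x * U f x \<partial>rho)"
        using UH1(2)[OF f] A by (intro tendsto_mult_left) (auto simp: paired_def)
      then show "(\<lambda>n. \<integral>x. (d * f x) * clip n (S (indicator A) x) \<partial>rho)
        \<longlonglongrightarrow> (\<integral>x. indicator A x * (d * U f x) \<partial>rho)"
        by (simp add: mult.assoc mult.left_commute[of _ d])
    qed
    show ?thesis by (rule uniq[OF U(2)[OF i p] p]) (use U(1)[OF i p] i L1_set in auto)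
  qed
  have bound: "Lp_norm 1 (U h) \<le> C * H1_norm h" if h: "h \<in> H1" for h
  proof -
    have "Lp_norm 1 (U h) / C \<le> H1_norm h"
      unfolding H1_norm_def
    proof (rule cInf_greatest)
      show "{\<Sum>j. norm (c j) |c a. atomic_decomp h c a} \<noteq> {}" using H1[OF h] by blast
      fix y assume "y \<in> {\<Sum>j. norm (c j) |c a. atomic_decomp h c a}"
      then obtain c a where y: "y = (\<Sum>j. norm (c j))" and dec: "atomic_decomp h c a" by blast
      obtain u where u: "integrable rho u" "paired h u" "(\<integral>x. norm (u x) \<partial>rho) \<le> C * y"
        using ex[OF _ dec] H1[OF h] unfolding y by blast
      have "ae_eq (U h) u" by (rule uniq[OF UH1(2)[OF h] u(2)]) (use UH1(1)[OF h] u(1) L1_set in auto)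
      then have "(\<integral>x. norm (U h x) \<partial>rho) = (\<integral>x. norm (u x) \<partial>rho)"
        using borel_measurable_integrable[OF UH1(1)[OF h]] borel_measurable_integrable[OF u(1)]
        unfolding ae_eq_def by (intro integral_cong_AE) (auto elim: eventually_mono)
      then show "Lp_norm 1 (U h) / C \<le> y" using u(3) C(1) by (simp add: Lp1_norm field_simps)
    qed
    then show ?thesis using C(1) by (simp add: field_simps)
  qed
  have agree: "ae_eq (U h) (T h)" if h: "h \<in> H1" and h2: "square_integrable rho h" for h
  proof (rule uniq[OF UH1(2)[OF h]])
    have Th: "square_integrable rho (T h)" by (rule bounded_on_L2_square_integrable[OF bounded_L2 h2])
    show "set_integrable rho A (T h)" if "test_set A" for A
      using square_integrable_set_integrable[OF Th] test_set_measure[OF that] by blast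
    show "set_integrable rho A (U h)" if "test_set A" for A using L1_set UH1(1)[OF h] that by blast
    show "paired h (T h)"
      unfolding paired_def
    proof (intro allI impI)
      fix A :: "'n pt set" assume A: "test_set A"
      let ?g = "S (indicator A)"
      note Asq = test_set_square_integrable[OF A]
      have g: "square_integrable rho ?g" using S Asq by (simp add: is_transpose_def)
      have hg: "integrable rho (\<lambda>x. h x * ?g x)" by (rule integrable_mult_square_integrable[OF h2 g])
      have "(\<lambda>n. \<integral>x. h x * clip n (?g x) \<partial>rho) \<longlonglongrightarrow> (\<integral>x. h x * ?g x \<partial>rho)"
      proof (rule integral_dominated_convergence[where w = "\<lambda>x. norm (h x * ?g x)"])
        show "(\<lambda>x. h x * ?g x) \<in> borel_measurable rho" using hg by (rule borel_measurable_integrable)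
        show "integrable rho (\<lambda>x. norm (h x * ?g x))" using hg by simp
        show "(\<lambda>x. h x * clip n (?g x)) \<in> borel_measurable rho" for n
          using Sm[OF A] square_integrable_measurable[OF h2] by simp
        show "AE x in rho. (\<lambda>n. h x * clip n (?g x)) \<longlonglongrightarrow> h x * ?g x"
          by (intro AE_I2 tendsto_mult_left clip_tendsto)
        show "AE x in rho. norm (h x * clip n (?g x)) \<le> norm (h x * ?g x)" for n
          by (intro AE_I2) (simp add: norm_mult mult_left_mono clip_norm_le_norm)
      qed
      also have "(\<integral>x. h x * ?g x \<partial>rho) = (\<integral>x. indicator A x * T h x \<partial>rho)"
        using S h2 Asq by (simp add: is_transpose_def mult.commute)
      finally show "(\<lambda>n. \<integral>x. h x * clip n (?g x) \<partial>rho) \<longlonglongrightarrow> (\<integral>x. indicator A x * T h x \<partial>rho)" .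
    qed
  qed
  show ?thesis
    unfolding extends_H1_L1_def linear_on_upto_def
    using add cmult bound agree UH1(1)
    by (intro exI[of _ U] conjI ballI allI exI[of _ C]) (auto simp: Lp1_iff Lp2_iff)
qed

end

section \<open>Extension to bounded functions\<close>

text \<open>
  Values selected arbitrarily on a basis of $X$ extend linearly, and the extension stays in the
  relation because the relation is linear. If the basis extends one of $W$, the values on the
  latter can be taken in the smaller relation $Q$.
\<close>

lemma linear_selection:
  fixes P Q :: "('a \<Rightarrow> complex) \<Rightarrow> ('a \<Rightarrow> complex) \<Rightarrow> bool"
  assumes P_add: "\<And>f g u v. P f u \<Longrightarrow> P g v \<Longrightarrow> P (\<lambda>x. f x + g x) (\<lambda>x. u x + v x)"
    and P_cmult: "\<And>c f u. P f u \<Longrightarrow> P (\<lambda>x. c * f x) (\<lambda>x. c * u x)"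
    and P_total: "\<And>f. f \<in> X \<Longrightarrow> \<exists>u. P f u"
    and Q_add: "\<And>f g u v. Q f u \<Longrightarrow> Q g v \<Longrightarrow> Q (\<lambda>x. f x + g x) (\<lambda>x. u x + v x)"
    and Q_cmult: "\<And>c f u. Q f u \<Longrightarrow> Q (\<lambda>x. c * f x) (\<lambda>x. c * u x)"
    and Q_total: "\<And>f. f \<in> W \<Longrightarrow> \<exists>u. Q f u"
    and QP: "\<And>f u. Q f u \<Longrightarrow> P f u" and WX: "W \<subseteq> X" and W0: "(\<lambda>x. 0) \<in> W"
  obtains U where "\<And>f g. U (\<lambda>x. f x + g x) = (\<lambda>x. U f x + U g x)"
    "\<And>c f. U (\<lambda>x. c * f x) = (\<lambda>x. c * U f x)"
    "\<And>f. f \<in> X \<Longrightarrow> P f (U f)" "\<And>f. f \<in> W \<Longrightarrow> Q f (U f)"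
proof -
  define s where "s = (\<lambda>(c::complex) (f::'a \<Rightarrow> complex) x. c * f x)"
  interpret V: vector_space s
    by unfold_locales (auto simp: s_def fun_eq_iff plus_fun_def algebra_simps)
  interpret VP: vector_space_pair s s ..
  obtain B0 where B0: "B0 \<subseteq> W" "V.independent B0" "W \<subseteq> V.span B0"
    using V.maximal_independent_subset[of W] by metis
  obtain B where B: "B0 \<subseteq> B" "B \<subseteq> X" "V.independent B" "X \<subseteq> V.span B"
    using V.maximal_independent_subset_extend[of B0 X] B0 WX by (metis subset_trans)
  define val where "val b = (if b \<in> B0 then SOME u. Q b u else SOME u. P b u)" for b
  have valQ: "Q b (val b)" if "b \<in> B0" for b
    using someI_ex[OF Q_total[of b]] that B0(1) by (auto simp: val_def)
  have valP: "P b (val b)" if "b \<in> B" for b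
  proof (cases "b \<in> B0")
    case True then show ?thesis using valQ QP by blast
  next
    case False then show ?thesis using someI_ex[OF P_total[of b]] that B(2) by (auto simp: val_def)
  qed
  define U where "U = VP.construct B val"
  have lin: "Vector_Spaces.linear s s U" unfolding U_def by (rule VP.linear_construct[OF B(3)])
  have add: "U (f + g) = U f + U g" and scale: "U (s c f) = s c (U f)" for f g c
    using lin unfolding Vector_Spaces.linear_iff by blast+
  have U_B: "U b = val b" if "b \<in> B" for b unfolding U_def by (rule VP.construct_basis[OF B(3) that])
  have span: "V.span E \<subseteq> {f. N f (U f)}"
    if E: "\<And>b. b \<in> E \<Longrightarrow> N b (U b)" and N0: "N (\<lambda>x. 0) u0"
      and N_add: "\<And>f g u v. N f u \<Longrightarrow> N g v \<Longrightarrow> N (\<lambda>x. f x + g x) (\<lambda>x. u x + v x)"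
      and N_cmult: "\<And>c f u. N f u \<Longrightarrow> N (\<lambda>x. c * f x) (\<lambda>x. c * u x)" for N E u0
  proof (rule V.span_minimal)
    show "E \<subseteq> {f. N f (U f)}" using E by blast
    show "V.subspace {f. N f (U f)}"
    proof (rule V.subspaceI)
      have "U 0 = 0" using scale[of 0 0] by (simp add: V.scale_zero_left)
      moreover have "N 0 0"
        using N_cmult[OF N0, of 0] by (simp add: zero_fun_def)
      ultimately show "0 \<in> {f. N f (U f)}" by simp
    next
      fix f g assume "f \<in> {f. N f (U f)}" "g \<in> {f. N f (U f)}"
      then show "f + g \<in> {f. N f (U f)}" using N_add[of f "U f" g "U g"] add[of f g] by (simp add: plus_fun_def)
    next
      fix c f assume "f \<in> {f. N f (U f)}"
      then show "s c f \<in> {f. N f (U f)}" using N_cmult[of f "U f" c] scale[of c f] by (simp add: s_def)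
    qed
  qed
  obtain u0 where u0: "Q (\<lambda>x. 0) u0" using Q_total[OF W0] by blast
  have "P f (U f)" if "f \<in> X" for f
    using span[of B P u0] valP U_B QP[OF u0] P_add P_cmult that B(4) by auto
  moreover have "Q f (U f)" if "f \<in> W" for f
  proof -
    have "Q b (U b)" if "b \<in> B0" for b using valQ[OF that] U_B that B(1) by (metis subsetD)
    from span[of B0 Q u0, OF this u0 Q_add Q_cmult] show ?thesis using that B0(3) by blast
  qed
  moreover have "U (\<lambda>x. f x + g x) = (\<lambda>x. U f x + U g x)" for f g
    using add[of f g] by (simp add: plus_fun_def)
  moreover have "U (\<lambda>x. c * f x) = (\<lambda>x. c * U f x)" for c f
    using scale[of c f] by (simp add: s_def)
  ultimately show ?thesis using that by blast
qed

lemma Linf_AE_bound: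
  assumes "f \<in> Linf"
  shows "AE x in rho. norm (f x) \<le> enn2real (Linf_norm f)" "Linf_norm f = ennreal (enn2real (Linf_norm f))"
proof -
  have fin: "Linf_norm f < \<infinity>" using assms by (simp add: Linf_def)
  then show eq: "Linf_norm f = ennreal (enn2real (Linf_norm f))" by simp
  have "AE x in rho. ennreal (norm (f x)) \<le> Linf_norm f"
    unfolding Linf_norm_def by (rule esssup_AE)
  then show "AE x in rho. norm (f x) \<le> enn2real (Linf_norm f)"
    by (subst (asm) eq) (simp add: ennreal_le_iff)
qed

lemma LinfI:
  assumes "f \<in> borel_measurable rho" "AE x in rho. norm (f x) \<le> B"
  shows "f \<in> Linf"
proof -
  have "AE x in rho. ennreal (norm (f x)) \<le> ennreal B"
    using assms(2) by eventually_elim (rule ennreal_leI)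
  then have "Linf_norm f \<le> ennreal B"
    unfolding Linf_norm_def using assms(1) by (intro esssup_I) auto
  then show ?thesis using assms(1) by (auto simp: Linf_def intro: le_less_trans)
qed

lemma Linf_measurable: "f \<in> Linf \<Longrightarrow> f \<in> borel_measurable rho"
  by (simp add: Linf_def)

lemma Linf_add: "f \<in> Linf \<Longrightarrow> g \<in> Linf \<Longrightarrow> (\<lambda>x. f x + g x) \<in> Linf"
proof (rule LinfI[where B = "enn2real (Linf_norm f) + enn2real (Linf_norm g)"])
  assume f: "f \<in> Linf" and g: "g \<in> Linf"
  show "(\<lambda>x. f x + g x) \<in> borel_measurable rho"
    by (rule borel_measurable_add[OF Linf_measurable[OF f] Linf_measurable[OF g]])
  show "AE x in rho. norm (f x + g x) \<le> enn2real (Linf_norm f) + enn2real (Linf_norm g)"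
    using Linf_AE_bound(1)[OF f] Linf_AE_bound(1)[OF g]
    by eventually_elim (rule norm_triangle_mono)
qed

lemma Linf_cmult: "f \<in> Linf \<Longrightarrow> (\<lambda>x. c * f x) \<in> Linf"
proof (rule LinfI[where B = "norm c * enn2real (Linf_norm f)"])
  assume f: "f \<in> Linf"
  show "(\<lambda>x. c * f x) \<in> borel_measurable rho"
    by (rule borel_measurable_times[OF borel_measurable_const Linf_measurable[OF f]])
  show "AE x in rho. norm (c * f x) \<le> norm c * enn2real (Linf_norm f)"
    using Linf_AE_bound(1)[OF f] by eventually_elim (simp add: norm_mult mult_left_mono)
qed

lemma integrable_Linf_times:
  assumes f: "f \<in> Linf" and g: "integrable rho g"
  shows "integrable rho (\<lambda>x. f x * g x)"
    "norm (\<integral>x. f x * g x \<partial>rho) \<le> enn2real (Linf_norm f) * (\<integral>x. norm (g x) \<partial>rho)"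
proof -
  let ?L = "enn2real (Linf_norm f)"
  note [measurable] = Linf_measurable[OF f] borel_measurable_integrable[OF g]
  have ng: "integrable rho (\<lambda>x. ?L * norm (g x))" using g by simp
  have pt: "AE x in rho. norm (f x * g x) \<le> ?L * norm (g x)"
    using Linf_AE_bound(1)[OF f] by eventually_elim (simp add: norm_mult mult_right_mono)
  show i: "integrable rho (\<lambda>x. f x * g x)"
    by (rule Bochner_Integration.integrable_bound[OF ng]) (use pt in \<open>auto elim!: eventually_mono simp: abs_mult\<close>)
  have "norm (\<integral>x. f x * g x \<partial>rho) \<le> (\<integral>x. norm (f x * g x) \<partial>rho)" by (rule integral_norm_bound)
  also have "\<dots> \<le> (\<integral>x. ?L * norm (g x) \<partial>rho)" using i ng pt by (intro integral_mono_AE) auto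
  finally show "norm (\<integral>x. f x * g x \<partial>rho) \<le> ?L * (\<integral>x. norm (g x) \<partial>rho)" by simp
qed

lemma cancelling_subset_scale:
  assumes "cancelling R M b" "R \<subseteq> R'" "norm c * M \<le> M'"
  shows "cancelling R' M' (\<lambda>x. c * b x)"
proof -
  note b = cancellingD[OF assms(1)]
  have "norm (c * b x) \<le> M'" for x
    using mult_left_mono[OF b(2)[of x] norm_ge_zero[of c]] assms(3) by (simp add: norm_mult)
  moreover have "c * b x = 0" if "x \<notin> R'" for x
  proof -
    have "b x = 0" using b(3) that assms(2) by blast
    then show ?thesis by simp
  qed
  ultimately show ?thesis unfolding cancelling_def using b(1,4) by simp
qed

locale transposed_pair =
  T: singular_integral T k D \<kappa> + S: singular_integral S "\<lambda>x y. k y x" D \<kappa>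
  for T S :: "'n::finite cfun \<Rightarrow> 'n cfun" and k D \<kappa> +
  assumes transpose: "is_transpose T S"
begin

text \<open>
  The equation that determines $Tf$ modulo constants on each $R$: it says that
  $\langle u, b\rangle = \langle f, T^t b\rangle$ for all atoms $b$ on $R$.
\<close>

definition represents_on :: "'n pt set \<Rightarrow> 'n cfun \<Rightarrow> 'n cfun \<Rightarrow> bool" where
  "represents_on R f u \<longleftrightarrow> u \<in> borel_measurable borel \<and> set_integrable rho R u \<and>
     (\<forall>b. cancelling R (1 / measure rho R) b \<longrightarrow> (\<integral>x. u x * b x \<partial>rho) = (\<integral>x. f x * S b x \<partial>rho))"

text \<open>
  Only the part of $f$ in the dilated set is fed to $T$; the contribution of the remaining part is
  given by the increments of the kernel, which are integrable by the Hormander condition.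
\<close>

lemma represents_on_exists:
  assumes H: "S.hormander A" and R: "R \<in> CZ_sets" and f: "f \<in> Linf"
  obtains u where "represents_on R f u"
proof -
  let ?L = "enn2real (Linf_norm f)"
  let ?E = "half_space - D R"
  obtain z where z: "z \<in> R" using CZ_set_nonempty[OF R] by blast
  note Rb[measurable] = CZ_set_measurable[OF R]
  note Db[measurable] = T.D_borel[OF R]
  have fm: "f \<in> borel_measurable rho" by (rule Linf_measurable[OF f])
  note km = regular_kernel_measurable[OF T.kernel]
  define f1 where "f1 x = indicator (D R) x * f x" for x
  have f1sq: "square_integrable rho f1"
    unfolding square_integrable_def
  proof
    show f1m: "f1 \<in> borel_measurable rho" unfolding f1_def using fm by measurable
    show "integrable rho (\<lambda>x. (norm (f1 x))\<^sup>2)"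
    proof (rule Bochner_Integration.integrable_bound)
      show "integrable rho (\<lambda>x. ?L\<^sup>2 * indicator (D R) x)"
        using T.D_finite(1)[OF R] by (intro integrable_mult_right integrable_real_indicator) auto
      show "(\<lambda>x. (norm (f1 x))\<^sup>2) \<in> borel_measurable rho" using f1m by measurable
      show "AE x in rho. norm ((norm (f1 x))\<^sup>2) \<le> norm (?L\<^sup>2 * indicator (D R) x)"
        using Linf_AE_bound(1)[OF f]
        by eventually_elim (auto simp: f1_def indicator_def intro!: power_mono)
    qed
  qed
  define v1 where "v1 = T f1"
  have v1sq: "square_integrable rho v1"
    unfolding v1_def by (rule bounded_on_L2_square_integrable[OF T.bounded_L2 f1sq])
  \<comment> \<open>restricted to $R$ in the first variable, the increments are integrable on the product space\<close>
  define G where "G x y = indicator R x * (indicator ?E y * ((k x y - k z y) * f y))" for x y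
  have fst_m: "(\<lambda>p. indicator R (fst p) :: complex) \<in> borel_measurable (rho \<Otimes>\<^sub>M rho)"
    by (rule measurable_compose[OF measurable_fst]) measurable
  have snd_m: "(\<lambda>p. indicator ?E (snd p) :: complex) \<in> borel_measurable (rho \<Otimes>\<^sub>M rho)"
    by (rule measurable_compose[OF measurable_snd]) measurable
  have fsnd: "(\<lambda>p. f (snd p)) \<in> borel_measurable (rho \<Otimes>\<^sub>M rho)"
    using measurable_compose[OF measurable_snd fm] .
  have kz: "(\<lambda>y. k x y) \<in> borel_measurable rho" for x
    using measurable_compose[OF measurable_Pair1'[of x rho rho] km] by simp
  have kzs: "(\<lambda>p. k z (snd p)) \<in> borel_measurable (rho \<Otimes>\<^sub>M rho)"
    using measurable_compose[OF measurable_snd kz] .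
  have kp: "(\<lambda>p. k (fst p) (snd p)) \<in> borel_measurable (rho \<Otimes>\<^sub>M rho)"
    using km by (simp add: case_prod_unfold)
  have Gm: "(\<lambda>p. G (fst p) (snd p)) \<in> borel_measurable (rho \<Otimes>\<^sub>M rho)"
    unfolding G_def using fst_m snd_m fsnd kzs kp by measurable
  have A: "A \<ge> 0" using H by (simp add: S.hormander_def)
  have Gint: "integrable (rho \<Otimes>\<^sub>M rho) (case_prod G)"
  proof (rule integrableI_bounded)
    show "case_prod G \<in> borel_measurable (rho \<Otimes>\<^sub>M rho)" using Gm by (simp add: case_prod_unfold)
    have "(\<integral>\<^sup>+p. ennreal (norm (case_prod G p)) \<partial>(rho \<Otimes>\<^sub>M rho)) = (\<integral>\<^sup>+x. \<integral>\<^sup>+y. ennreal (norm (G x y)) \<partial>rho \<partial>rho)"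
      using rho.nn_integral_fst[of "\<lambda>p. ennreal (norm (case_prod G p))" rho] Gm by (simp add: case_prod_unfold)
    also have "\<dots> \<le> (\<integral>\<^sup>+x. ennreal (?L * A) * indicator R x \<partial>rho)"
    proof (rule nn_integral_mono)
      fix x
      show "(\<integral>\<^sup>+y. ennreal (norm (G x y)) \<partial>rho) \<le> ennreal (?L * A) * indicator R x"
      proof (cases "x \<in> R")
        case True
        have "(\<integral>\<^sup>+y. ennreal (norm (G x y)) \<partial>rho)
            \<le> (\<integral>\<^sup>+y. ennreal ?L * (ennreal (norm (k x y - k z y)) * indicator ?E y) \<partial>rho)"
        proof (rule nn_integral_mono_AE)
          show "AE y in rho. ennreal (norm (G x y)) \<le> ennreal ?L * (ennreal (norm (k x y - k z y)) * indicator ?E y)"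
            using Linf_AE_bound(1)[OF f]
          proof eventually_elim
            case (elim y)
            show ?case
            proof (cases "y \<in> ?E")
              case True
              have "norm (G x y) \<le> ?L * norm (k x y - k z y)"
                using mult_left_mono[OF elim norm_ge_zero[of "k x y - k z y"]] True \<open>x \<in> R\<close>
                by (simp add: G_def norm_mult mult.commute)
              then show ?thesis using True by (simp add: ennreal_mult[symmetric] ennreal_leI)
            next
              case False
              then have "G x y = 0" by (auto simp: G_def indicator_def)
              then show ?thesis by simp
            qed
          qed
        qed
        also have "\<dots> = ennreal ?L * (\<integral>\<^sup>+y\<in>?E. ennreal (norm (k x y - k z y)) \<partial>rho)"
        proof (rule nn_integral_cmult)
          have "(\<lambda>y. ennreal (norm (k x y - k z y))) \<in> borel_measurable rho"
            using borel_measurable_diff[OF kz[of x] kz[of z]] by measurable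
          moreover have "(indicator ?E :: _ \<Rightarrow> ennreal) \<in> borel_measurable rho" by measurable
          ultimately show "(\<lambda>y. ennreal (norm (k x y - k z y)) * indicator ?E y) \<in> borel_measurable rho"
            by (rule borel_measurable_times_ennreal)
        qed
        also have "\<dots> \<le> ennreal ?L * ennreal A"
          using H R True z by (intro mult_left_mono) (auto simp: S.hormander_def)
        finally show ?thesis using True A by (simp add: ennreal_mult)
      qed (simp add: G_def)
    qed
    also have "\<dots> = ennreal (?L * A) * emeasure rho R" by (simp add: nn_integral_cmult_indicator)
    also have "\<dots> < \<infinity>" using emeasure_CZ_set_finite[OF R] by (simp add: ennreal_mult_less_top)
    finally show "(\<integral>\<^sup>+p. ennreal (norm (case_prod G p)) \<partial>(rho \<Otimes>\<^sub>M rho)) < \<infinity>" .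
  qed
  define v2 where "v2 x = (\<integral>y. G x y \<partial>rho)" for x
  have v2i: "integrable rho v2" unfolding v2_def by (rule rho_pair.integrable_fst[OF Gint])
  have v2R: "set_integrable rho R v2"
    unfolding set_integral_eq_indicator
    using integrable_times_bounded(1)[OF v2i, of "indicator R" 1] by (simp add: mult.commute indicator_def)
  have v1R: "set_integrable rho R v1"
    using v1sq emeasure_CZ_set_finite[OF R] by (intro square_integrable_set_integrable) auto
  have m1: "v1 \<in> borel_measurable borel" using square_integrable_measurable[OF v1sq] by simp
  have m2: "v2 \<in> borel_measurable borel" using borel_measurable_integrable[OF v2i] by simp
  have pair: "(\<integral>x. (v1 x + v2 x) * b x \<partial>rho) = (\<integral>x. f x * S b x \<partial>rho)"
    if b: "cancelling R (1 / measure rho R) b" for b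
  proof -
    note bD = cancellingD[OF b]
    have bsq: "square_integrable rho b" by (rule cancelling_square_integrable[OF R b])
    have Sb: "square_integrable rho (S b)" by (rule bounded_on_L2_square_integrable[OF S.bounded_L2 bsq])
    have Sbi: "integrable rho (S b)"
      using S.atom_image_L1[OF H] cancelling_imp_atom[OF R b] by metis
    have b1: "integrable rho (\<lambda>x. v1 x * b x)" by (rule integrable_mult_square_integrable[OF v1sq bsq])
    have bm: "b \<in> borel_measurable rho" using bD(1) by simp
    have b2: "integrable rho (\<lambda>x. v2 x * b x)" by (rule integrable_times_bounded(1)[OF v2i bm bD(2)])
    have e1: "(\<integral>x. v1 x * b x \<partial>rho) = (\<integral>x. f1 x * S b x \<partial>rho)"
      using transpose f1sq bsq by (simp add: v1_def is_transpose_def)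
    have bfst: "(\<lambda>p. b (fst p)) \<in> borel_measurable (rho \<Otimes>\<^sub>M rho)"
      by (rule measurable_compose[OF measurable_fst bm])
    have Gb: "integrable (rho \<Otimes>\<^sub>M rho) (\<lambda>(x, y). G x y * b x)"
      using integrable_times_bounded(1)[OF Gint bfst bD(2)] by (simp add: case_prod_unfold)
    have "(\<integral>x. v2 x * b x \<partial>rho) = (\<integral>x. \<integral>y. G x y * b x \<partial>rho \<partial>rho)"
      unfolding v2_def by (simp only: integral_mult_left_zero)
    also have "\<dots> = (\<integral>y. \<integral>x. G x y * b x \<partial>rho \<partial>rho)"
      by (rule rho_pair.Fubini_integral[OF Gb, symmetric])
    also have "\<dots> = (\<integral>y. indicator ?E y * f y * S b y \<partial>rho)"
    proof (rule integral_cong_AE)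
      show "(\<lambda>y. \<integral>x. G x y * b x \<partial>rho) \<in> borel_measurable rho"
        by (rule borel_measurable_integrable[OF rho_pair.integrable_snd[OF Gb]])
      show "(\<lambda>y. indicator ?E y * f y * S b y) \<in> borel_measurable rho"
        using fm square_integrable_measurable[OF Sb] by measurable
      show "AE y in rho. (\<integral>x. G x y * b x \<partial>rho) = indicator ?E y * f y * S b y"
        using S.representation_off_D[OF R b, of z]
      proof eventually_elim
        case (elim y)
        have "(\<integral>x. G x y * b x \<partial>rho) = (\<integral>x. (indicator ?E y * f y) * ((k x y - k z y) * b x) \<partial>rho)"
          using bD(3) by (intro Bochner_Integration.integral_cong) (auto simp: G_def indicator_def)
        also have "\<dots> = (indicator ?E y * f y) * (\<integral>x. (k x y - k z y) * b x \<partial>rho)" by simp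
        finally show ?case using elim by (auto simp: indicator_def)
      qed
    qed
    finally have e2: "(\<integral>x. v2 x * b x \<partial>rho) = (\<integral>y. indicator ?E y * f y * S b y \<partial>rho)" .
    have i1: "integrable rho (\<lambda>x. f1 x * S b x)" by (rule integrable_mult_square_integrable[OF f1sq Sb])
    have i2: "integrable rho (\<lambda>y. indicator ?E y * f y * S b y)"
      using integrable_times_bounded(1)[OF integrable_Linf_times(1)[OF f Sbi], of "indicator ?E" 1]
      by (simp add: mult_ac indicator_def)
    have "(\<integral>x. (v1 x + v2 x) * b x \<partial>rho) = (\<integral>x. f1 x * S b x + indicator ?E x * f x * S b x \<partial>rho)"
      using b1 b2 e1 e2 i1 i2 by (simp add: distrib_right)
    also have "\<dots> = (\<integral>x. f x * S b x \<partial>rho)"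
    proof (rule integral_cong_AE)
      show "AE x in rho. f1 x * S b x + indicator ?E x * f x * S b x = f x * S b x"
        using AE_rho_half_space by eventually_elim (auto simp: f1_def indicator_def)
    qed (use i1 i2 integrable_Linf_times(1)[OF f Sbi] in \<open>auto intro!: borel_measurable_integrable simp del: borel_measurable_rho_iff\<close>)
    finally show ?thesis .
  qed
  have "set_integrable rho R (\<lambda>x. v1 x + v2 x)" using v1R v2R by (rule set_integral_add)
  then have "represents_on R f (\<lambda>x. v1 x + v2 x)"
    unfolding represents_on_def using m1 m2 pair by simp
  then show ?thesis by (rule that)
qed

text \<open>
  An atom on the smaller set is a multiple, by the ratio of the measures, of an atom on the
  larger one.
\<close>

lemma represents_on_subset:
  assumes u: "represents_on R' f u" and fm: "f \<in> borel_measurable borel" and R: "R \<in> CZ_sets" "R' \<in> CZ_sets" "R \<subseteq> R'"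
  shows "represents_on R f u"
proof -
  note um = u[unfolded represents_on_def, THEN conjunct1]
  have ui: "set_integrable rho R' u" using u by (simp add: represents_on_def)
  define c where "c = measure rho R / measure rho R'"
  have c: "c > 0" unfolding c_def using measure_CZ_set_pos[OF R(1)] measure_CZ_set_pos[OF R(2)] by simp
  have "(\<integral>x. u x * b x \<partial>rho) = (\<integral>x. f x * S b x \<partial>rho)" if b: "cancelling R (1 / measure rho R) b" for b
  proof -
    have bsq: "square_integrable rho b" by (rule cancelling_square_integrable[OF R(1) b])
    have c': "cancelling R' (1 / measure rho R') (\<lambda>x. complex_of_real c * b x)"
    proof (rule cancelling_subset_scale[OF b R(3)])
      have "\<bar>c\<bar> * (1 / measure rho R) = 1 / measure rho R'"
        using c measure_CZ_set_pos[OF R(1)] by (simp only: abs_of_pos) (simp add: c_def)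
      then show "norm (complex_of_real c) * (1 / measure rho R) \<le> 1 / measure rho R'"
        by (simp only: norm_of_real)
    qed
    have "complex_of_real c * (\<integral>x. u x * b x \<partial>rho) = (\<integral>x. u x * (complex_of_real c * b x) \<partial>rho)"
      by (simp add: mult.left_commute)
    also have "\<dots> = (\<integral>x. f x * S (\<lambda>x. complex_of_real c * b x) x \<partial>rho)"
      using u c' unfolding represents_on_def by blast
    finally have *: "complex_of_real c * (\<integral>x. u x * b x \<partial>rho) = (\<integral>x. f x * S (\<lambda>x. complex_of_real c * b x) x \<partial>rho)" .
    have "(\<integral>x. f x * S (\<lambda>x. complex_of_real c * b x) x \<partial>rho) = (\<integral>x. complex_of_real c * (f x * S b x) \<partial>rho)"
      using bounded_on_L2_cmult[OF S.bounded_L2 bsq, of "complex_of_real c"] fm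
        square_integrable_measurable[OF bounded_on_L2_square_integrable[OF S.bounded_L2 bsq]]
        square_integrable_measurable[OF bounded_on_L2_square_integrable[OF S.bounded_L2
          square_integrable_cmult[OF bsq, of "complex_of_real c"]]]
      by (intro integral_cong_AE) (auto elim!: eventually_mono)
    then show ?thesis using * c by simp
  qed
  moreover have "set_integrable rho R u"
    using ui CZ_set_measurable[OF R(1)] R(3) by (intro set_integrable_subset[OF ui]) auto
  ultimately show ?thesis unfolding represents_on_def using um by blast
qed

end

lemma suminf_indicator_disjointed:
  fixes A :: "nat \<Rightarrow> 'a set" and w :: "nat \<Rightarrow> complex"
  assumes "x \<in> disjointed A j"
  shows "(\<Sum>n. indicator (disjointed A n) x * w n) = w j"
proof -
  have "x \<notin> disjointed A n" if "n \<noteq> j" for n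
    using disjoint_family_disjointed[of A] that assms unfolding disjoint_family_on_def by blast
  then have "(\<Sum>n. indicator (disjointed A n) x * w n) = (\<Sum>n\<in>{j}. indicator (disjointed A n) x * w n)"
    by (intro suminf_finite) auto
  then show ?thesis using assms by simp
qed

lemma CZ_exhaustion_borel [measurable]: "CZ_exhaustion q n \<in> sets borel"
  using CZ_set_measurable CZ_exhaustion_in_CZ_sets by blast

context transposed_pair
begin

lemma represents_on_diff_const:
  assumes R: "R \<in> CZ_sets" and f: "f \<in> Linf" and u: "represents_on R f u" and v: "represents_on R f v"
  obtains c where "AE x in rho. x \<in> R \<longrightarrow> u x - v x = c"
proof -
  let ?d = "\<lambda>x. u x - v x"
  have um: "u \<in> borel_measurable borel" and vm: "v \<in> borel_measurable borel"
    and ui: "set_integrable rho R u" and vi: "set_integrable rho R v"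
    using u v by (auto simp: represents_on_def)
  have "(\<integral>x. ?d x * b x \<partial>rho) = 0" if b: "cancelling R (1 / measure rho R) b" for b
  proof -
    note bD = cancellingD(1-3)[OF b]
    have "integrable rho (\<lambda>x. u x * b x)" "integrable rho (\<lambda>x. v x * b x)"
      using integrable_set_integrable_times_bounded[OF CZ_set_measurable[OF R] ui um bD]
        integrable_set_integrable_times_bounded[OF CZ_set_measurable[OF R] vi vm bD] by blast+
    moreover have "(\<integral>x. u x * b x \<partial>rho) = (\<integral>x. v x * b x \<partial>rho)"
      using u v b by (simp add: represents_on_def)
    ultimately show ?thesis by (simp add: left_diff_distrib)
  qed
  moreover have "?d \<in> borel_measurable borel" using um vm by measurable
  moreover have "set_integrable rho R ?d" using ui vi by (rule set_integral_diff)
  ultimately have "AE x in rho. x \<in> R \<longrightarrow> ?d x = average R ?d"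
    using AE_eq_average_of_cancelling[OF R, of ?d] by blast
  then show ?thesis by (rule that)
qed

lemma represents_on_minus_const:
  assumes R: "R \<in> CZ_sets" and u: "represents_on R f u"
  shows "represents_on R f (\<lambda>x. u x - c)"
proof -
  have um: "u \<in> borel_measurable borel" and ui: "set_integrable rho R u"
    using u by (auto simp: represents_on_def)
  have "set_integrable rho R (\<lambda>x. c)"
    using square_integrable_set_integrable[of "indicator R" R] CZ_set_measurable[OF R] emeasure_CZ_set_finite[OF R]
    by (simp add: set_integrable_def)
  then have "set_integrable rho R (\<lambda>x. u x - c)" using ui by (intro set_integral_diff)
  moreover have "(\<integral>x. (u x - c) * b x \<partial>rho) = (\<integral>x. u x * b x \<partial>rho)"
    if b: "cancelling R (1 / measure rho R) b" for b
  proof -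
    note bD = cancellingD[OF b]
    have "integrable rho (\<lambda>x. u x * b x)"
      by (rule integrable_set_integrable_times_bounded[OF CZ_set_measurable[OF R] ui um bD(1-3)])
    then show ?thesis using cancelling_square_integrable(2)[OF R b] bD(4)
      by (simp add: left_diff_distrib)
  qed
  ultimately show ?thesis using u um unfolding represents_on_def by simp
qed

text \<open>
  On one orthant, local representatives on the exhausting sets, normalised to have integral $0$ on
  the smallest of them, agree almost everywhere where they are both defined. They are glued along
  the increments of the exhaustion.
\<close>

lemma represents_on_orthant:
  assumes H: "S.hormander A" and f: "f \<in> Linf" and q: "q \<in> orthants"
  obtains u where "u \<in> borel_measurable borel" "\<And>n. represents_on (CZ_exhaustion q n) f u"
    "\<And>x. x \<notin> (\<Union>n. CZ_exhaustion q n) \<Longrightarrow> u x = 0"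
proof -
  let ?E = "CZ_exhaustion q"
  note E = CZ_exhaustion_in_CZ_sets[of q]
  have fm: "f \<in> borel_measurable borel" using Linf_measurable[OF f] by simp
  have "\<exists>w. represents_on (?E n) f w \<and> (\<integral>x. indicator (?E 0) x * w x \<partial>rho) = 0" for n
  proof -
    obtain u where u: "represents_on (?E n) f u" using represents_on_exists[OF H E f] by metis
    define c where "c = average (?E 0) u"
    have ui: "set_integrable rho (?E 0) u"
      using represents_on_subset[OF u fm E E CZ_exhaustion_mono[OF q]] by (simp add: represents_on_def)
    have m: "measure rho (?E 0) > 0" by (rule measure_CZ_set_pos[OF E])
    have indi: "integrable rho (indicator (?E 0) :: _ \<Rightarrow> complex)"
      and int_ind: "(\<integral>x. indicator (?E 0) x \<partial>rho) = complex_of_real (measure rho (?E 0))"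
      using indicator_integral_complex[of "?E 0" rho] emeasure_CZ_set_finite[OF E] by auto
    have "(\<integral>x. indicator (?E 0) x * (u x - c) \<partial>rho)
        = (\<integral>x. indicator (?E 0) x * u x \<partial>rho) - (\<integral>x. indicator (?E 0) x * c \<partial>rho)"
      unfolding right_diff_distrib using ui indi
      by (intro Bochner_Integration.integral_diff) (auto simp: set_integral_eq_indicator)
    also have "\<dots> = 0"
      using m int_ind unfolding c_def average_def set_integral_eq_indicator
      by (simp add: scaleR_conv_of_real)
    finally show ?thesis using represents_on_minus_const[OF E u] by blast
  qed
  then obtain w where w: "\<And>n. represents_on (?E n) f (w n)"
    and w0: "\<And>n. (\<integral>x. indicator (?E 0) x * w n x \<partial>rho) = 0" by metis
  have wm: "w n \<in> borel_measurable borel" for n using w by (simp add: represents_on_def)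
  have compat: "AE x in rho. x \<in> ?E m \<longrightarrow> w m x = w n x" if "m \<le> n" for m n
  proof -
    have wn: "represents_on (?E m) f (w n)"
      by (rule represents_on_subset[OF w fm E E CZ_exhaustion_mono[OF q that]])
    obtain c where c: "AE x in rho. x \<in> ?E m \<longrightarrow> w m x - w n x = c"
      by (rule represents_on_diff_const[OF E[of m] f w[of m] wn])
    have sub: "?E 0 \<subseteq> ?E m" by (intro CZ_exhaustion_mono q) simp
    have i: "integrable rho (\<lambda>x. indicator (?E 0) x * w j x)" for j
      using represents_on_subset[OF w fm E E CZ_exhaustion_mono[OF q, of 0 j]]
      by (simp add: represents_on_def set_integral_eq_indicator)
    have "0 = (\<integral>x. indicator (?E 0) x * w m x - indicator (?E 0) x * w n x \<partial>rho)"
      using i w0 by simp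
    also have "\<dots> = (\<integral>x. c * complex_of_real (indicator (?E 0) x) \<partial>rho)"
    proof (rule integral_cong_AE)
      show "AE x in rho. indicator (?E 0) x * w m x - indicator (?E 0) x * w n x = c * complex_of_real (indicator (?E 0) x)"
        using c by eventually_elim (use sub in \<open>auto simp: indicator_def\<close>)
      show "(\<lambda>x. indicator (?E 0) x * w m x - indicator (?E 0) x * w n x) \<in> borel_measurable rho"
        using wm[of m] wm[of n] by measurable
      have "(\<lambda>x. complex_of_real (indicator (?E 0) x)) \<in> borel_measurable rho" by measurable
      then show "(\<lambda>x. c * complex_of_real (indicator (?E 0) x)) \<in> borel_measurable rho"
        by (intro borel_measurable_times borel_measurable_const)
    qed
    also have "\<dots> = c * complex_of_real (measure rho (?E 0))"
      by (simp add: integral_complex_of_real)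
    finally have "c = 0" using measure_CZ_set_pos[OF E, of 0] by simp
    then show ?thesis using c by auto
  qed
  define u where "u x = (\<Sum>n. indicator (disjointed ?E n) x * w n x)" for x
  have um: "u \<in> borel_measurable borel"
  proof -
    have "disjointed ?E n \<in> sets borel" for n unfolding disjointed_def by measurable
    then show ?thesis unfolding u_def using wm by measurable
  qed
  have eq: "AE x in rho. x \<in> ?E n \<longrightarrow> u x = w n x" for n
  proof -
    have "AE x in rho. \<forall>m\<in>{..n}. x \<in> ?E m \<longrightarrow> w m x = w n x"
      using compat by (intro AE_ball_countable[THEN iffD2]) auto
    then show ?thesis
    proof eventually_elim
      case (elim x)
      show ?case
      proof
        assume x: "x \<in> ?E n"
        then have "x \<in> (\<Union>m\<in>{0..<Suc n}. disjointed ?E m)" unfolding finite_UN_disjointed_eq by auto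
        then obtain m where m: "m \<le> n" "x \<in> disjointed ?E m" by (auto simp: less_Suc_eq_le)
        then have "u x = w m x" unfolding u_def by (intro suminf_indicator_disjointed)
        also have "\<dots> = w n x" using elim m disjointed_subset[of ?E m] by auto
        finally show "u x = w n x" .
      qed
    qed
  qed
  have "represents_on (?E n) f u" for n
  proof -
    have wi: "set_integrable rho (?E n) (w n)" using w by (simp add: represents_on_def)
    have "integrable rho (\<lambda>x. indicator (?E n) x * u x) \<longleftrightarrow> integrable rho (\<lambda>x. indicator (?E n) x * w n x)"
      using eq[of n] um wm[of n]
      by (intro integrable_cong_AE) (auto elim!: eventually_mono simp: indicator_def)
    then have "set_integrable rho (?E n) u" using wi by (simp add: set_integral_eq_indicator)
    moreover have "(\<integral>x. u x * b x \<partial>rho) = (\<integral>x. f x * S b x \<partial>rho)"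
      if b: "cancelling (?E n) (1 / measure rho (?E n)) b" for b
    proof -
      have "(\<integral>x. u x * b x \<partial>rho) = (\<integral>x. w n x * b x \<partial>rho)"
      proof (rule integral_cong_AE)
        show "AE x in rho. u x * b x = w n x * b x"
          using eq[of n]
        proof eventually_elim
          case (elim x)
          then show ?case using cancellingD(3)[OF b, of x] by (cases "x \<in> ?E n") auto
        qed
      qed (use um wm[of n] cancellingD(1)[OF b] in \<open>auto\<close>)
      also have "\<dots> = (\<integral>x. f x * S b x \<partial>rho)" using w b by (simp add: represents_on_def)
      finally show ?thesis .
    qed
    ultimately show ?thesis unfolding represents_on_def using um by blast
  qed
  moreover have "u x = 0" if "x \<notin> (\<Union>n. ?E n)" for x
  proof -
    have "x \<notin> disjointed ?E n" for n using that disjointed_subset[of ?E n] by blast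
    then show ?thesis by (simp add: u_def)
  qed
  ultimately show ?thesis using um that by blast
qed

text \<open>
  The global form of the equation. It leaves a constant on each orthant undetermined.
\<close>

definition represents :: "'n cfun \<Rightarrow> 'n cfun \<Rightarrow> bool" where
  "represents f u \<longleftrightarrow> f \<in> Linf \<and> u \<in> L1_loc \<and> (\<forall>R\<in>CZ_sets. represents_on R f u)"

lemma represents_exists:
  assumes H: "S.hormander A" and f: "f \<in> Linf"
  obtains u where "represents f u"
proof -
  have fm: "f \<in> borel_measurable borel" using Linf_measurable[OF f] by simp
  have "\<exists>u. u \<in> borel_measurable borel \<and> (\<forall>n. represents_on (CZ_exhaustion q n) f u) \<and>
      (\<forall>x. x \<notin> (\<Union>n. CZ_exhaustion q n) \<longrightarrow> u x = 0)" if "q \<in> orthants" for q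
    using represents_on_orthant[OF H f that] by metis
  then obtain v where v: "\<And>q. q \<in> orthants \<Longrightarrow> v q \<in> borel_measurable borel"
    "\<And>q n. q \<in> orthants \<Longrightarrow> represents_on (CZ_exhaustion q n) f (v q)"
    "\<And>q x. q \<in> orthants \<Longrightarrow> x \<notin> (\<Union>n. CZ_exhaustion q n) \<Longrightarrow> v q x = 0"
    by metis
  define u where "u x = (\<Sum>q\<in>orthants. v q x)" for x
  have um: "u \<in> borel_measurable borel" unfolding u_def using v(1) by (intro borel_measurable_sum)
  have eq: "u x = v q x" if q: "q \<in> orthants" and x: "x \<in> CZ_exhaustion q n" for q x n
  proof -
    have "v q' x = 0" if "q' \<in> orthants - {q}" for q'
    proof (rule v(3))
      show "x \<notin> (\<Union>n. CZ_exhaustion q' n)"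
        using that orthant_of_eq[OF q x] orthant_of_eq[of q' x] by blast
    qed (use that in auto)
    then have "u x = (\<Sum>q'\<in>{q}. v q' x)"
      unfolding u_def using q finite_orthants by (intro sum.mono_neutral_right) auto
    then show ?thesis by simp
  qed
  have rep_ex: "represents_on (CZ_exhaustion q n) f u" if q: "q \<in> orthants" for q n
  proof -
    let ?E = "CZ_exhaustion q n"
    note r = v(2)[OF q, of n]
    have "(\<lambda>x. indicator ?E x * u x) = (\<lambda>x. indicator ?E x * v q x)"
      using eq[OF q, of _ n] by (auto simp: indicator_def fun_eq_iff)
    then have "set_integrable rho ?E u" using r by (simp add: represents_on_def set_integral_eq_indicator)
    moreover have "(\<integral>x. u x * b x \<partial>rho) = (\<integral>x. f x * S b x \<partial>rho)" if b: "cancelling ?E (1 / measure rho ?E) b" for b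
    proof -
      have "u x * b x = v q x * b x" for x
        using eq[OF q, of x n] cancellingD(3)[OF b, of x] by (cases "x \<in> ?E") auto
      then have "(\<integral>x. u x * b x \<partial>rho) = (\<integral>x. v q x * b x \<partial>rho)" by presburger
      then show ?thesis using r b by (simp add: represents_on_def)
    qed
    ultimately show ?thesis unfolding represents_on_def using um by blast
  qed
  have rep: "represents_on R f u" if R: "R \<in> CZ_sets" for R
  proof -
    obtain q n where q: "q \<in> orthants" "R \<subseteq> CZ_exhaustion q n"
      using CZ_set_in_CZ_exhaustion[OF R] by metis
    show ?thesis by (rule represents_on_subset[OF rep_ex[OF q(1)] fm R CZ_exhaustion_in_CZ_sets q(2)])
  qed
  have "set_integrable rho C u" if C: "compact C" "C \<subseteq> half_space" for C
  proof -
    obtain n where n: "\<And>p. p \<in> C \<Longrightarrow> p \<in> CZ_exhaustion (orthant_of p) n"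
      using compact_in_CZ_exhaustion[OF C] by metis
    have "set_integrable rho (\<Union>q\<in>orthants. CZ_exhaustion q n) u"
    proof (rule set_integrable_UN[OF finite_orthants])
      show "set_integrable rho (CZ_exhaustion q n) u" if "q \<in> orthants" for q
        using rep_ex[OF that, of n] by (simp add: represents_on_def)
    qed simp
    moreover have "C \<in> sets rho" using C(1) by (simp add: borel_compact)
    moreover have "C \<subseteq> (\<Union>q\<in>orthants. CZ_exhaustion q n)"
      using n orthant_of_in_orthants by (intro subsetI UN_I)
    ultimately show ?thesis by (rule set_integrable_subset)
  qed
  then have "u \<in> L1_loc" using um by (simp add: L1_loc_def)
  then show ?thesis using that rep f unfolding represents_def by blast
qed

lemma L1_loc_CZ_set_integrable:
  assumes "u \<in> L1_loc" "R \<in> CZ_sets"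
  shows "set_integrable rho R u"
proof -
  obtain C where "compact C" "C \<subseteq> half_space" "R \<subseteq> C" using CZ_set_compact_hull[OF assms(2)] by metis
  then show ?thesis
    using assms(1) CZ_set_measurable[OF assms(2)] unfolding L1_loc_def
    by (auto intro: set_integrable_subset)
qed

lemma representsI:
  assumes "f \<in> Linf" "u \<in> L1_loc"
    "\<And>R b. R \<in> CZ_sets \<Longrightarrow> cancelling R (1 / measure rho R) b \<Longrightarrow> (\<integral>x. u x * b x \<partial>rho) = (\<integral>x. f x * S b x \<partial>rho)"
  shows "represents f u"
  unfolding represents_def represents_on_def
  using assms L1_loc_CZ_set_integrable by (auto simp: L1_loc_def)

lemma representsD:
  assumes "represents f u" "R \<in> CZ_sets" "cancelling R (1 / measure rho R) b"
  shows "(\<integral>x. u x * b x \<partial>rho) = (\<integral>x. f x * S b x \<partial>rho)" "integrable rho (\<lambda>x. u x * b x)"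
proof -
  have r: "represents_on R f u" using assms unfolding represents_def by blast
  show "(\<integral>x. u x * b x \<partial>rho) = (\<integral>x. f x * S b x \<partial>rho)"
    using r assms(3) unfolding represents_on_def by blast
  show "integrable rho (\<lambda>x. u x * b x)"
    using r integrable_set_integrable_times_bounded[OF CZ_set_measurable[OF assms(2)] _ _ cancellingD(1-3)[OF assms(3)], of u]
    by (simp add: represents_on_def)
qed

text \<open>
  Every $u$ that represents $f$ has the right oscillation, and $Tf$ represents $f$ when $f$ is in
  $L^2$. Since the representing functions differ by constants that may vary from orthant to
  orthant, an arbitrary choice would be linear and would extend $T$ only modulo such functions;
  the linear selection makes both hold almost everywhere.
\<close>

theorem extends_Linf_BMO:
  assumes H: "S.hormander A"
  shows "extends_Linf_BMO T"
proof -
  obtain C where C: "C > 0" "\<And>a. atom a \<Longrightarrow> integrable rho (S a)"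
      "\<And>a. atom a \<Longrightarrow> (\<integral>x. norm (S a x) \<partial>rho) \<le> C"
    using S.atom_image_L1[OF H] by metis
  have add: "represents (\<lambda>x. f x + g x) (\<lambda>x. u x + v x)" if p: "represents f u" "represents g v" for f g u v
  proof (rule representsI)
    show "(\<lambda>x. f x + g x) \<in> Linf" using p by (intro Linf_add) (auto simp: represents_def)
    have uv: "u \<in> L1_loc" "v \<in> L1_loc" using p by (auto simp: represents_def)
    then show "(\<lambda>x. u x + v x) \<in> L1_loc" unfolding L1_loc_def by (auto intro: set_integral_add)
    fix R :: "'n pt set" and b assume R: "R \<in> CZ_sets" and b: "cancelling R (1 / measure rho R) b"
    have Sb: "integrable rho (S b)" by (rule C(2)[OF cancelling_imp_atom[OF R b]])
    show "(\<integral>x. (u x + v x) * b x \<partial>rho) = (\<integral>x. (f x + g x) * S b x \<partial>rho)"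
      using representsD[OF p(1) R b] representsD[OF p(2) R b]
        integrable_Linf_times(1)[OF _ Sb, of f] integrable_Linf_times(1)[OF _ Sb, of g] p
      by (simp add: represents_def distrib_right)
  qed
  have cmult: "represents (\<lambda>x. c * f x) (\<lambda>x. c * u x)" if p: "represents f u" for c f u
  proof (rule representsI)
    show "(\<lambda>x. c * f x) \<in> Linf" using p by (intro Linf_cmult) (auto simp: represents_def)
    have u: "u \<in> L1_loc" using p by (auto simp: represents_def)
    then show "(\<lambda>x. c * u x) \<in> L1_loc" unfolding L1_loc_def by (auto intro: set_integrable_mult_right)
    fix R :: "'n pt set" and b assume R: "R \<in> CZ_sets" and b: "cancelling R (1 / measure rho R) b"
    show "(\<integral>x. (c * u x) * b x \<partial>rho) = (\<integral>x. (c * f x) * S b x \<partial>rho)"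
      using representsD[OF p R b] by (simp add: mult.assoc)
  qed
  let ?W = "Linf \<inter> {f. square_integrable rho f}"
  let ?Q = "\<lambda>f u. represents f u \<and> square_integrable rho f \<and> ae_eq u (T f)"
  have TW: "represents f (T f)" if f: "f \<in> Linf" "square_integrable rho f" for f
  proof (rule representsI[OF f(1)])
    have Tf: "square_integrable rho (T f)" by (rule bounded_on_L2_square_integrable[OF T.bounded_L2 f(2)])
    have "set_integrable rho K (T f)" if "compact K" "K \<subseteq> half_space" for K
      using square_integrable_set_integrable[OF Tf borel_compact[OF that(1)] emeasure_rho_compact[OF that]] .
    then show "T f \<in> L1_loc"
      unfolding L1_loc_def using square_integrable_measurable[OF Tf] by simp
    fix R :: "'n pt set" and b assume R: "R \<in> CZ_sets" and b: "cancelling R (1 / measure rho R) b"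
    show "(\<integral>x. T f x * b x \<partial>rho) = (\<integral>x. f x * S b x \<partial>rho)"
      using transpose f(2) cancelling_square_integrable(1)[OF R b] by (simp add: is_transpose_def)
  qed
  obtain U where U: "\<And>f g. U (\<lambda>x. f x + g x) = (\<lambda>x. U f x + U g x)"
    "\<And>c f. U (\<lambda>x. c * f x) = (\<lambda>x. c * U f x)"
    "\<And>f. f \<in> Linf \<Longrightarrow> represents f (U f)" "\<And>f. f \<in> ?W \<Longrightarrow> ?Q f (U f)"
  proof (rule linear_selection[where P = represents and X = Linf and Q = ?Q and W = ?W])
    show "\<exists>u. represents f u" if "f \<in> Linf" for f using represents_exists[OF H that] by metis
    show "\<exists>u. ?Q f u" if "f \<in> ?W" for f using TW[of f] that by (auto simp: ae_eq_def)
    show "?Q (\<lambda>x. f x + g x) (\<lambda>x. u x + v x)" if fu: "?Q f u" and gv: "?Q g v" for f g u v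
    proof (intro conjI)
      have eqs: "AE x in rho. u x = T f x" "AE x in rho. v x = T g x"
        "AE x in rho. T (\<lambda>x. f x + g x) x = T f x + T g x"
        using fu gv bounded_on_L2_add[OF T.bounded_L2, of f g] by (auto simp: ae_eq_def)
      show "ae_eq (\<lambda>x. u x + v x) (T (\<lambda>x. f x + g x))"
        unfolding ae_eq_def using eqs by eventually_elim simp
      show "represents (\<lambda>x. f x + g x) (\<lambda>x. u x + v x)" using add fu gv by blast
      show "square_integrable rho (\<lambda>x. f x + g x)" using square_integrable_add fu gv by blast
    qed
    show "?Q (\<lambda>x. c * f x) (\<lambda>x. c * u x)" if fu: "?Q f u" for c f u
    proof (intro conjI)
      have eqs: "AE x in rho. u x = T f x" "AE x in rho. T (\<lambda>x. c * f x) x = c * T f x"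
        using fu bounded_on_L2_cmult[OF T.bounded_L2, of f c] by (auto simp: ae_eq_def)
      show "ae_eq (\<lambda>x. c * u x) (T (\<lambda>x. c * f x))"
        unfolding ae_eq_def using eqs by eventually_elim simp
      show "represents (\<lambda>x. c * f x) (\<lambda>x. c * u x)" using cmult fu by blast
      show "square_integrable rho (\<lambda>x. c * f x)" using square_integrable_cmult fu by blast
    qed
    have "(\<lambda>x. 0) \<in> Linf" by (rule LinfI[where B = 0]) auto
    then show "(\<lambda>x. 0) \<in> ?W" by (simp add: square_integrable_def)
    show "represents (\<lambda>x. f x + g x) (\<lambda>x. u x + v x)" if "represents f u" "represents g v" for f g u v
      by (rule add[OF that])
    show "represents (\<lambda>x. c * f x) (\<lambda>x. c * u x)" if "represents f u" for c f u
      by (rule cmult[OF that])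
    show "?W \<subseteq> Linf" by blast
    show "represents f u" if "?Q f u" for f u using that by blast
  qed (use that in blast)
  have bound: "BMO_norm (U f) \<le> ennreal (2 * C) * Linf_norm f" if f: "f \<in> Linf" for f
  proof -
    let ?L = "enn2real (Linf_norm f)"
    have r: "represents f (U f)" by (rule U(3)[OF f])
    have "BMO_norm (U f) \<le> ennreal (2 * (?L * C))"
    proof (rule BMO_norm_le)
      have Ul: "U f \<in> L1_loc" using r by (simp add: represents_def)
      then show "U f \<in> borel_measurable borel" by (simp add: L1_loc_def)
      show "set_integrable rho R (U f)" if "R \<in> CZ_sets" for R
        by (rule L1_loc_CZ_set_integrable[OF Ul that])
      fix R :: "'n pt set" and b assume R: "R \<in> CZ_sets" and b: "cancelling R (1 / measure rho R) b"
      note at = cancelling_imp_atom[OF R b]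
      have "norm (\<integral>x. U f x * b x \<partial>rho) \<le> ?L * (\<integral>x. norm (S b x) \<partial>rho)"
        unfolding representsD(1)[OF r R b] by (rule integrable_Linf_times(2)[OF f C(2)[OF at]])
      also have "\<dots> \<le> ?L * C" using C(3)[OF at] by (intro mult_left_mono) auto
      finally show "norm (\<integral>x. U f x * b x \<partial>rho) \<le> ?L * C" .
    qed
    also have "\<dots> = ennreal (2 * C) * ennreal ?L"
      using C(1) by (simp add: ennreal_mult[symmetric] mult_ac)
    finally show ?thesis using Linf_AE_bound(2)[OF f] by simp
  qed
  have BMO: "U f \<in> BMO" if f: "f \<in> Linf" for f
  proof -
    have "ennreal (2 * C) * Linf_norm f < \<infinity>"
      using f by (simp add: Linf_def ennreal_mult_less_top)
    then have "BMO_norm (U f) < \<infinity>" using bound[OF f] by (rule le_less_trans[rotated])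
    then show ?thesis using U(3)[OF f] by (simp add: BMO_def represents_def)
  qed
  have agree: "eq_mod_const (U f) (T f)" if "f \<in> Linf \<inter> Lp 2" for f
    using U(4)[of f] that unfolding eq_mod_const_def ae_eq_def Lp2_iff
    by (intro exI[of _ 0]) (auto simp: Lp2_iff)
  have lin: "linear_on_upto eq_mod_const Linf U"
    unfolding linear_on_upto_def eq_mod_const_def U(1,2) by (auto intro!: exI[of _ 0])
  show ?thesis
    unfolding extends_Linf_BMO_def
    using lin BMO bound agree by (intro exI[of _ U] conjI ballI exI[of _ "2 * C"]) auto
qed

end

section \<open>The boundedness theorem\<close>

lemma singular_integralI:
  fixes T :: "'n::finite cfun \<Rightarrow> 'n cfun"
  assumes CZ: "CZ_data \<kappa> xR rR" and T: "bounded_on_L2 T" "regular_kernel T k"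
  shows "singular_integral T k (dilated rR) \<kappa>"
proof
  fix R :: "'n pt set" assume R: "R \<in> CZ_sets"
  have d: "rR R > 0" "emeasure rho (dilated rR R) \<le> ennreal \<kappa> * emeasure rho R"
    using CZ R unfolding CZ_data_def by blast+
  show "open (dilated rR R)"
    by (rule open_dilated[OF CZ_set_subset_half_space[OF R] CZ_set_nonempty[OF R]])
  show "R \<subseteq> dilated rR R" by (rule subset_dilated[where rR = rR, OF CZ_set_subset_half_space[OF R] d(1)])
  show "emeasure rho (dilated rR R) \<le> ennreal \<kappa> * emeasure rho R" by (rule d(2))
qed (use T in auto)

text \<open>
  A point off the dilated set differs from all points of $R$, so only values of the kernel off the
  diagonal enter the condition, where $J$ and $k$ agree.
\<close>

lemma hormander_of_SUP:
  fixes J :: "'n::finite pt \<Rightarrow> 'n pt \<Rightarrow> complex"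
  assumes si: "singular_integral T k (dilated rR) \<kappa>"
    and fin: "(SUP R\<in>CZ_sets. SUP y\<in>R. SUP z\<in>R.
            (\<integral>\<^sup>+x\<in>half_space - dilated rR R. ennreal (norm (J x y - J x z)) \<partial>rho)) < \<infinity>"
    and eq: "\<And>x y. (x, y) \<in> offdiag \<Longrightarrow> k x y = J x y"
  obtains A where "singular_integral.hormander k (dilated rR) A"
proof -
  interpret singular_integral T k "dilated rR" \<kappa> by (rule si)
  let ?I = "\<lambda>R y z. \<integral>\<^sup>+x\<in>half_space - dilated rR R. ennreal (norm (J x y - J x z)) \<partial>rho"
  let ?s = "SUP R\<in>CZ_sets. SUP y\<in>R. SUP z\<in>R. ?I R y z"
  have "(\<integral>\<^sup>+x\<in>half_space - dilated rR R. ennreal (norm (k x y - k x z)) \<partial>rho) \<le> ennreal (enn2real ?s)"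
    if R: "R \<in> CZ_sets" and y: "y \<in> R" and z: "z \<in> R" for R y z
  proof -
    have off: "(x, w) \<in> offdiag" if "x \<in> half_space - dilated rR R" "w \<in> R" for x w
      using that subset_D[OF R] CZ_set_subset_half_space[OF R] by (auto simp: offdiag_def)
    have "(\<integral>\<^sup>+x\<in>half_space - dilated rR R. ennreal (norm (k x y - k x z)) \<partial>rho) = ?I R y z"
    proof (rule nn_integral_cong)
      fix x
      show "ennreal (norm (k x y - k x z)) * indicator (half_space - dilated rR R) x
          = ennreal (norm (J x y - J x z)) * indicator (half_space - dilated rR R) x"
      proof (cases "x \<in> half_space - dilated rR R")
        case True
        then show ?thesis using eq[OF off[OF True y]] eq[OF off[OF True z]] by simp
      next
        case False
        then show ?thesis by (auto simp: indicator_def)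
      qed
    qed
    also have "\<dots> \<le> (SUP z\<in>R. ?I R y z)" by (rule SUP_upper[OF z])
    also have "\<dots> \<le> (SUP y\<in>R. SUP z\<in>R. ?I R y z)"
      by (rule SUP_upper[OF y, where f = "\<lambda>y. SUP z\<in>R. ?I R y z"])
    also have "\<dots> \<le> ?s"
      by (rule SUP_upper[OF R, where f = "\<lambda>R. SUP y\<in>R. SUP z\<in>R. ?I R y z"])
    also have "\<dots> = ennreal (enn2real ?s)" using fin by simp
    finally show ?thesis .
  qed
  then have "hormander (enn2real ?s)" unfolding hormander_def by simp
  then show ?thesis by (rule that)
qed

theorem theorem4p1:
  fixes T :: "'n::finite cfun \<Rightarrow> 'n cfun"
    and K :: "'n pt \<Rightarrow> 'n pt \<Rightarrow> complex"
    and \<kappa> :: real and xR :: "'n pt set \<Rightarrow> 'n pt" and rR :: "'n pt set \<Rightarrow> real"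
  assumes "CZ_data \<kappa> xR rR"
    and "bounded_on_L2 T"
    and "has_kernel T K"
  shows "((SUP R\<in>CZ_sets. SUP y\<in>R. SUP z\<in>R.
            (\<integral>\<^sup>+x\<in>half_space - dilated rR R. ennreal (norm (K x y - K x z)) \<partial>rho)) < \<infinity>
          \<longrightarrow> extends_H1_L1 T) \<and>
         ((SUP R\<in>CZ_sets. SUP y\<in>R. SUP z\<in>R.
            (\<integral>\<^sup>+x\<in>half_space - dilated rR R. ennreal (norm (K y x - K z x)) \<partial>rho)) < \<infinity>
          \<longrightarrow> extends_Linf_BMO T)"
proof -
  define k where "k x y = (if (x, y) \<in> offdiag then K x y else 0)" for x y
  have k: "regular_kernel T k"
    using regular_kernel_of_has_kernel[OF assms(3)] by (simp add: k_def[abs_def])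
  have k_eq: "k x y = K x y" if "(x, y) \<in> offdiag" for x y using that by (simp add: k_def)
  obtain S where S: "is_transpose T S" using transpose_exists[OF assms(2)] by metis
  note siT = singular_integralI[OF assms(1,2) k]
  note siS = singular_integralI[OF assms(1) transpose_bounded_on_L2[OF assms(2) S]
      regular_kernel_transpose[OF assms(2) k S]]
  interpret T: singular_integral T k "dilated rR" \<kappa> by (rule siT)
  interpret transposed_pair T S k "dilated rR" \<kappa>
    by (intro transposed_pair.intro siT siS transposed_pair_axioms.intro S)
  show ?thesis
  proof (intro conjI impI)
    assume fin: "(SUP R\<in>CZ_sets. SUP y\<in>R. SUP z\<in>R.
            (\<integral>\<^sup>+x\<in>half_space - dilated rR R. ennreal (norm (K x y - K x z)) \<partial>rho)) < \<infinity>"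
    obtain A where "T.hormander A" by (rule hormander_of_SUP[OF siT fin k_eq])
    then show "extends_H1_L1 T" by (rule T.extends_H1_L1)
  next
    assume fin: "(SUP R\<in>CZ_sets. SUP y\<in>R. SUP z\<in>R.
            (\<integral>\<^sup>+x\<in>half_space - dilated rR R. ennreal (norm (K y x - K z x)) \<partial>rho)) < \<infinity>"
    have sym: "k y x = K y x" if "(x, y) \<in> offdiag" for x y
      using that by (intro k_eq) (auto simp: offdiag_def)
    obtain A where "S.hormander A" by (rule hormander_of_SUP[OF siS fin sym])
    then show "extends_Linf_BMO T" by (rule extends_Linf_BMO)
  qed
qed

end
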